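(* Let $\Gamma\in\{pm,cm,pg\}$. A $\Gamma$-gain graph $(G,m)$ is minimally rigid (in $\mathbb{R}^2$) if and only if it satisfies all of the following conditions: (1) $G$ is $(2,1)$-tight; (2) every purely periodic subgraph of $G$ is $(2,2)$-sparse; (3) every balanced subgraph of $G$ is $(2,3)$-sparse.
   Context: The groups: $pm=\mathbb{Z}^2\rtimes\mathcal{C}_s$ is the group of isometries of $\mathbb{R}^2$ of the form $x\mapsto \sigma(x)+(a,b)$ with $(a,b)\in\mathbb{Z}^2$ and $\sigma\in\mathcal{C}_s=\{\mathrm{id},s\}$, $s(x,y)=(x,-y)$; such an element is written $(a,b,\sigma)$, with $0$ in the last slot meaning $\mathrm{id}$. $pg$ is the subgroup of $pm$ generated by $(0,1,0)$ and $(1,0,s)$. $cm$ is the subgroup of $pm$ generated by $(1,1,0)$, $(1,-1,0)$ and $(0,0,s)$. Elements with $\sigma=\mathrm{id}$ are translations. For $\gamma\in\Gamma$, $\gamma_l$ denotes its linear part. Gain graphs: A $\Gamma$-gain graph $(G,m)$ is a finite multigraph $G=(V,E)$ (loops and parallel edges allowed) with each edge oriented and labelled by $m(e)\in\Gamma$, such that parallel edges (oriented the same way) have different gains and every loop has non-identity gain. An edge from $v_i$ to $v_j$ is written $(v_i,v_j;m(e))$; reversing its orientation while inverting its gain is regarded as giving the same edge. The net gain of a walk $e_1^{\alpha_1}\cdots e_k^{\alpha_k}$ ($\alpha_i=1$ if $e_i$ is traversed forwards, $-1$ if backwards) is $\prod_{i=1}^k m(e_i)^{\alpha_i}$. The gain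 space at a vertex $v$ is the subgroup of $\Gamma$ generated by the net gains of closed walks starting and ending at $v$. A gain graph (or subgraph, with the restricted gains) is balanced if its gain space at every vertex is trivial, and purely periodic if its gain space at every vertex consists only of translations. Sparsity: A multigraph is $(k,l)$-sparse if every subgraph $(V',E')$ with $|E'|\ge 1$ satisfies $|E'|\le k|V'|-l$; it is $(k,l)$-tight if moreover $|E|=k|V|-l$. Rigidity: The derived graph $\tilde G=(\tilde V,\tilde E)$ has $\tilde V=V\times\Gamma$, with $(v_i,\gamma_i)$ and $(v_j,\gamma_j)$ adjacent iff there is an edge $(v_i,v_j;\gamma_i^{-1}\gamma_j)$ in $(G,m)$. A map $p:V\to\mathbb{R}^2$ determines $\tilde p(v,\gamma)=\gamma(p(v))$; $p$ is a configuration if $\tilde p$ takes different values at the ends of each edge of $\tilde G$. A $\Gamma$-symmetric infinitesimal motion of $(\tilde G,\tilde p)$ is a map $\tilde u:\tilde V\to\mathbb{R}^2$ with $(\tilde p(x)-\tilde p(y))\cdot(\tilde u(x)-\tilde u(y))=0$ for all $xy\in\tilde E$ and $\tilde u(v,\gamma)=\gamma_l(\tilde u(v,\mathrm{id}))$ for all $(v,\gamma)$. It is trivial if it corresponds to a rigid body motion, i.e. $\tilde u(x)=A\tilde p(x)+b$ for some skew-symmetric $A$ and vector $b$. $(\tilde G,\tilde p)$ is $\Gamma$-symmetrically infinitesimally rigid if all its $\Gamma$-symmetric infinitesimal motions are trivial. The orbit rigidity matrix $\mathbf{O}(\tilde G,\tilde p,\Gamma)$ is the $|E|\times 2|V|$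 matrix whose row for a non-loop edge $e=(v_i,v_j;m(e))$ has $(p(v_i)-m(e)p(v_j))^T$ in the two columns of $v_i$, $(p(v_j)-m(e)^{-1}p(v_i))^T$ in those of $v_j$, and $0$ elsewhere, and whose row for a loop $e$ at $v_i$ has $(2p(v_i)-m(e)p(v_i)-m(e)^{-1}p(v_i))^T$ in the columns of $v_i$ and $0$ elsewhere. A configuration $p$ is generic if this matrix has the maximum rank over all configurations of $(G,m)$. $(G,m)$ is rigid if $(\tilde G,\tilde p)$ is $\Gamma$-symmetrically infinitesimally rigid for every (equivalently, some) generic $p$; independent if the orbit rigidity matrix is row-independent for generic $p$; minimally rigid if it is rigid and independent. *)

theory Defs
  imports
    "HOL-Analysis.Analysis"
    "HOL-Algebra.Generated_Groups"
    "Graph_Theory.Digraph_Component"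
begin

section \<open>The groups pm, cm and pg\<close>

type_synonym plane_map = "real^2 \<Rightarrow> real^2"

definition reflection :: plane_map where
  "reflection x = vector [x $ 1, - x $ 2]"

text \<open>\<open>isom a b \<sigma>\<close> is the element written $(a,b,\sigma)$, so the identity linear part,
  written $0$ in the triple notation, is \<open>id\<close>.\<close>

definition isom :: "int \<Rightarrow> int \<Rightarrow> plane_map \<Rightarrow> plane_map" where
  "isom a b \<sigma> = (\<lambda>x. \<sigma> x + vector [of_int a, of_int b])"

definition pm :: "plane_map monoid" where
  "pm = \<lparr>carrier = {isom a b \<sigma> |a b \<sigma>. \<sigma> \<in> {id, reflection}}, mult = (\<circ>), one = id\<rparr>"

definition pg :: "plane_map monoid" where
  "pg = subgroup_generated pm {isom 0 1 id, isom 1 0 reflection}"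

definition cm :: "plane_map monoid" where
  "cm = subgroup_generated pm {isom 1 1 id, isom 1 (-1) id, isom 0 0 reflection}"

text \<open>The linear part of an affine map.\<close>

definition linear_part :: "plane_map \<Rightarrow> plane_map" where
  "linear_part \<gamma> = (\<lambda>x. \<gamma> x - \<gamma> 0)"

definition translation_maps :: "plane_map set" where
  "translation_maps = {\<gamma>. linear_part \<gamma> = id}"

lemma linear_part_isom:
  "\<sigma> \<in> {id, reflection} \<Longrightarrow> linear_part (isom a b \<sigma>) = \<sigma>"
  by (auto simp: linear_part_def isom_def reflection_def vec_eq_iff forall_2 fun_eq_iff)

lemma isom_comp_id: "isom a b id \<circ> isom c d \<sigma> = isom (a + c) (b + d) \<sigma>"
  by (auto simp: isom_def vec_eq_iff forall_2 fun_eq_iff)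

lemma isom_comp_reflection:
  "isom a b reflection \<circ> isom c d \<sigma> = isom (a + c) (b - d) (reflection \<circ> \<sigma>)"
  by (auto simp: isom_def reflection_def vec_eq_iff forall_2 fun_eq_iff)

lemma reflection_reflection: "reflection \<circ> reflection = id"
  by (auto simp: reflection_def vec_eq_iff forall_2 fun_eq_iff)

lemma isom_0_0_id: "isom 0 0 id = id"
  by (auto simp: isom_def vec_eq_iff forall_2 fun_eq_iff)

lemma group_pm: "group pm"
proof (rule groupI)
  fix x y assume "x \<in> carrier pm" "y \<in> carrier pm"
  then show "x \<otimes>\<^bsub>pm\<^esub> y \<in> carrier pm"
    by (fastforce simp: pm_def isom_comp_id isom_comp_reflection reflection_reflection)
next
  show "\<one>\<^bsub>pm\<^esub> \<in> carrier pm"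
    by (auto simp: pm_def intro!: exI[of _ 0] isom_0_0_id[symmetric])
next
  fix x assume "x \<in> carrier pm"
  then obtain a b \<sigma> where x: "x = isom a b \<sigma>" "\<sigma> \<in> {id, reflection}"
    by (auto simp: pm_def)
  show "\<exists>y\<in>carrier pm. y \<otimes>\<^bsub>pm\<^esub> x = \<one>\<^bsub>pm\<^esub>"
  proof (cases "\<sigma> = id")
    case True
    then show ?thesis using x
      by (intro bexI[of _ "isom (-a) (-b) id"]) (auto simp: pm_def isom_comp_id isom_0_0_id)
  next
    case False
    then show ?thesis using x
      by (intro bexI[of _ "isom (-a) b reflection"])
        (auto simp: pm_def isom_comp_reflection reflection_reflection isom_0_0_id)
  qed
qed (auto simp: pm_def comp_assoc)

section \<open>Gain graphs\<close>

text \<open>The orientation is that of the digraph: the edge $(v_i, v_j; m(e))$ has tail $v_i$ and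
  head $v_j$. As an edge may be reversed by inverting its gain, antiparallel edges must not have
  mutually inverse gains; in particular two loops at a vertex have neither equal nor inverse
  gains. The vertex set of a graph is nonempty.\<close>

definition gain_graph ::
  "plane_map monoid \<Rightarrow> ('v, 'e) pre_digraph \<Rightarrow> ('e \<Rightarrow> plane_map) \<Rightarrow> bool" where
  "gain_graph \<Gamma> G m \<longleftrightarrow>
     fin_digraph G \<and> verts G \<noteq> {} \<and>
     (\<forall>e \<in> arcs G. m e \<in> carrier \<Gamma>) \<and>
     (\<forall>e \<in> arcs G. tail G e = head G e \<longrightarrow> m e \<noteq> \<one>\<^bsub>\<Gamma>\<^esub>) \<and>
     (\<forall>e \<in> arcs G. \<forall>f \<in> arcs G. e \<noteq> f \<and> tail G e = tail G f \<and> head G e = head G f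
        \<longrightarrow> m e \<noteq> m f) \<and>
     (\<forall>e \<in> arcs G. \<forall>f \<in> arcs G. e \<noteq> f \<and> tail G e = head G f \<and> head G e = tail G f
        \<longrightarrow> m e \<noteq> inv\<^bsub>\<Gamma>\<^esub> (m f))"

text \<open>A step \<open>(e, True)\<close> traverses \<open>e\<close> forwards, \<open>(e, False)\<close> backwards.\<close>

fun gain_walk :: "('v, 'e) pre_digraph \<Rightarrow> 'v \<Rightarrow> ('e \<times> bool) list \<Rightarrow> 'v \<Rightarrow> bool" where
  "gain_walk G u [] v \<longleftrightarrow> u \<in> verts G \<and> u = v"
| "gain_walk G u ((e, True) # w) v \<longleftrightarrow> e \<in> arcs G \<and> tail G e = u \<and> gain_walk G (head G e) w v"
| "gain_walk G u ((e, False) # w) v \<longleftrightarrow> e \<in> arcs G \<and> head G e = u \<and> gain_walk G (tail G e) w v"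

fun net_gain :: "plane_map monoid \<Rightarrow> ('e \<Rightarrow> plane_map) \<Rightarrow> ('e \<times> bool) list \<Rightarrow> plane_map" where
  "net_gain \<Gamma> m [] = \<one>\<^bsub>\<Gamma>\<^esub>"
| "net_gain \<Gamma> m ((e, True) # w) = m e \<otimes>\<^bsub>\<Gamma>\<^esub> net_gain \<Gamma> m w"
| "net_gain \<Gamma> m ((e, False) # w) = inv\<^bsub>\<Gamma>\<^esub> (m e) \<otimes>\<^bsub>\<Gamma>\<^esub> net_gain \<Gamma> m w"

definition gain_space ::
  "plane_map monoid \<Rightarrow> ('v, 'e) pre_digraph \<Rightarrow> ('e \<Rightarrow> plane_map) \<Rightarrow> 'v \<Rightarrow> plane_map set" where
  "gain_space \<Gamma> G m v = generate \<Gamma> {net_gain \<Gamma> m w |w. gain_walk G v w v}"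

definition balanced ::
  "plane_map monoid \<Rightarrow> ('v, 'e) pre_digraph \<Rightarrow> ('e \<Rightarrow> plane_map) \<Rightarrow> bool" where
  "balanced \<Gamma> G m \<longleftrightarrow> (\<forall>v \<in> verts G. gain_space \<Gamma> G m v = {\<one>\<^bsub>\<Gamma>\<^esub>})"

definition purely_periodic ::
  "plane_map monoid \<Rightarrow> ('v, 'e) pre_digraph \<Rightarrow> ('e \<Rightarrow> plane_map) \<Rightarrow> bool" where
  "purely_periodic \<Gamma> G m \<longleftrightarrow> (\<forall>v \<in> verts G. gain_space \<Gamma> G m v \<subseteq> translation_maps)"

section \<open>Sparsity\<close>

definition kl_sparse :: "int \<Rightarrow> int \<Rightarrow> ('v, 'e) pre_digraph \<Rightarrow> bool" where
  "kl_sparse k l G \<longleftrightarrow>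
     (\<forall>H. subgraph H G \<and> card (arcs H) \<ge> 1
        \<longrightarrow> int (card (arcs H)) \<le> k * int (card (verts H)) - l)"

definition kl_tight :: "int \<Rightarrow> int \<Rightarrow> ('v, 'e) pre_digraph \<Rightarrow> bool" where
  "kl_tight k l G \<longleftrightarrow> kl_sparse k l G \<and> int (card (arcs G)) = k * int (card (verts G)) - l"

section \<open>Symmetric rigidity of the derived framework\<close>

definition derived_verts ::
  "plane_map monoid \<Rightarrow> ('v, 'e) pre_digraph \<Rightarrow> ('v \<times> plane_map) set" where
  "derived_verts \<Gamma> G = verts G \<times> carrier \<Gamma>"

text \<open>The second disjunct accounts for the edge $(v_i, v_j; m(e))$ being the same as
  $(v_j, v_i; m(e)^{-1})$.\<close>

definition derived_adj ::
  "plane_map monoid \<Rightarrow> ('v, 'e) pre_digraph \<Rightarrow> ('e \<Rightarrow> plane_map)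
     \<Rightarrow> 'v \<times> plane_map \<Rightarrow> 'v \<times> plane_map \<Rightarrow> bool" where
  "derived_adj \<Gamma> G m x y \<longleftrightarrow>
     x \<in> derived_verts \<Gamma> G \<and> y \<in> derived_verts \<Gamma> G \<and>
     (\<exists>e \<in> arcs G.
        tail G e = fst x \<and> head G e = fst y \<and> m e = inv\<^bsub>\<Gamma>\<^esub> (snd x) \<otimes>\<^bsub>\<Gamma>\<^esub> snd y \<or>
        tail G e = fst y \<and> head G e = fst x \<and> m e = inv\<^bsub>\<Gamma>\<^esub> (snd y) \<otimes>\<^bsub>\<Gamma>\<^esub> snd x)"

definition derived_pos :: "('v \<Rightarrow> real^2) \<Rightarrow> 'v \<times> plane_map \<Rightarrow> real^2" where
  "derived_pos p = (\<lambda>(v, \<gamma>). \<gamma> (p v))"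

definition configuration ::
  "plane_map monoid \<Rightarrow> ('v, 'e) pre_digraph \<Rightarrow> ('e \<Rightarrow> plane_map) \<Rightarrow> ('v \<Rightarrow> real^2) \<Rightarrow> bool" where
  "configuration \<Gamma> G m p \<longleftrightarrow>
     (\<forall>x y. derived_adj \<Gamma> G m x y \<longrightarrow> derived_pos p x \<noteq> derived_pos p y)"

definition symmetric_motion ::
  "plane_map monoid \<Rightarrow> ('v, 'e) pre_digraph \<Rightarrow> ('e \<Rightarrow> plane_map) \<Rightarrow> ('v \<Rightarrow> real^2)
     \<Rightarrow> ('v \<times> plane_map \<Rightarrow> real^2) \<Rightarrow> bool" where
  "symmetric_motion \<Gamma> G m p u \<longleftrightarrow>
     (\<forall>x y. derived_adj \<Gamma> G m x y \<longrightarrow>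
        (derived_pos p x - derived_pos p y) \<bullet> (u x - u y) = 0) \<and>
     (\<forall>v \<in> verts G. \<forall>\<gamma> \<in> carrier \<Gamma>. u (v, \<gamma>) = linear_part \<gamma> (u (v, \<one>\<^bsub>\<Gamma>\<^esub>)))"

definition trivial_motion ::
  "plane_map monoid \<Rightarrow> ('v, 'e) pre_digraph \<Rightarrow> ('v \<Rightarrow> real^2)
     \<Rightarrow> ('v \<times> plane_map \<Rightarrow> real^2) \<Rightarrow> bool" where
  "trivial_motion \<Gamma> G p u \<longleftrightarrow>
     (\<exists>(A :: real^2^2) b. transpose A = - A \<and>
        (\<forall>x \<in> derived_verts \<Gamma> G. u x = A *v derived_pos p x + b))"

definition symmetrically_rigid ::
  "plane_map monoid \<Rightarrow> ('v, 'e) pre_digraph \<Rightarrow> ('e \<Rightarrow> plane_map) \<Rightarrow> ('v \<Rightarrow> real^2) \<Rightarrow> bool" where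
  "symmetrically_rigid \<Gamma> G m p \<longleftrightarrow>
     (\<forall>u. symmetric_motion \<Gamma> G m p u \<longrightarrow> trivial_motion \<Gamma> G p u)"

text \<open>The pair of entries of row \<open>e\<close> in the two columns of the vertex \<open>v\<close>.\<close>

definition orbit_entry ::
  "plane_map monoid \<Rightarrow> ('v, 'e) pre_digraph \<Rightarrow> ('e \<Rightarrow> plane_map) \<Rightarrow> ('v \<Rightarrow> real^2)
     \<Rightarrow> 'e \<Rightarrow> 'v \<Rightarrow> real^2" where
  "orbit_entry \<Gamma> G m p e v =
     (let i = tail G e; j = head G e in
      if i = j then
        (if v = i then 2 *\<^sub>R p i - m e (p i) - (inv\<^bsub>\<Gamma>\<^esub> (m e)) (p i) else 0)
      else if v = i then p i - m e (p j)
      else if v = j then p j - (inv\<^bsub>\<Gamma>\<^esub> (m e)) (p i)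
      else 0)"

text \<open>\<open>verts G\<close> and \<open>arcs G\<close> may be proper subsets of the finite index types (so that, for
  instance, edgeless graphs are covered). The matrix is then padded: rows outside \<open>arcs G\<close> are set
  to zero and columns outside \<open>verts G\<close> are zero, which does not affect the rank.\<close>

definition orbit_matrix ::
  "plane_map monoid \<Rightarrow> ('v::finite, 'e::finite) pre_digraph \<Rightarrow> ('e \<Rightarrow> plane_map) \<Rightarrow> ('v \<Rightarrow> real^2)
     \<Rightarrow> real^('v \<times> 2)^'e" where
  "orbit_matrix \<Gamma> G m p =
     (\<chi> e. \<chi> c. if e \<in> arcs G then orbit_entry \<Gamma> G m p e (fst c) $ snd c else 0)"

definition generic ::
  "plane_map monoid \<Rightarrow> ('v::finite, 'e::finite) pre_digraph \<Rightarrow> ('e \<Rightarrow> plane_map)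
     \<Rightarrow> ('v \<Rightarrow> real^2) \<Rightarrow> bool" where
  "generic \<Gamma> G m p \<longleftrightarrow>
     configuration \<Gamma> G m p \<and>
     (\<forall>q. configuration \<Gamma> G m q \<longrightarrow>
        rank (orbit_matrix \<Gamma> G m q) \<le> rank (orbit_matrix \<Gamma> G m p))"

definition row_independent :: "'e set \<Rightarrow> real^'c^'e \<Rightarrow> bool" where
  "row_independent E M \<longleftrightarrow> inj_on (\<lambda>e. row e M) E \<and> independent ((\<lambda>e. row e M) ` E)"

definition gain_rigid ::
  "plane_map monoid \<Rightarrow> ('v::finite, 'e::finite) pre_digraph \<Rightarrow> ('e \<Rightarrow> plane_map) \<Rightarrow> bool" where
  "gain_rigid \<Gamma> G m \<longleftrightarrow> (\<forall>p. generic \<Gamma> G m p \<longrightarrow> symmetrically_rigid \<Gamma> G m p)"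

definition gain_independent ::
  "plane_map monoid \<Rightarrow> ('v::finite, 'e::finite) pre_digraph \<Rightarrow> ('e \<Rightarrow> plane_map) \<Rightarrow> bool" where
  "gain_independent \<Gamma> G m \<longleftrightarrow>
     (\<forall>p. generic \<Gamma> G m p \<longrightarrow> row_independent (arcs G) (orbit_matrix \<Gamma> G m p))"

definition minimally_rigid ::
  "plane_map monoid \<Rightarrow> ('v::finite, 'e::finite) pre_digraph \<Rightarrow> ('e \<Rightarrow> plane_map) \<Rightarrow> bool" where
  "minimally_rigid \<Gamma> G m \<longleftrightarrow> gain_rigid \<Gamma> G m \<and> gain_independent \<Gamma> G m"

end

theory Submission
  imports Defs
begin


text \<open>In coordinates the row of an edge splits into an $x$-part, a multiple of a row of the graphic
  matrix, and a $y$-part, a multiple of a row of the signed graphic matrix given by the linear parts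
  of the gains. Independence implies the counts because balanced and purely periodic subgraphs
  carry a 3- and a 2-dimensional space of infinitesimal rigid motions, pulled back along a
  potential for the gains.

  Conversely, a gain_sparse graph has a vertex $v$ of degree at most 3, and one inducts on the number of
  edges. The only hard case is that of three edges from $v$ to neighbours that do not all coincide;
  replacing them by one of the three chords between the neighbours and applying a 1-extension works
  unless all three chords violate sparsity. Then each chord lies in a tight
  subgraph which, by induction, admits only trivial motions. The images of the neighbours form a
  nondegenerate triangle, so these three subgraphs move with one common infinitesimal rigid motion.
  Comparing the potentials on the overlaps bounds its freedom, and the resulting edge count of the
  union together with $v$ contradicts sparsity.\<close>

section \<open>Generic configurations\<close>

text \<open>The induction leaves the group. The reflection loop used for three parallel edges has
  gain $(0,0,s)$, which does not lie in pg, so edges carry bare numerical gains: a real shift in x,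
  an integral shift in y and a sign. Integrality in y is the one arithmetic fact kept. It enters
  where two tight subgraphs share a vertex w but give it opposite signs: a common motion with
  angular velocity \<omega> must satisfy \<omega> (2 y_w - n) = 0 for an integer n, and this
  excludes rotation only if 2 y_w is not an integer. Configurations are therefore kept off the
  horizontal lines at half-integral height. The constants 3, 2, 1 have one source: a rigid motion
  (k, l, \<omega>) pulls back to a balanced subgraph in full, to a purely periodic one if \<omega> =
  0, and to any subgraph if also l = 0. Only translation along the mirror survives in all cases,
  which gives the global count 2|V| - 1.\<close>

lemma independent_combination_poly:
  fixes R :: "'e \<Rightarrow> 'i \<Rightarrow> real poly"
  assumes "finite E"
    and "\<And>c. (\<forall>i\<in>C. (\<Sum>e\<in>E. c e * poly (R e i) t0) = 0) \<Longrightarrow> \<forall>e\<in>E. c e = 0"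
  shows "finite {t. \<not> (\<forall>c. (\<forall>i\<in>C. (\<Sum>e\<in>E. c e * poly (R e i) t) = 0) \<longrightarrow> (\<forall>e\<in>E. c e = 0))}"
  using assms
proof (induction E arbitrary: R rule: finite_induct)
  case empty
  then show ?case by simp
next
  case (insert f E R)
  have "\<exists>i\<in>C. poly (R f i) t0 \<noteq> 0"
  proof (rule ccontr)
    assume *: "\<not> (\<exists>i\<in>C. poly (R f i) t0 \<noteq> 0)"
    have "\<forall>e\<in>insert f E. (if e = f then 1 else 0 :: real) = 0"
      by (rule insert.prems) (use * insert.hyps in \<open>auto intro!: sum.neutral\<close>)
    then show False by simp
  qed
  then obtain j where j: "j \<in> C" "poly (R f j) t0 \<noteq> 0" by blast
  \<comment> \<open>Fraction-free elimination: row \<open>f\<close> clears column \<open>j\<close>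
    from the remaining rows, with the pivot polynomial \<open>q\<close> multiplied in instead of
    divided out. Away from the roots of \<open>q\<close>, independence of the reduced rows gives
    independence of all rows.\<close>
  define q where "q = R f j"
  define R' where "R' e i = q * R e i - R e j * R f i" for e i
  have R': "(\<Sum>e\<in>E. c e * poly (R' e i) t)
      = poly q t * (\<Sum>e\<in>E. c e * poly (R e i) t) - (\<Sum>e\<in>E. c e * poly (R e j) t) * poly (R f i) t" for c i t
    by (simp add: R'_def sum_distrib_left sum_distrib_right sum_subtractf[symmetric] algebra_simps)
  have "finite {t. \<not> (\<forall>c. (\<forall>i\<in>C. (\<Sum>e\<in>E. c e * poly (R' e i) t) = 0) \<longrightarrow> (\<forall>e\<in>E. c e = 0))}"
  proof (rule insert.IH)
    fix c assume c: "\<forall>i\<in>C. (\<Sum>e\<in>E. c e * poly (R' e i) t0) = 0"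
    \<comment> \<open>Reads a dependency of the reduced rows back as one of the original rows: the
      old coefficients times the pivot, with the coefficient of \<open>f\<close> reproducing the
      subtracted multiple.\<close>
    define d where "d e = (if e = f then - (\<Sum>e\<in>E. c e * poly (R e j) t0) else poly q t0 * c e)" for e
    have "\<forall>e\<in>insert f E. d e = 0"
    proof (rule insert.prems, safe)
      fix i assume "i \<in> C"
      have "(\<Sum>e\<in>E. d e * poly (R e i) t0) = poly q t0 * (\<Sum>e\<in>E. c e * poly (R e i) t0)"
        unfolding sum_distrib_left by (rule sum.cong) (use insert.hyps in \<open>auto simp: d_def\<close>)
      with c \<open>i \<in> C\<close> R'[of c i t0]
      show "(\<Sum>e\<in>insert f E. d e * poly (R e i) t0) = 0"
        using insert.hyps by (simp add: d_def)
    qed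
    then show "\<forall>e\<in>E. c e = 0"
      using j insert.hyps by (auto simp: d_def q_def split: if_splits)
  qed
  moreover have "finite {t. poly q t = 0}"
    using j by (intro poly_roots_finite) (auto simp: q_def)
  ultimately have "finite ({t. \<not> (\<forall>c. (\<forall>i\<in>C. (\<Sum>e\<in>E. c e * poly (R' e i) t) = 0) \<longrightarrow> (\<forall>e\<in>E. c e = 0))}
       \<union> {t. poly q t = 0})" by simp
  moreover have "\<forall>e\<in>insert f E. c e = 0"
    if q: "poly q t \<noteq> 0"
      and ind: "\<forall>c. (\<forall>i\<in>C. (\<Sum>e\<in>E. c e * poly (R' e i) t) = 0) \<longrightarrow> (\<forall>e\<in>E. c e = 0)"
      and c: "\<forall>i\<in>C. (\<Sum>e\<in>insert f E. c e * poly (R e i) t) = 0" for t c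
  proof -
    have *: "(\<Sum>e\<in>E. c e * poly (R e i) t) = - c f * poly (R f i) t" if "i \<in> C" for i
      using c that insert.hyps by (simp add: add_eq_0_iff2)
    have "\<forall>i\<in>C. (\<Sum>e\<in>E. c e * poly (R' e i) t) = 0"
      using j by (simp add: R' * q_def)
    with ind have "\<forall>e\<in>E. c e = 0" by blast
    moreover from this have "c f = 0"
      using *[OF j(1)] q by (simp add: q_def)
    ultimately show ?thesis by auto
  qed
  ultimately show ?case
    by (elim finite_subset[rotated]) blast
qed

text \<open>Genericity is tested along lines of configurations: countably many exceptions, rather than
  finitely many, are needed to exclude half-integral coordinates.\<close>

definition line_config :: "('v \<Rightarrow> real^2) \<Rightarrow> ('v \<Rightarrow> real^2) \<Rightarrow> real \<Rightarrow> 'v \<Rightarrow> real^2" where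
  "line_config p q t = (\<lambda>w. p w + t *\<^sub>R (q w - p w))"

definition generic_condition :: "(('v \<Rightarrow> real^2) \<Rightarrow> bool) \<Rightarrow> bool" where
  "generic_condition P \<longleftrightarrow> (\<forall>p q. P p \<longrightarrow> countable {t. \<not> P (line_config p q t)})"

text \<open>Restrictions to lines stand in for multivariate polynomials: one nonzero value on a line
  leaves only finitely many zeros on that line.\<close>

definition polynomial_on_lines :: "(('v \<Rightarrow> real^2) \<Rightarrow> real) \<Rightarrow> bool" where
  "polynomial_on_lines f \<longleftrightarrow> (\<forall>p q. \<exists>r. \<forall>t. f (line_config p q t) = poly r t)"

lemma line_config_0 [simp]: "line_config p q 0 = p"
  by (simp add: line_config_def)

lemma line_config_swap: "line_config q p (1 - t) = line_config p q t"
  by (auto simp: line_config_def algebra_simps)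

lemma generic_condition_conj:
  assumes "generic_condition P" "generic_condition Q"
  shows "generic_condition (\<lambda>p. P p \<and> Q p)"
  unfolding generic_condition_def
proof (intro allI impI)
  fix p q assume "P p \<and> Q p"
  then have "countable ({t. \<not> P (line_config p q t)} \<union> {t. \<not> Q (line_config p q t)})"
    using assms by (simp add: generic_condition_def)
  then show "countable {t. \<not> (P (line_config p q t) \<and> Q (line_config p q t))}"
    by (rule countable_subset[rotated]) auto
qed

text \<open>On the line joining the two witnesses each condition holds at one end, hence off a
  countable set of parameters, and the reals are uncountable. Each condition may thus be verified at
  a configuration of its own.\<close>

lemma generic_condition_meet:
  assumes P: "generic_condition P" "P p" and Q: "generic_condition Q" "Q q"
  obtains r where "P r" "Q r"
proof -
  have "countable {t. \<not> Q (line_config q p t)}" and 1: "countable {t. \<not> P (line_config p q t)}"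
    using assms by (auto simp: generic_condition_def)
  then have "countable ((\<lambda>t. 1 - t) ` {t. \<not> Q (line_config q p t)})" by simp
  moreover have "{t. \<not> Q (line_config p q t)} \<subseteq> (\<lambda>t. 1 - t) ` {t. \<not> Q (line_config q p t)}"
  proof
    fix t assume "t \<in> {t. \<not> Q (line_config p q t)}"
    then have "1 - t \<in> {t. \<not> Q (line_config q p t)}" by (simp add: line_config_swap)
    then show "t \<in> (\<lambda>t. 1 - t) ` {t. \<not> Q (line_config q p t)}"
      by (metis (no_types, lifting) add.commute diff_add_cancel diff_diff_eq2 imageI)
  qed
  ultimately have "countable {t. \<not> Q (line_config p q t)}" using countable_subset by blast
  with 1 have "countable ({t. \<not> P (line_config p q t)} \<union> {t. \<not> Q (line_config p q t)})" by simp
  then have "({t. \<not> P (line_config p q t)} \<union> {t. \<not> Q (line_config p q t)}) \<noteq> UNIV"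
    using uncountable_UNIV_real by metis
  then show ?thesis using that by blast
qed

lemma generic_condition_ball:
  assumes "finite A" and "\<And>a. a \<in> A \<Longrightarrow> generic_condition (P a)"
    and "\<And>a. a \<in> A \<Longrightarrow> \<exists>p. P a p"
  shows "generic_condition (\<lambda>p. \<forall>a\<in>A. P a p) \<and> (\<exists>p. \<forall>a\<in>A. P a p)"
  using assms
proof (induction A rule: finite_induct)
  case empty
  then show ?case by (simp add: generic_condition_def)
next
  case (insert a A)
  then obtain p q where p: "P a p" and q: "\<forall>a\<in>A. P a q" by blast
  have *: "generic_condition (P a)" "generic_condition (\<lambda>p. \<forall>a\<in>A. P a p)"
    using insert by auto
  from generic_condition_meet[OF *(1) p *(2) q] obtain r where "P a r" "\<forall>a\<in>A. P a r" .
  with generic_condition_conj[OF *] show ?case by auto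
qed

section \<open>Polynomial conditions on configurations\<close>

lemma polynomial_on_lines_const [simp, intro]: "polynomial_on_lines (\<lambda>p. c)"
  unfolding polynomial_on_lines_def by (intro allI exI[of _ "[:c:]"]) simp

lemma polynomial_on_lines_coord [simp, intro]: "polynomial_on_lines (\<lambda>p. p w $ k)"
  unfolding polynomial_on_lines_def
proof (intro allI)
  fix p q :: "'a \<Rightarrow> real^2"
  show "\<exists>r. \<forall>t. line_config p q t w $ k = poly r t"
    by (intro exI[of _ "[:p w $ k, q w $ k - p w $ k:]"]) (simp add: line_config_def)
qed

lemma polynomial_on_lines_add [intro]:
  assumes "polynomial_on_lines f" "polynomial_on_lines g"
  shows "polynomial_on_lines (\<lambda>p. f p + g p)"
  using assms unfolding polynomial_on_lines_def by (metis poly_add)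

lemma polynomial_on_lines_diff [intro]:
  assumes "polynomial_on_lines f" "polynomial_on_lines g"
  shows "polynomial_on_lines (\<lambda>p. f p - g p)"
  using assms unfolding polynomial_on_lines_def by (metis poly_diff)

lemma polynomial_on_lines_mult [intro]:
  assumes "polynomial_on_lines f" "polynomial_on_lines g"
  shows "polynomial_on_lines (\<lambda>p. f p * g p)"
  using assms unfolding polynomial_on_lines_def by (metis poly_mult)

lemma generic_condition_independent:
  assumes "finite E" and "\<And>e i. polynomial_on_lines (\<lambda>p. R p e i)"
  shows "generic_condition (\<lambda>p. \<forall>c. (\<forall>i\<in>C. (\<Sum>e\<in>E. c e * R p e i) = 0) \<longrightarrow> (\<forall>e\<in>E. c e = (0::real)))"
  unfolding generic_condition_def
proof (intro allI impI)
  fix p q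
  assume p: "\<forall>c. (\<forall>i\<in>C. (\<Sum>e\<in>E. c e * R p e i) = 0) \<longrightarrow> (\<forall>e\<in>E. c e = 0)"
  have "\<exists>r. \<forall>t. R (line_config p q t) e i = poly r t" for e i
    using assms(2) by (auto simp: polynomial_on_lines_def)
  then obtain r where r: "\<And>e i t. R (line_config p q t) e i = poly (r e i) t" by metis
  have "finite {t. \<not> (\<forall>c. (\<forall>i\<in>C. (\<Sum>e\<in>E. c e * poly (r e i) t) = 0) \<longrightarrow> (\<forall>e\<in>E. c e = 0))}"
    by (rule independent_combination_poly[where ?t0.0 = 0, OF assms(1)]) (use p in \<open>simp flip: r\<close>)
  then show "countable {t. \<not> (\<forall>c. (\<forall>i\<in>C. (\<Sum>e\<in>E. c e * R (line_config p q t) e i) = 0) \<longrightarrow> (\<forall>e\<in>E. c e = 0))}"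
    by (simp add: r countable_finite)
qed

lemma generic_condition_nonzero:
  assumes "polynomial_on_lines f"
  shows "generic_condition (\<lambda>p. f p \<noteq> 0)"
  unfolding generic_condition_def
proof (intro allI impI)
  fix p q assume "f p \<noteq> 0"
  obtain r where r: "\<And>t. f (line_config p q t) = poly r t"
    using assms unfolding polynomial_on_lines_def by blast
  have "poly r 0 \<noteq> 0" using r[of 0] \<open>f p \<noteq> 0\<close> by simp
  then have "finite {t. poly r t = 0}" by (intro poly_roots_finite) auto
  then show "countable {t. \<not> f (line_config p q t) \<noteq> 0}" by (simp add: r countable_finite)
qed

text \<open>Along a line the doubled coordinate is affine in t. If constant, it keeps its
  non-integral initial value; otherwise the integers have a countable preimage.\<close>

lemma generic_condition_not_half_integer:
  "generic_condition (\<lambda>p. 2 * p w $ 2 \<notin> (\<int>::real set))"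
  unfolding generic_condition_def
proof (intro allI impI)
  fix p q :: "'a \<Rightarrow> real^2" assume p: "2 * p w $ 2 \<notin> (\<int>::real set)"
  define d where "d = 2 * (q w $ 2 - p w $ 2)"
  have "{t. \<not> 2 * line_config p q t w $ 2 \<notin> (\<int>::real set)} \<subseteq> (\<lambda>z. (z - 2 * p w $ 2) / d) ` \<int>"
  proof
    fix t assume t: "t \<in> {t. \<not> 2 * line_config p q t w $ 2 \<notin> (\<int>::real set)}"
    then have *: "2 * p w $ 2 + t * d \<in> \<int>" by (simp add: line_config_def d_def algebra_simps)
    with p have "d \<noteq> 0" by auto
    then show "t \<in> (\<lambda>z. (z - 2 * p w $ 2) / d) ` \<int>"
      by (intro image_eqI[OF _ *]) simp
  qed
  moreover have "countable (\<int>::real set)" by (simp add: Ints_def)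
  ultimately show "countable {t. \<not> 2 * line_config p q t w $ 2 \<notin> (\<int>::real set)}"
    using countable_subset by blast
qed


section \<open>Edge rows, motions and counts\<close>

text \<open>The gain of an edge is $(shx, shy, \sigma)$ with $\sigma$ the reflection iff \<open>flp\<close>. The
  label serves only to provide fresh parallel edges.\<close>

datatype 'v gedge =
  GEdge (src: 'v) (tgt: 'v) (flp: bool) (shx: real) (shy: real) (lbl: nat)

definition sn :: "bool \<Rightarrow> real" where
  "sn b = (if b then -1 else 1)"

lemma sn_simps [simp]: "sn True = -1" "sn False = 1" "sn b * sn b = 1" "sn b * (sn b * x) = x" "sn b \<noteq> 0"
  "sn (\<not> b) = - sn b" "sn b \<in> \<int>"
  by (auto simp: sn_def)

lemma sn_neq: "sn (b \<noteq> c) = sn b * sn c"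
  by (auto simp: sn_def)

lemma sn_eq_iff [simp]: "sn b = sn c \<longleftrightarrow> b = c"
  by (auto simp: sn_def)

definition dX :: "('v \<Rightarrow> real^2) \<Rightarrow> 'v gedge \<Rightarrow> real" where
  "dX p e = p (src e) $ 1 - p (tgt e) $ 1 - shx e"

definition dY :: "('v \<Rightarrow> real^2) \<Rightarrow> 'v gedge \<Rightarrow> real" where
  "dY p e = p (src e) $ 2 - sn (flp e) * p (tgt e) $ 2 - shy e"

text \<open>The head entry is minus the inverse linear part applied to the tail entry, so both are
  multiples of \<open>dX\<close> and \<open>dY\<close>. Loops have no clause of their own: both
  indicators fall on the same vertex and the entries add.\<close>

definition orow :: "('v \<Rightarrow> real^2) \<Rightarrow> 'v gedge \<Rightarrow> 'v \<times> 2 \<Rightarrow> real" where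
  "orow p e i = (if snd i = 1
     then dX p e * (of_bool (fst i = src e) - of_bool (fst i = tgt e))
     else dY p e * (of_bool (fst i = src e) - sn (flp e) * of_bool (fst i = tgt e)))"

definition rowv :: "('v::finite \<Rightarrow> real^2) \<Rightarrow> 'v gedge \<Rightarrow> real^('v \<times> 2)" where
  "rowv p e = (\<chi> i. orow p e i)"

definition ends :: "'v gedge set \<Rightarrow> 'v set" where
  "ends F = src ` F \<union> tgt ` F"

text \<open>Coefficients are indexed by edges, so equal rows of distinct edges count as dependent.
  The column set \<open>C\<close> is \<open>UNIV\<close> for the matrix itself and
  \<open>{v} \<times> UNIV\<close> for the block at a new vertex.\<close>

definition indep :: "('v \<times> 2) set \<Rightarrow> ('v \<Rightarrow> real^2) \<Rightarrow> 'v gedge set \<Rightarrow> bool" where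
  "indep C p E \<longleftrightarrow> (\<forall>c. (\<forall>i\<in>C. (\<Sum>e\<in>E. c e * orow p e i) = 0) \<longrightarrow> (\<forall>e\<in>E. c e = 0))"

lemma indepD:
  "indep C p E \<Longrightarrow> (\<And>i. i \<in> C \<Longrightarrow> (\<Sum>e\<in>E. c e * orow p e i) = 0) \<Longrightarrow> e \<in> E \<Longrightarrow> c e = 0"
  unfolding indep_def by blast

lemma indepI:
  "(\<And>c e. (\<And>i. i \<in> C \<Longrightarrow> (\<Sum>e\<in>E. c e * orow p e i) = 0) \<Longrightarrow> e \<in> E \<Longrightarrow> c e = 0) \<Longrightarrow> indep C p E"
  unfolding indep_def by blast

lemma indep_mono:
  assumes "indep C p E" "F \<subseteq> E" "finite E"
  shows "indep C p F"
proof (rule indepI)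
  fix c e assume c: "\<And>i. i \<in> C \<Longrightarrow> (\<Sum>e\<in>F. c e * orow p e i) = 0" and e: "e \<in> F"
  define d where "d f = (if f \<in> F then c f else 0)" for f
  have "(\<Sum>e\<in>E. d e * orow p e i) = (\<Sum>e\<in>F. c e * orow p e i)" for i
    by (rule sum.mono_neutral_cong_right) (use assms in \<open>auto simp: d_def\<close>)
  then have "d e = 0" using indepD[OF assms(1), of d e] c e assms(2) by auto
  then show "c e = 0" using e by (simp add: d_def)
qed

lemma generic_condition_indep:
  assumes "finite E"
  shows "generic_condition (\<lambda>p. indep C p E)"
  unfolding indep_def
proof (rule generic_condition_independent[OF assms])
  fix e :: "'a gedge" and i
  show "polynomial_on_lines (\<lambda>p. orow p e i)"
    unfolding orow_def dX_def dY_def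
    by (cases "snd i = 1", simp_all only: simp_thms if_True if_False,
        (intro polynomial_on_lines_mult polynomial_on_lines_diff polynomial_on_lines_const
          polynomial_on_lines_coord)+)
qed

lemma orow_outside: "w \<noteq> src e \<Longrightarrow> w \<noteq> tgt e \<Longrightarrow> orow p e (w, k) = 0"
  by (simp add: orow_def)

lemma orow_cong: "p (src e) = q (src e) \<Longrightarrow> p (tgt e) = q (tgt e) \<Longrightarrow> orow p e = orow q e"
  by (auto simp: orow_def fun_eq_iff dX_def dY_def)

lemma inner_rowv:
  "rowv p e \<bullet> u = dX p e * (u $ (src e, 1) - u $ (tgt e, 1))
     + dY p e * (u $ (src e, 2) - sn (flp e) * u $ (tgt e, 2))"
proof -
  have "rowv p e \<bullet> u = (\<Sum>i\<in>UNIV \<times> UNIV. orow p e i * u $ i)"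
    by (simp add: inner_vec_def rowv_def UNIV_Times_UNIV)
  also have "\<dots> = (\<Sum>w\<in>UNIV. \<Sum>k\<in>UNIV. orow p e (w, k) * u $ (w, k))"
    by (simp add: sum.cartesian_product case_prod_unfold)
  also have "\<dots> = (\<Sum>w\<in>UNIV. orow p e (w, 1) * u $ (w, 1)) + (\<Sum>w\<in>UNIV. orow p e (w, 2) * u $ (w, 2))"
    by (simp add: UNIV_2 sum.distrib)
  also have "(\<Sum>w\<in>UNIV. orow p e (w, 1) * u $ (w, 1)) = dX p e * (u $ (src e, 1) - u $ (tgt e, 1))"
    by (simp add: orow_def of_bool_def algebra_simps sum_subtractf if_distrib[of "\<lambda>x. _ * x"] sum_distrib_left[symmetric]
         sum.delta cong: if_cong)
  also have "(\<Sum>w\<in>UNIV. orow p e (w, 2) * u $ (w, 2))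
      = dY p e * (u $ (src e, 2) - sn (flp e) * u $ (tgt e, 2))"
    by (simp add: orow_def of_bool_def algebra_simps sum_subtractf if_distrib[of "\<lambda>x. _ * x"] sum_distrib_left[symmetric]
         sum.delta cong: if_cong)
  finally show ?thesis .
qed

section \<open>Infinitesimal motions and dimension counts\<close>

definition motions :: "('v::finite \<Rightarrow> real^2) \<Rightarrow> 'v gedge set \<Rightarrow> (real^('v \<times> 2)) set" where
  "motions p F = {u. \<forall>e\<in>F. rowv p e \<bullet> u = 0}"

text \<open>Vectors have coordinates at every vertex of the type; restricting the support makes
  dimensions comparable with the size of a chosen vertex set.\<close>

definition supported :: "'v set \<Rightarrow> (real^('v::finite \<times> 2)) set" where
  "supported V = {u. \<forall>i. fst i \<notin> V \<longrightarrow> u $ i = 0}"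

lemma subspace_supported: "subspace (supported V)"
  by (auto simp: subspace_def supported_def)

lemma subspace_motions: "subspace (motions p F)"
  by (auto simp: subspace_def motions_def inner_add_right)

lemma dim_supported: "dim (supported V) = 2 * card V"
proof -
  have "supported V = {u. \<forall>i. i \<notin> V \<times> UNIV \<longrightarrow> u $ i = 0}"
    by (auto simp: supported_def)
  then have "dim (supported V) = card (V \<times> (UNIV :: 2 set))"
    using dim_substandard_cart[of "V \<times> (UNIV :: 2 set)", where 'a = real] by (simp add: dim_vec_eq)
  then show ?thesis by (simp add: card_cartesian_product)
qed

lemma indep_iff_independent:
  assumes "finite E"
  shows "indep UNIV p E \<longleftrightarrow> inj_on (rowv p) E \<and> independent (rowv p ` E)"
proof -
  have *: "(\<Sum>e\<in>E. c e *\<^sub>R rowv p e) = 0 \<longleftrightarrow> (\<forall>i\<in>UNIV. (\<Sum>e\<in>E. c e * orow p e i) = 0)" for c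
    by (simp add: vec_eq_iff rowv_def)
  show ?thesis
  proof
    assume ind: "indep UNIV p E"
    have inj: "inj_on (rowv p) E"
    proof (rule inj_onI, rule ccontr)
      fix e f assume ef: "e \<in> E" "f \<in> E" "rowv p e = rowv p f" "e \<noteq> f"
      define c where "c g = (if g = e then 1 else if g = f then -1 else 0 :: real)" for g
      have "(\<Sum>g\<in>E. c g *\<^sub>R rowv p g) = (\<Sum>g\<in>{e, f}. c g *\<^sub>R rowv p g)"
        by (rule sum.mono_neutral_right) (use assms ef in \<open>auto simp: c_def\<close>)
      also have "\<dots> = 0" using ef by (simp add: c_def)
      finally have 0: "\<forall>i\<in>UNIV. (\<Sum>g\<in>E. c g * orow p g i) = 0" by (rule *[THEN iffD1])
      have "c e = 0" by (rule indepD[OF ind _ ef(1)], rule bspec[OF 0])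
      then show False by (simp add: c_def)
    qed
    moreover have "independent (rowv p ` E)"
      unfolding independent_explicit
    proof (intro conjI allI impI ballI)
      show "finite (rowv p ` E)" using assms by simp
    next
      fix c v assume c: "(\<Sum>v\<in>rowv p ` E. c v *\<^sub>R v) = 0" and "v \<in> rowv p ` E"
      then obtain e where e: "e \<in> E" "v = rowv p e" by blast
      have "(\<Sum>e\<in>E. c (rowv p e) *\<^sub>R rowv p e) = 0" using c inj by (simp add: sum.reindex)
      then have 0: "\<forall>i\<in>UNIV. (\<Sum>e\<in>E. c (rowv p e) * orow p e i) = 0" by (rule *[THEN iffD1])
      have "c (rowv p e) = 0" by (rule indepD[OF ind _ e(1)], rule bspec[OF 0])
      then show "c v = 0" using e by simp
    qed
    ultimately show "inj_on (rowv p) E \<and> independent (rowv p ` E)" by blast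
  next
    assume inj: "inj_on (rowv p) E \<and> independent (rowv p ` E)"
    show "indep UNIV p E"
    proof (rule indepI)
      fix c e assume c: "\<And>i. i \<in> UNIV \<Longrightarrow> (\<Sum>e\<in>E. c e * orow p e i) = 0" and e: "e \<in> E"
      have "(\<Sum>v\<in>rowv p ` E. c (inv_into E (rowv p) v) *\<^sub>R v) = (\<Sum>e\<in>E. c e *\<^sub>R rowv p e)"
        using inj by (auto simp: sum.reindex intro!: sum.cong)
      also have "\<dots> = 0" by (rule *[THEN iffD2]) (use c in simp)
      finally have "\<forall>v\<in>rowv p ` E. c (inv_into E (rowv p) v) = 0"
        using inj unfolding independent_explicit by meson
      then show "c e = 0" using e inj by (metis imageI inv_into_f_f)
    qed
  qed
qed

lemma rowv_supported:
  assumes "e \<in> F" "ends F \<subseteq> V"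
  shows "rowv p e \<in> supported V"
  using assms by (auto simp: rowv_def supported_def ends_def intro!: orow_outside)

text \<open>Rank-nullity: within \<open>supported V\<close> the motions are the orthogonal
  complement of the span of the rows.\<close>

lemma dim_motions:
  assumes "finite F" "indep UNIV p F" "ends F \<subseteq> V"
  shows "dim (motions p F \<inter> supported V) + card F = 2 * card V"
proof -
  let ?A = "span (rowv p ` F)"
  have ind: "inj_on (rowv p) F" "independent (rowv p ` F)"
    using assms indep_iff_independent by blast+
  have "?A \<subseteq> supported V"
    using assms by (intro span_minimal subspace_supported) (auto intro: rowv_supported)
  then have "dim {y \<in> supported V. \<forall>x\<in>?A. orthogonal x y} + dim ?A = 2 * card V"
    using dim_subspace_orthogonal_to_vectors[OF subspace_span subspace_supported, of "rowv p ` F" V]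
    by (simp add: dim_supported)
  moreover have "{y \<in> supported V. \<forall>x\<in>?A. orthogonal x y} = motions p F \<inter> supported V"
  proof -
    have "(\<forall>x\<in>?A. orthogonal x y) \<longleftrightarrow> y \<in> motions p F" for y
    proof
      assume "\<forall>x\<in>?A. orthogonal x y"
      then show "y \<in> motions p F" by (auto simp: motions_def orthogonal_def span_base)
    next
      assume "y \<in> motions p F"
      then have "\<And>x. x \<in> rowv p ` F \<Longrightarrow> orthogonal y x"
        by (auto simp: motions_def orthogonal_def inner_commute)
      then show "\<forall>x\<in>?A. orthogonal x y"
        using orthogonal_to_span orthogonal_commute by blast
    qed
    then show ?thesis by (simp add: Int_def conj_commute)
  qed
  moreover have "dim ?A = card F"
    using ind by (simp add: dim_eq_card_independent card_image)
  ultimately show ?thesis by simp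
qed

lemma count_le:
  fixes \<Phi> :: "'a::euclidean_space \<Rightarrow> real^('v::finite \<times> 2)"
  assumes "finite F" "indep UNIV p F" "ends F \<subseteq> V"
    and "linear \<Phi>" "inj \<Phi>" "range \<Phi> \<subseteq> motions p F \<inter> supported V"
  shows "card F + DIM('a) \<le> 2 * card V"
proof -
  have "dim (range \<Phi>) = DIM('a)"
    using dim_image_eq[of \<Phi> UNIV] assms by simp
  moreover have "dim (range \<Phi>) \<le> dim (motions p F \<inter> supported V)"
    using assms by (intro dim_subset) auto
  ultimately show ?thesis using dim_motions[OF assms(1-3)] by simp
qed

text \<open>An embedded family as large as the kernel leaves no other motion. This turns a tight
  count into the fact that a subgraph admits only the expected rigid motions.\<close>

lemma count_eq:
  fixes \<Phi> :: "'a::euclidean_space \<Rightarrow> real^('v::finite \<times> 2)"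
  assumes "finite F" "indep UNIV p F" "ends F \<subseteq> V"
    and "linear \<Phi>" "inj \<Phi>" "range \<Phi> \<subseteq> motions p F \<inter> supported V"
    and "2 * card V \<le> card F + DIM('a)"
  shows "motions p F \<inter> supported V = range \<Phi>"
proof -
  have "dim (range \<Phi>) = DIM('a)"
    using dim_image_eq[of \<Phi> UNIV] assms by simp
  then have "range \<Phi> = motions p F \<inter> supported V"
    using assms dim_motions[OF assms(1-3)]
    by (intro subspace_dim_equal linear_subspace_image subspace_UNIV subspace_inter
        subspace_motions subspace_supported) auto
  then show ?thesis by simp
qed

lemma count_ge:
  fixes \<Phi> :: "'a::euclidean_space \<Rightarrow> real^('v::finite \<times> 2)"
  assumes "finite F" "indep UNIV p F" "ends F \<subseteq> V"
    and "linear \<Phi>" "motions p F \<inter> supported V \<subseteq> range \<Phi>"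
  shows "2 * card V \<le> card F + DIM('a)"
proof -
  have "dim (motions p F \<inter> supported V) \<le> dim (range \<Phi>)"
    using assms by (intro dim_subset)
  also have "\<dots> \<le> DIM('a)"
    using dim_image_le[OF assms(4), of UNIV] by simp
  finally show ?thesis using dim_motions[OF assms(1-3)] by simp
qed

section \<open>Potentials, balance and rigid motions\<close>

text \<open>The gain of \<open>e\<close> is $g_{src}^{-1} g_{tgt}$ for the potential
  $w \mapsto g_w = (A_w, B_w, s_w)$.\<close>

definition fits :: "('v \<Rightarrow> real) \<Rightarrow> ('v \<Rightarrow> real) \<Rightarrow> ('v \<Rightarrow> bool) \<Rightarrow> 'v gedge \<Rightarrow> bool" where
  "fits A B s e \<longleftrightarrow> shx e = A (tgt e) - A (src e) \<and> flp e = (s (src e) \<noteq> s (tgt e)) \<and>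
     shy e = sn (s (src e)) * (B (tgt e) - B (src e))"

text \<open>One potential serves all components at once. \<open>B\<close> is integral at every
  vertex, also outside \<open>F\<close>, so that the heights of two such potentials always differ by
  an integer.\<close>

definition balanced_set :: "'v gedge set \<Rightarrow> bool" where
  "balanced_set F \<longleftrightarrow> (\<exists>A B s. (\<forall>w. B w \<in> \<int>) \<and> (\<forall>e\<in>F. fits A B s e))"

text \<open>Balance of the signed graph of linear parts: \<open>s\<close> is a 2-colouring that
  changes exactly along the reflecting edges.\<close>

definition periodic_set :: "'v gedge set \<Rightarrow> bool" where
  "periodic_set F \<longleftrightarrow> (\<exists>s :: 'v \<Rightarrow> bool. \<forall>e\<in>F. flp e = (s (src e) \<noteq> s (tgt e)))"

definition gain_sparse :: "'v gedge set \<Rightarrow> bool" where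
  "gain_sparse E \<longleftrightarrow> (\<forall>F\<subseteq>E. F \<noteq> {} \<longrightarrow>
     card F + 1 \<le> 2 * card (ends F) \<and>
     (periodic_set F \<longrightarrow> card F + 2 \<le> 2 * card (ends F)) \<and>
     (balanced_set F \<longrightarrow> card F + 3 \<le> 2 * card (ends F)))"

lemma sparseD:
  assumes "gain_sparse E" "F \<subseteq> E" "F \<noteq> {}"
  shows "card F + 1 \<le> 2 * card (ends F)"
    and "periodic_set F \<Longrightarrow> card F + 2 \<le> 2 * card (ends F)"
    and "balanced_set F \<Longrightarrow> card F + 3 \<le> 2 * card (ends F)"
  using assms unfolding gain_sparse_def by blast+

lemma sparse_mono: "gain_sparse E \<Longrightarrow> F \<subseteq> E \<Longrightarrow> gain_sparse F"
  unfolding gain_sparse_def by blast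

lemma balanced_set_periodic_set: "balanced_set F \<Longrightarrow> periodic_set F"
  unfolding balanced_set_def periodic_set_def fits_def by blast

text \<open>\<open>rigid_motion p A B s V (k, l, \<omega>)\<close> is the infinitesimal rigid motion
  $(x, y) \mapsto (k - \omega y, l + \omega x)$, pulled back along the potential
  $w \mapsto (A_w, B_w, s_w)$.\<close>

definition rigid_motion ::
  "('v::finite \<Rightarrow> real^2) \<Rightarrow> ('v \<Rightarrow> real) \<Rightarrow> ('v \<Rightarrow> real) \<Rightarrow> ('v \<Rightarrow> bool) \<Rightarrow> 'v set
     \<Rightarrow> real \<times> real \<times> real \<Rightarrow> real^('v \<times> 2)" where
  "rigid_motion p A B s V = (\<lambda>(k, l, \<omega>). \<chi> i. if fst i \<in> V then
     (if snd i = 1 then k - \<omega> * (sn (s (fst i)) * p (fst i) $ 2 + B (fst i))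
      else sn (s (fst i)) * (l + \<omega> * (p (fst i) $ 1 + A (fst i)))) else 0)"

lemma linear_rigid_motion: "linear (rigid_motion p A B s V)"
  by (rule linearI) (auto simp: rigid_motion_def vec_eq_iff algebra_simps)

lemma rigid_motion_supported: "rigid_motion p A B s V x \<in> supported V"
  by (cases x) (auto simp: rigid_motion_def supported_def)

lemma fits_dX: "fits A B s e \<Longrightarrow> dX p e = (p (src e) $ 1 + A (src e)) - (p (tgt e) $ 1 + A (tgt e))"
  by (simp add: fits_def dX_def)

text \<open>\<open>sn (s w) * p w $ 2 + B w\<close> is the height of the lifted point g_w(p(w)). An
  edge fitting the potential is thus a bar between two lifted points, up to the linear part at its
  source.\<close>

lemma fits_dY: "fits A B s e \<Longrightarrow> dY p e = sn (s (src e)) *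
    ((sn (s (src e)) * p (src e) $ 2 + B (src e)) - (sn (s (tgt e)) * p (tgt e) $ 2 + B (tgt e)))"
  using sn_neq[of "s (src e)" "s (tgt e)"] by (auto simp: fits_def dY_def algebra_simps)

lemma rigid_motion_bal:
  assumes "\<forall>e\<in>F. fits A B s e" "ends F \<subseteq> V"
  shows "rigid_motion p A B s V x \<in> motions p F"
proof -
  obtain k l \<omega> where x: "x = (k, l, \<omega>)" by (cases x)
  have "rowv p e \<bullet> rigid_motion p A B s V x = 0" if "e \<in> F" for e
  proof -
    have e: "fits A B s e" "src e \<in> V" "tgt e \<in> V" using assms that by (auto simp: ends_def)
    have f: "sn (flp e) = sn (s (src e)) * sn (s (tgt e))"
      using e sn_neq by (auto simp: fits_def)
    show ?thesis
      unfolding inner_rowv fits_dX[OF e(1)] fits_dY[OF e(1)] f x rigid_motion_def using e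
      by (simp add: algebra_simps)
  qed
  then show ?thesis by (simp add: motions_def)
qed

text \<open>A translation is the same at every point, so only the linear parts have to be
  consistent; \<open>A\<close> and \<open>B\<close> are multiplied by zero.\<close>

lemma rigid_motion_per:
  assumes "\<forall>e\<in>F. flp e = (s (src e) \<noteq> s (tgt e))" "ends F \<subseteq> V"
  shows "rigid_motion p A B s V (k, l, 0) \<in> motions p F"
proof -
  have "rowv p e \<bullet> rigid_motion p A B s V (k, l, 0) = 0" if "e \<in> F" for e
  proof -
    have e: "src e \<in> V" "tgt e \<in> V" using assms that by (auto simp: ends_def)
    have f: "sn (flp e) = sn (s (src e)) * sn (s (tgt e))"
      using assms(1) that sn_neq by auto
    show ?thesis
      unfolding inner_rowv f rigid_motion_def using e by (simp add: algebra_simps)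
  qed
  then show ?thesis by (simp add: motions_def)
qed

text \<open>A horizontal translation is fixed by the reflection and so passes through every
  gain.\<close>

lemma rigid_motion_all:
  assumes "ends F \<subseteq> V"
  shows "rigid_motion p A B s V (k, 0, 0) \<in> motions p F"
  using assms by (fastforce simp: motions_def inner_rowv rigid_motion_def ends_def)

text \<open>An infinitesimal rigid motion of the plane that vanishes at two distinct points is zero;
  \<open>a\<close> and \<open>b\<close> supply two lifted points in different positions.\<close>

lemma inj_rigid_motion:
  assumes "a \<in> V" "b \<in> V"
    and "p a $ 1 + A a \<noteq> p b $ 1 + A b \<or>
      sn (s a) * p a $ 2 + B a \<noteq> sn (s b) * p b $ 2 + B b"
  shows "inj (rigid_motion p A B s V)"
  unfolding linear_injective_0[OF linear_rigid_motion]
proof (intro allI impI)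
  fix x assume 0: "rigid_motion p A B s V x = 0"
  obtain k l \<omega> where x: "x = (k, l, \<omega>)" by (cases x)
  have "k = \<omega> * (sn (s w) * p w $ 2 + B w)" "l + \<omega> * (p w $ 1 + A w) = 0" if "w \<in> V" for w
    using arg_cong[OF 0, of "\<lambda>u. u $ (w, 1)"] arg_cong[OF 0, of "\<lambda>u. u $ (w, 2)"] that
    by (auto simp: x rigid_motion_def)
  from this[OF assms(1)] this[OF assms(2)] have
    *: "\<omega> * (sn (s a) * p a $ 2 + B a) = \<omega> * (sn (s b) * p b $ 2 + B b)"
      "\<omega> * (p a $ 1 + A a) = \<omega> * (p b $ 1 + A b)"
      and k: "k = \<omega> * (sn (s a) * p a $ 2 + B a)" "l + \<omega> * (p a $ 1 + A a) = 0"
    by linarith+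
  with assms(3) have "\<omega> = 0" by auto
  with k show "x = 0" by (simp add: x zero_prod_def)
qed

lemma linear_rigid_motion2: "linear (\<lambda>(k, l). rigid_motion p A B s V (k, l, 0))"
  by (rule linearI) (auto simp: rigid_motion_def vec_eq_iff algebra_simps)

lemma linear_rigid_motion1: "linear (\<lambda>k. rigid_motion p A B s V (k, 0, 0))"
  by (rule linearI) (auto simp: rigid_motion_def vec_eq_iff algebra_simps)

lemma inj_rigid_motion2:
  assumes "V \<noteq> {}"
  shows "inj (\<lambda>(k, l). rigid_motion p A B s V (k, l, 0))"
  unfolding linear_injective_0[OF linear_rigid_motion2]
proof safe
  fix k l assume 0: "rigid_motion p A B s V (k, l, 0) = 0"
  obtain w where "w \<in> V" using assms by blast
  then have "k = 0 \<and> l = 0"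
    using arg_cong[OF 0, of "\<lambda>u. u $ (w, 1)"] arg_cong[OF 0, of "\<lambda>u. u $ (w, 2)"]
    by (auto simp: rigid_motion_def)
  then show "(k, l) = 0" by (simp add: zero_prod_def)
qed

lemma inj_rigid_motion1:
  assumes "V \<noteq> {}"
  shows "inj (\<lambda>k. rigid_motion p A B s V (k, 0, 0))"
  using inj_rigid_motion2[OF assms, of p A B s] by (auto simp: inj_def)

section \<open>Independence implies the counts\<close>

lemma indep_row_nonzero:
  assumes "indep C p E" "finite E" "e \<in> E"
  shows "dX p e \<noteq> 0 \<or> dY p e \<noteq> 0"
proof (rule ccontr)
  assume "\<not> ?thesis"
  then have "orow p e = (\<lambda>i. 0)" by (auto simp: orow_def)
  moreover have "indep C p {e}" using assms indep_mono by blast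
  ultimately show False by (auto simp: indep_def)
qed

lemma indep_counts:
  fixes F :: "'v::finite gedge set"
  assumes "indep UNIV p F" "finite F" "F \<noteq> {}"
  shows "card F + 1 \<le> 2 * card (ends F)"
    and "periodic_set F \<Longrightarrow> card F + 2 \<le> 2 * card (ends F)"
    and "balanced_set F \<Longrightarrow> card F + 3 \<le> 2 * card (ends F)"
proof -
  have ne: "ends F \<noteq> {}" using assms by (auto simp: ends_def)
  have "card F + DIM(real) \<le> 2 * card (ends F)"
    by (rule count_le[OF assms(2,1) order_refl linear_rigid_motion1 inj_rigid_motion1[OF ne]])
      (use rigid_motion_all[OF order_refl, where F = F and p = p] rigid_motion_supported in blast)
  then show "card F + 1 \<le> 2 * card (ends F)" by simp
  show "card F + 2 \<le> 2 * card (ends F)" if "periodic_set F"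
  proof -
    obtain s :: "'v \<Rightarrow> bool" where s: "\<forall>e\<in>F. flp e = (s (src e) \<noteq> s (tgt e))" using \<open>periodic_set F\<close> unfolding periodic_set_def by blast
    have "card F + DIM(real \<times> real) \<le> 2 * card (ends F)"
      by (rule count_le[OF assms(2,1) order_refl linear_rigid_motion2 inj_rigid_motion2[OF ne, where p = p and s = s]])
        (use rigid_motion_per[OF s order_refl, where p = p] rigid_motion_supported in force)
    then show ?thesis by simp
  qed
  show "card F + 3 \<le> 2 * card (ends F)" if "balanced_set F"
  proof -
    obtain A B s where f: "\<forall>e\<in>F. fits A B s e" using \<open>balanced_set F\<close> by (auto simp: balanced_set_def)
    obtain e where e: "e \<in> F" using assms by blast
    \<comment> \<open>If all lifted points coincided, the family would lose a dimension; the nonzero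
      row of \<open>e\<close> keeps its two lifted ends apart.\<close>
    have inj: "inj (rigid_motion p A B s (ends F))"
    proof (rule inj_rigid_motion)
      show "src e \<in> ends F" "tgt e \<in> ends F" using e by (auto simp: ends_def)
      show "p (src e) $ 1 + A (src e) \<noteq> p (tgt e) $ 1 + A (tgt e) \<or>
        sn (s (src e)) * p (src e) $ 2 + B (src e) \<noteq> sn (s (tgt e)) * p (tgt e) $ 2 + B (tgt e)"
        using indep_row_nonzero[OF assms(1,2) e] f e fits_dX[of A B s e p] fits_dY[of A B s e p] by auto
    qed
    have "card F + DIM(real \<times> real \<times> real) \<le> 2 * card (ends F)"
      by (rule count_le[OF assms(2,1) order_refl linear_rigid_motion inj])
        (use rigid_motion_bal[OF f order_refl, where p = p] rigid_motion_supported in blast)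
    then show ?thesis by simp
  qed
qed

lemma indep_sparse:
  fixes E :: "'v::finite gedge set"
  assumes "indep UNIV p E" "finite E"
  shows "gain_sparse E"
  unfolding gain_sparse_def
proof (intro allI impI)
  fix F assume F: "F \<subseteq> E" "F \<noteq> {}"
  have "indep UNIV p F" "finite F"
    using F assms indep_mono finite_subset by blast+
  from indep_counts[OF this F(2)]
  show "card F + 1 \<le> 2 * card (ends F) \<and> (periodic_set F \<longrightarrow> card F + 2 \<le> 2 * card (ends F)) \<and>
     (balanced_set F \<longrightarrow> card F + 3 \<le> 2 * card (ends F))" by blast
qed


section \<open>Extension moves\<close>

text \<open>Makes \<open>v\<close> the source by reversing an edge that starts elsewhere, with the
  inverse gain (-a, -\<sigma> b, \<sigma>). Row and fit are unchanged, so the star of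
  \<open>v\<close> may be treated as outgoing.\<close>

definition orient :: "'v \<Rightarrow> 'v gedge \<Rightarrow> 'v gedge" where
  "orient v e = (if src e = v then e
     else GEdge (tgt e) (src e) (flp e) (- shx e) (- sn (flp e) * shy e) (lbl e))"

lemma orient_ends: "{src (orient v e), tgt (orient v e)} = {src e, tgt e}"
  by (auto simp: orient_def)

lemma orient_flp [simp]: "flp (orient v e) = flp e"
  by (simp add: orient_def)

lemma orow_orient: "orow p (orient v e) = orow p e"
  by (auto simp: orient_def orow_def dX_def dY_def fun_eq_iff sn_def algebra_simps)

lemma fits_orient: "fits A B s (orient v e) = fits A B s e"
  by (auto simp: orient_def fits_def sn_def algebra_simps)

lemma orient_shy_Ints: "shy e \<in> \<int> \<Longrightarrow> shy (orient v e) \<in> \<int>"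
  by (auto simp: orient_def)

text \<open>Together with \<open>imgy\<close>, the point to which the gain carries
  \<open>p (tgt f)\<close>: the position of the neighbour's copy that is joined to the identity copy
  of the source.\<close>

definition imgx :: "('v \<Rightarrow> real^2) \<Rightarrow> 'v gedge \<Rightarrow> real" where
  "imgx p f = p (tgt f) $ 1 + shx f"

definition imgy :: "('v \<Rightarrow> real^2) \<Rightarrow> 'v gedge \<Rightarrow> real" where
  "imgy p f = sn (flp f) * p (tgt f) $ 2 + shy f"

lemma dX_img: "dX p f = p (src f) $ 1 - imgx p f"
  by (simp add: dX_def imgx_def)

lemma dY_img: "dY p f = p (src f) $ 2 - imgy p f"
  by (simp add: dY_def imgy_def)

lemma orient_src_iff: "src (orient v e) = v \<longleftrightarrow> src e = v \<or> tgt e = v"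
  by (auto simp: orient_def)

lemma indep_cong:
  assumes "\<And>e. e \<in> E \<Longrightarrow> orow p e = orow q e"
  shows "indep C p E \<longleftrightarrow> indep C q E"
proof -
  have "(\<Sum>e\<in>E. c e * orow p e i) = (\<Sum>e\<in>E. c e * orow q e i)" for c i
    by (rule sum.cong) (simp_all add: assms)
  then show ?thesis by (simp add: indep_def)
qed

section \<open>0-extensions and 1-extensions\<close>

lemma sum_orow_outside:
  assumes "v \<notin> ends H"
  shows "(\<Sum>e\<in>H. c e * orow r e (v, k)) = 0"
proof (rule sum.neutral, rule ballI)
  fix e assume "e \<in> H"
  with assms have "v \<noteq> src e" "v \<noteq> tgt e" by (auto simp: ends_def)
  then show "c e * orow r e (v, k) = 0" by (simp add: orow_outside)
qed

lemma disjoint_star: "v \<notin> ends H \<Longrightarrow> \<forall>e\<in>S. src e = v \<or> tgt e = v \<Longrightarrow> H \<inter> S = {}"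
  by (auto simp: ends_def)

text \<open>The columns of \<open>v\<close> meet only the rows of \<open>S\<close>, so the matrix is
  block triangular, and the two blocks can be tested at different configurations.\<close>

lemma zero_extension:
  assumes H: "finite H" "indep UNIV p H" "v \<notin> ends H"
    and S: "finite S" "\<forall>e\<in>S. src e = v \<or> tgt e = v" "indep ({v} \<times> UNIV) q S"
  shows "\<exists>r. indep UNIV r (H \<union> S)"
proof -
  obtain r where r: "indep UNIV r H" "indep ({v} \<times> UNIV) r S"
    using generic_condition_meet[OF generic_condition_indep H(2) generic_condition_indep S(3)] H S
    by metis
  have disj: "H \<inter> S = {}" using H(3) S(2) by (rule disjoint_star)
  have "indep UNIV r (H \<union> S)"
  proof (rule indepI)
    fix c e assume c: "\<And>i. i \<in> UNIV \<Longrightarrow> (\<Sum>e\<in>H \<union> S. c e * orow r e i) = 0" and e: "e \<in> H \<union> S"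
    have *: "(\<Sum>e\<in>H. c e * orow r e i) + (\<Sum>e\<in>S. c e * orow r e i) = 0" for i
      using c[of i] disj H(1) S(1) by (simp add: sum.union_disjoint)
    have cS: "c e = 0" if "e \<in> S" for e
    proof (rule indepD[OF r(2) _ that])
      fix i :: "'a \<times> 2" assume i: "i \<in> {v} \<times> UNIV"
      have "(\<Sum>e\<in>H. c e * orow r e i) = 0"
        using i sum_orow_outside[OF H(3)] by auto
      with *[of i] show "(\<Sum>e\<in>S. c e * orow r e i) = 0" by simp
    qed
    then have 0: "(\<Sum>e\<in>S. c e * orow r e i) = 0" for i by (simp add: sum.neutral)
    have "c e = 0" if "e \<in> H" for e
      by (rule indepD[OF r(1) _ that]) (use * 0 in simp)
    with cS e show "c e = 0" by blast
  qed
  then show ?thesis by blast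
qed

lemma exists_config_distinct_images:
  assumes "tgt f \<noteq> tgt g \<or> shx f \<noteq> shx g \<or> shy f \<noteq> shy g \<or> flp f \<noteq> flp g"
  shows "\<exists>q. imgx q f \<noteq> imgx q g \<or> imgy q f \<noteq> imgy q g"
proof (cases "tgt f = tgt g")
  case False
  \<comment> \<open>The images of \<open>f\<close> and \<open>g\<close> get first coordinates 0 and
    1.\<close>
  define q where "q = (\<lambda>w. if w = tgt f then vector [- shx f, 0] else vector [1 - shx g, 0] :: real^2)"
  have "imgx q f \<noteq> imgx q g" using False by (simp add: imgx_def q_def)
  then show ?thesis by blast
next
  case True
  show ?thesis
  proof (cases "shx f = shx g \<and> flp f \<noteq> flp g")
    case False
    then have "imgx (\<lambda>w. 0) f \<noteq> imgx (\<lambda>w. 0) g \<or> imgy (\<lambda>w. 0) f \<noteq> imgy (\<lambda>w. 0) g"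
      using assms True by (auto simp: imgx_def imgy_def)
    then show ?thesis by blast
  next
    case flip: True
    \<comment> \<open>With opposite signs and a common target the two images move in opposite
      vertical directions; at this height they differ by exactly 1.\<close>
    define q where "q = (\<lambda>w :: 'a. vector [0, sn (flp f) * (shy g - shy f + 1) / 2] :: real^2)"
    have "sn (flp g) = - sn (flp f)" using flip by (auto simp: sn_def)
    then have "imgy q f \<noteq> imgy q g" by (simp add: imgy_def q_def field_simps)
    then show ?thesis by blast
  qed
qed

text \<open>The cross product of the two edge vectors, that is, the determinant of the block of two
  edges at their common source.\<close>

definition spread :: "('v \<Rightarrow> real^2) \<Rightarrow> 'v gedge \<Rightarrow> 'v gedge \<Rightarrow> real" where
  "spread p f g = dX p f * dY p g - dX p g * dY p f"

lemma polynomial_on_lines_spread: "polynomial_on_lines (\<lambda>p. spread p f g)"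
  unfolding spread_def dX_def dY_def
  by (intro polynomial_on_lines_mult polynomial_on_lines_diff polynomial_on_lines_const
          polynomial_on_lines_coord)

lemma exists_config_spread:
  assumes "src f = v" "src g = v" "tgt f \<noteq> v" "tgt g \<noteq> v"
    and "tgt f \<noteq> tgt g \<or> shx f \<noteq> shx g \<or> shy f \<noteq> shy g \<or> flp f \<noteq> flp g"
  shows "\<exists>q. spread q f g \<noteq> 0"
proof -
  obtain q where q: "imgx q f \<noteq> imgx q g \<or> imgy q f \<noteq> imgy q g"
    using exists_config_distinct_images assms(5) by blast
  define a b where "a = imgx q g - imgx q f" and "b = imgy q g - imgy q f"
  \<comment> \<open>The source is put at the image of \<open>f\<close> displaced by (a, b) turned
    through a right angle; the determinant becomes the squared distance of the images.\<close>
  define q' where "q' = q(v := vector [imgx q f - b, imgy q f + a])"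
  have img: "imgx q' f = imgx q f" "imgy q' f = imgy q f" "imgx q' g = imgx q g" "imgy q' g = imgy q g"
    using assms by (auto simp: imgx_def imgy_def q'_def)
  have "spread q' f g = a * a + b * b"
    unfolding spread_def dX_img dY_img img using assms
    by (simp add: q'_def a_def b_def algebra_simps)
  moreover have "a * a + b * b \<noteq> 0" using q by (auto simp: a_def b_def sum_squares_eq_zero_iff)
  ultimately have "spread q' f g \<noteq> 0" by metis
  then show ?thesis by blast
qed

lemma orow_at_src:
  assumes "src f \<noteq> tgt f"
  shows "orow p f (src f, 1) = dX p f" "orow p f (src f, 2) = dY p f"
  using assms by (auto simp: orow_def)

lemma orow_loop:
  assumes "src f = v" "tgt f = v"
  shows "orow p f (v, 1) = 0" "orow p f (v, 2) = dY p f * (1 - sn (flp f))"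
  using assms by (auto simp: orow_def)

text \<open>Twice the signed area of the triangle formed by the three images.\<close>

definition collinearity :: "('v \<Rightarrow> real^2) \<Rightarrow> 'v gedge \<Rightarrow> 'v gedge \<Rightarrow> 'v gedge \<Rightarrow> real" where
  "collinearity p f g h = (imgx p g - imgx p f) * (imgy p h - imgy p f)
     - (imgx p h - imgx p f) * (imgy p g - imgy p f)"

lemma polynomial_on_lines_collinearity: "polynomial_on_lines (\<lambda>p. collinearity p f g h)"
  unfolding collinearity_def imgx_def imgy_def
  by (intro polynomial_on_lines_mult polynomial_on_lines_add polynomial_on_lines_diff
      polynomial_on_lines_const polynomial_on_lines_coord)

lemma exists_config_noncollinear:
  assumes "tgt h \<noteq> tgt f" "tgt h \<noteq> tgt g"
    and "tgt f \<noteq> tgt g \<or> shx f \<noteq> shx g \<or> shy f \<noteq> shy g \<or> flp f \<noteq> flp g"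
  shows "\<exists>q. collinearity q f g h \<noteq> 0"
proof -
  obtain q where q: "imgx q f \<noteq> imgx q g \<or> imgy q f \<noteq> imgy q g"
    using exists_config_distinct_images assms(3) by blast
  define a b where "a = imgx q g - imgx q f" and "b = imgy q g - imgy q f"
  \<comment> \<open>Solved for the position of \<open>tgt h\<close>, so that its image is the image
    of \<open>f\<close> displaced by (a, b) turned through a right angle. The other two images have
    different vertices and stay in place.\<close>
  define q' where "q' = q(tgt h := vector [imgx q f - b - shx h, sn (flp h) * (imgy q f + a - shy h)])"
  have img: "imgx q' f = imgx q f" "imgy q' f = imgy q f" "imgx q' g = imgx q g" "imgy q' g = imgy q g"
    "imgx q' h = imgx q f - b" "imgy q' h = imgy q f + a"
    using assms by (auto simp: imgx_def imgy_def q'_def)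
  have "collinearity q' f g h = a * a + b * b"
    unfolding collinearity_def img by (simp add: a_def b_def algebra_simps)
  moreover have "a * a + b * b \<noteq> 0" using q by (auto simp: a_def b_def sum_squares_eq_zero_iff)
  ultimately have "collinearity q' f g h \<noteq> 0" by metis
  then show ?thesis by blast
qed

text \<open>If $\alpha$ and $\beta$ are the gains of \<open>f\<close> and \<open>g\<close>, both leaving the same vertex, the
  chord has gain $\alpha^{-1}\beta$.\<close>

definition chord :: "'v gedge \<Rightarrow> 'v gedge \<Rightarrow> nat \<Rightarrow> 'v gedge" where
  "chord f g l = GEdge (tgt f) (tgt g) (flp f \<noteq> flp g) (shx g - shx f) (sn (flp f) * (shy g - shy f)) l"

lemma chord_sel [simp]: "src (chord f g l) = tgt f" "tgt (chord f g l) = tgt g"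
  "flp (chord f g l) = (flp f \<noteq> flp g)" "shx (chord f g l) = shx g - shx f"
  "shy (chord f g l) = sn (flp f) * (shy g - shy f)" "lbl (chord f g l) = l"
  by (auto simp: chord_def)

lemma dX_chord: "dX p (chord f g l) = imgx p f - imgx p g"
  by (simp add: dX_def imgx_def)

lemma dY_chord: "dY p (chord f g l) = sn (flp f) * (imgy p f - imgy p g)"
  unfolding dY_def imgy_def chord_sel sn_neq by (simp add: algebra_simps)

text \<open>The vertex \<open>v\<close> is placed halfway between the ends of the chord: the two halves then carry
  equal stresses, which add up to a stress on the chord.\<close>

lemma one_extension:
  assumes H: "finite H" "v \<notin> ends H"
    and e: "e1 \<noteq> e2" "e2 \<noteq> e3" "e1 \<noteq> e3"
    and f: "f1 = orient v e1" "f2 = orient v e2" "f3 = orient v e3"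
      "src f1 = v" "src f2 = v" "src f3 = v" "tgt f1 \<noteq> v" "tgt f2 \<noteq> v" "tgt f3 \<noteq> v"
    and L: "chord f1 f2 l \<notin> H" "indep UNIV p (insert (chord f1 f2 l) H)"
    and D: "collinearity p f1 f2 f3 \<noteq> 0"
  shows "\<exists>r. indep UNIV r (H \<union> {e1, e2, e3})"
proof -
  define r where "r = p(v := vector [(imgx p f1 + imgx p f2) / 2, (imgy p f1 + imgy p f2) / 2])"
  define a b where "a = (imgx p f2 - imgx p f1) / 2" and "b = (imgy p f2 - imgy p f1) / 2"
  let ?L = "chord f1 f2 l"
  have img: "imgx r f1 = imgx p f1" "imgy r f1 = imgy p f1" "imgx r f2 = imgx p f2"
    "imgy r f2 = imgy p f2" "imgx r f3 = imgx p f3" "imgy r f3 = imgy p f3"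
    using f by (auto simp: imgx_def imgy_def r_def)
  have d: "dX r f1 = a" "dY r f1 = b" "dX r f2 = - a" "dY r f2 = - b"
    unfolding dX_img dY_img img f(4,5) by (auto simp: r_def a_def b_def field_simps)
  define a3 b3 where "a3 = dX r f3" and "b3 = dY r f3"
  \<comment> \<open>With \<open>v\<close> on the line through the first two images, a nondegenerate
    triangle means that the third edge is transversal to that line.\<close>
  have "collinearity p f1 f2 f3 = 2 * (a3 * b - a * b3)"
    unfolding a3_def b3_def dX_img dY_img img f(6) collinearity_def
    by (simp add: r_def a_def b_def field_simps)
  with D have D': "a3 * b - a * b3 \<noteq> 0" by auto
  have rL: "indep UNIV r (insert ?L H)"
  proof -
    have "orow r e = orow p e" if "e \<in> insert ?L H" for e
    proof -
      have "src e \<noteq> v \<and> tgt e \<noteq> v"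
      proof (cases "e = ?L")
        case True with f show ?thesis by (simp only: chord_sel not_False_eq_True)
      next
        case False with that H show ?thesis by (auto simp: ends_def)
      qed
      then show ?thesis by (intro orow_cong) (auto simp: r_def)
    qed
    then show ?thesis using L(2) indep_cong by blast
  qed
  have disj: "H \<inter> {e1, e2, e3} = {}"
    by (rule disjoint_star[OF H(2)]) (use f(1-6) in \<open>simp add: orient_src_iff\<close>)
  have "indep UNIV r (H \<union> {e1, e2, e3})"
  proof (rule indepI)
    fix c e assume c: "\<And>i. i \<in> UNIV \<Longrightarrow> (\<Sum>e\<in>H \<union> {e1, e2, e3}. c e * orow r e i) = 0"
      and e': "e \<in> H \<union> {e1, e2, e3}"
    have *: "(\<Sum>e\<in>H. c e * orow r e i) + (c e1 * orow r f1 i + c e2 * orow r f2 i + c e3 * orow r f3 i) = 0" for i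
      using c[of i] disj H(1) e by (simp add: sum.union_disjoint f orow_orient)
    have H0: "(\<Sum>e\<in>H. c e * orow r e (v, k)) = 0" for k
      by (rule sum_orow_outside[OF H(2)])
    have at_v: "orow r f1 (v, 1) = a" "orow r f1 (v, 2) = b" "orow r f2 (v, 1) = - a" "orow r f2 (v, 2) = - b"
      "orow r f3 (v, 1) = a3" "orow r f3 (v, 2) = b3"
      using orow_at_src[of f1 r] orow_at_src[of f2 r] orow_at_src[of f3 r] f d by (auto simp: a3_def b3_def)
    have 1: "(c e1 - c e2) * a + c e3 * a3 = 0"
      using *[of "(v, 1)"] unfolding H0 at_v by (simp add: algebra_simps)
    have 2: "(c e1 - c e2) * b + c e3 * b3 = 0"
      using *[of "(v, 2)"] unfolding H0 at_v by (simp add: algebra_simps)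
    have "c e3 * (a3 * b - a * b3) = 0" using 1 2 by algebra
    with D' have c3: "c e3 = 0" by simp
    have "(c e1 - c e2) * (a3 * b - a * b3) = 0" using 1 2 by algebra
    with D' have c12: "c e2 = c e1" by simp
    \<comment> \<open>The chord vector is twice either half, up to sign, hence the factor
      1/2.\<close>
    define d where "d e = (if e = ?L then c e1 / 2 else c e)" for e
    have dL: "c e1 * orow r f1 i + c e1 * orow r f2 i = c e1 / 2 * orow r ?L i" for i
    proof (cases "fst i = v")
      case True
      then have "orow r ?L i = 0" using orow_outside[of v ?L r "snd i"] f by (cases i) auto
      moreover have "orow r f1 i + orow r f2 i = 0"
        using True at_v exhaust_2[of "snd i"] by (cases i) auto
      ultimately show ?thesis by (simp add: algebra_simps flip: distrib_left)
    next
      case False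
      have dL: "dX r ?L = - 2 * a" "dY r ?L = - 2 * sn (flp f1) * b"
        unfolding dX_chord dY_chord img by (auto simp: a_def b_def field_simps)
      show ?thesis
      proof (cases "snd i = 1")
        case True
        then show ?thesis using False f(4-9) unfolding orow_def dL d by (simp add: algebra_simps)
      next
        case snd: False
        have s: "sn (flp ?L) = sn (flp f1) * sn (flp f2)" by (simp only: chord_sel sn_neq)
        show ?thesis using False f(4-9) snd unfolding orow_def dL d s
          by (simp add: algebra_simps)
      qed
    qed
    have "(\<Sum>e\<in>insert ?L H. d e * orow r e i) = 0" for i
    proof -
      have "(\<Sum>e\<in>H. d e * orow r e i) = (\<Sum>e\<in>H. c e * orow r e i)"
        by (rule sum.cong) (use L(1) in \<open>auto simp: d_def\<close>)
      then show ?thesis using *[of i] H(1) L(1) dL[of i] by (simp add: c3 c12 d_def)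
    qed
    then have d0: "d e = 0" if "e \<in> insert ?L H" for e
      by (rule indepD[OF rL _ that])
    have "c e1 = 0" using d0[of ?L] by (simp add: d_def)
    moreover have "c e = 0" if "e \<in> H" for e
      using d0[of e] that L(1) by (auto simp: d_def split: if_splits)
    ultimately show "c e = 0" using e' c3 c12 by auto
  qed
  then show ?thesis by blast
qed

text \<open>For three edges to one neighbour \<open>n\<close> the images may be collinear for every configuration, so
  no 1-extension is available; the force left over at \<open>n\<close> is then carried by a reflection loop.\<close>

lemma triple_edge_extension:
  assumes H: "finite H" "v \<notin> ends H"
    and e: "e1 \<noteq> e2" "e2 \<noteq> e3" "e1 \<noteq> e3"
    and f: "f1 = orient v e1" "f2 = orient v e2" "f3 = orient v e3"
      "src f1 = v" "src f2 = v" "src f3 = v" "tgt f1 = n" "tgt f2 = n" "tgt f3 = n" "n \<noteq> v"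
    and s: "flp f1 = flp f2" "flp f3 \<noteq> flp f1"
    and g: "shx f1 \<noteq> shx f2 \<or> shy f1 \<noteq> shy f2"
    and L: "GEdge n n True 0 0 l \<notin> H" "indep UNIV p (insert (GEdge n n True 0 0 l) H)"
  shows "\<exists>r. indep UNIV r (H \<union> {e1, e2, e3})"
proof -
  let ?L = "GEdge n n True 0 0 l"
  \<comment> \<open>\<open>spread\<close> makes the two edges of equal sign independent at
    \<open>v\<close>; \<open>dY\<close> of the third edge must not vanish because its stress will be
    read off from a vertical force.\<close>
  let ?P = "\<lambda>r. spread r f1 f2 \<noteq> 0 \<and> dY r f3 \<noteq> 0"
  obtain q1 where q1: "spread q1 f1 f2 \<noteq> 0" using exists_config_spread[of f1 v f2] f g by auto
  have q2: "dY ((\<lambda>w. 0)(v := vector [0, shy f3 + 1])) f3 \<noteq> 0" (is "dY ?q2 _ \<noteq> _")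
    using f by (simp add: dY_def)
  have gP: "generic_condition (\<lambda>r. spread r f1 f2 \<noteq> 0)" "generic_condition (\<lambda>r. dY r f3 \<noteq> 0)"
    unfolding dY_def
    by (intro generic_condition_nonzero polynomial_on_lines_spread polynomial_on_lines_mult
        polynomial_on_lines_diff polynomial_on_lines_const polynomial_on_lines_coord)+
  obtain q where q: "?P q"
    by (rule generic_condition_meet[OF gP(1) q1 gP(2) q2]) blast
  have fin: "finite (insert ?L H)" using H(1) by simp
  obtain r where r: "indep UNIV r (insert ?L H)" "spread r f1 f2 \<noteq> 0" "dY r f3 \<noteq> 0"
    by (rule generic_condition_meet[OF generic_condition_indep[OF fin] L(2) generic_condition_conj[OF gP] q]) blast
  have s': "sn (flp f2) = sn (flp f1)" "sn (flp f3) = - sn (flp f1)" using s by (auto simp: sn_def)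
  have disj: "H \<inter> {e1, e2, e3} = {}"
    by (rule disjoint_star[OF H(2)]) (use f(1-6) in \<open>simp add: orient_src_iff\<close>)
  have "indep UNIV r (H \<union> {e1, e2, e3})"
  proof (rule indepI)
    fix c e assume c: "\<And>i. i \<in> UNIV \<Longrightarrow> (\<Sum>e\<in>H \<union> {e1, e2, e3}. c e * orow r e i) = 0"
      and e': "e \<in> H \<union> {e1, e2, e3}"
    let ?S = "\<lambda>i. c e1 * orow r f1 i + c e2 * orow r f2 i + c e3 * orow r f3 i"
    have *: "(\<Sum>e\<in>H. c e * orow r e i) + ?S i = 0" for i
      using c[of i] disj H(1) e by (simp add: sum.union_disjoint f orow_orient)
    have H0: "(\<Sum>e\<in>H. c e * orow r e (v, k)) = 0" for k
      by (rule sum_orow_outside[OF H(2)])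
    have at_v: "orow r f1 (v, 1) = dX r f1" "orow r f1 (v, 2) = dY r f1" "orow r f2 (v, 1) = dX r f2"
      "orow r f2 (v, 2) = dY r f2" "orow r f3 (v, 1) = dX r f3" "orow r f3 (v, 2) = dY r f3"
      using orow_at_src[of f1 r] orow_at_src[of f2 r] orow_at_src[of f3 r] f by auto
    have 1: "c e1 * dX r f1 + c e2 * dX r f2 + c e3 * dX r f3 = 0"
      using *[of "(v, 1)"] unfolding H0 at_v by simp
    have 2: "c e1 * dY r f1 + c e2 * dY r f2 + c e3 * dY r f3 = 0"
      using *[of "(v, 2)"] unfolding H0 at_v by simp
    \<comment> \<open>The row of the loop is concentrated in the single coordinate (n, 2), so the
      loop can absorb any vertical force at \<open>n\<close>.\<close>
    have L0: "orow r ?L (n, 1) = 0" "orow r ?L (n, 2) \<noteq> 0"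
      using indep_row_nonzero[OF r(1), of ?L] H(1) by (auto simp: orow_def dX_def)
    define d where "d e = (if e = ?L then ?S (n, 2) / orow r ?L (n, 2) else c e)" for e
    have dL: "?S i = ?S (n, 2) / orow r ?L (n, 2) * orow r ?L i" for i
    proof -
      obtain w k where i: "i = (w, k)" by (cases i)
      consider "w = n" "k = 1" | "w = n" "k = 2" | "w = v" "k = 1" | "w = v" "k = 2" | "w \<noteq> n" "w \<noteq> v"
        using exhaust_2[of k] by blast
      then show ?thesis
      proof cases
        case 1
        have "orow r f (n, 1) = - dX r f" if "src f = v" "tgt f = n" for f
          using that f by (simp add: orow_def)
        then have "?S (n, 1) = - (c e1 * dX r f1 + c e2 * dX r f2 + c e3 * dX r f3)"
          using f by simp
        then show ?thesis using 1 L0 i \<open>c e1 * dX r f1 + c e2 * dX r f2 + c e3 * dX r f3 = 0\<close> by simp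
      next
        case 2 then show ?thesis using L0 i by simp
      next
        case 3 then show ?thesis using 1 at_v i f orow_outside[of v ?L r 1] by simp
      next
        case 4 then show ?thesis using 2 at_v i f orow_outside[of v ?L r 2] by simp
      next
        case 5 then show ?thesis using i f by (simp add: orow_outside)
      qed
    qed
    have "(\<Sum>e\<in>insert ?L H. d e * orow r e i) = 0" for i
    proof -
      have "(\<Sum>e\<in>H. d e * orow r e i) = (\<Sum>e\<in>H. c e * orow r e i)"
        by (rule sum.cong) (use L(1) in \<open>auto simp: d_def\<close>)
      then have "(\<Sum>e\<in>insert ?L H. d e * orow r e i) = ?S (n, 2) / orow r ?L (n, 2) * orow r ?L i + (\<Sum>e\<in>H. c e * orow r e i)"
        using H(1) L(1) by (simp add: d_def)
      with *[of i] show ?thesis unfolding dL[of i, symmetric] by linarith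
    qed
    then have d0: "d e = 0" if "e \<in> insert ?L H" for e
      by (rule indepD[OF r(1) _ that])
    have cH: "c e = 0" if "e \<in> H" for e
      using d0[of e] that L(1) by (auto simp: d_def split: if_splits)
    have "?S (n, 2) = 0" using d0[of ?L] L0 by (simp add: d_def)
    moreover have "orow r f (n, 2) = - sn (flp f) * dY r f" if "src f = v" "tgt f = n" for f
      using that f by (simp add: orow_def)
    ultimately have "sn (flp f1) * (c e1 * dY r f1 + c e2 * dY r f2 - c e3 * dY r f3) = 0"
      using f s' by (simp add: algebra_simps)
    \<comment> \<open>The third term has a plus sign in the equilibrium at \<open>v\<close> and a
      minus sign at \<open>n\<close>, because only the third edge has the other linear part. The
      difference isolates \<open>c e3\<close>.\<close>
    then have 3: "c e1 * dY r f1 + c e2 * dY r f2 - c e3 * dY r f3 = 0" by simp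
    with 2 have "c e3 * dY r f3 = 0" by linarith
    with r have c3: "c e3 = 0" by simp
    have "c e1 * spread r f1 f2 = 0" "c e2 * spread r f1 f2 = 0"
      using 1 2 c3 unfolding spread_def by algebra+
    with r have "c e1 = 0" "c e2 = 0" by auto
    with c3 cH e' show "c e = 0" by auto
  qed
  then show ?thesis by blast
qed


section \<open>Gluing the motions of tight subgraphs\<close>

text \<open>The vertexwise form of \<open>rigid_motion\<close>, in which motions described by
  different potentials can be compared at a shared vertex.\<close>

definition moves ::
  "('v::finite \<Rightarrow> real^2) \<Rightarrow> real^('v \<times> 2) \<Rightarrow> ('v \<Rightarrow> real) \<Rightarrow> ('v \<Rightarrow> real) \<Rightarrow> ('v \<Rightarrow> bool)
     \<Rightarrow> real \<Rightarrow> real \<Rightarrow> real \<Rightarrow> 'v \<Rightarrow> bool" where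
  "moves p u A B s k l \<omega> w \<longleftrightarrow> u $ (w, 1) = k - \<omega> * (sn (s w) * p w $ 2 + B w) \<and>
     u $ (w, 2) = sn (s w) * (l + \<omega> * (p w $ 1 + A w))"

lemma rigid_motion_moves: "w \<in> V \<Longrightarrow> moves p (rigid_motion p A B s V (k, l, \<omega>)) A B s k l \<omega> w"
  by (simp add: moves_def rigid_motion_def)

lemma rigid_motionI:
  assumes "u \<in> supported V" "\<forall>w\<in>V. moves p u A B s k l \<omega> w"
  shows "u = rigid_motion p A B s V (k, l, \<omega>)"
proof -
  have "u $ (w, c) = rigid_motion p A B s V (k, l, \<omega>) $ (w, c)" for w c
    using assms exhaust_2[of c] by (auto simp: rigid_motion_def moves_def supported_def)
  then show ?thesis by (simp add: vec_eq_iff)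
qed

lemma restrict_motion:
  assumes "u \<in> motions p F" "ends F \<subseteq> V"
  shows "(\<chi> i. if fst i \<in> V then u $ i else 0) \<in> motions p F \<inter> supported V"
proof -
  have "rowv p e \<bullet> (\<chi> i. if fst i \<in> V then u $ i else 0) = rowv p e \<bullet> u" if "e \<in> F" for e
    using that assms(2) by (auto simp: inner_rowv ends_def)
  then show ?thesis using assms(1) by (simp add: motions_def supported_def)
qed

lemma moves_restrict:
  "w \<in> V \<Longrightarrow> moves p (\<chi> i. if fst i \<in> V then u $ i else 0) A B s k l \<omega> w = moves p u A B s k l \<omega> w"
  by (simp add: moves_def)

text \<open>Multiplying a potential from the left by one isometry keeps every edge gain. A change of
  sign at \<open>n\<close> takes a reflection, which negates all of \<open>B\<close>; the integral
  target height keeps \<open>B\<close> integral.\<close>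

lemma fits_normalize:
  assumes "\<forall>w. B w \<in> \<int>" "\<forall>e\<in>F. fits A B s e" "b \<in> \<int>"
  shows "\<exists>A' B' s'. (\<forall>w. B' w \<in> \<int>) \<and> (\<forall>e\<in>F. fits A' B' s' e) \<and> A' n = a \<and> B' n = b \<and> s' n = \<sigma>"
proof (cases "s n = \<sigma>")
  case True
  show ?thesis
    by (rule exI[of _ "\<lambda>w. A w + (a - A n)"], rule exI[of _ "\<lambda>w. B w + (b - B n)"], rule exI[of _ s])
      (use assms True in \<open>auto simp: fits_def\<close>)
next
  case False
  show ?thesis
    by (rule exI[of _ "\<lambda>w. A w + (a - A n)"], rule exI[of _ "\<lambda>w. - B w + (b + B n)"],
        rule exI[of _ "\<lambda>w. \<not> s w"])
      (use assms False in \<open>auto simp: fits_def algebra_simps\<close>)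
qed

text \<open>The velocity at \<open>tgt f\<close>, transported by the gain of \<open>f\<close>,
  agrees with the field at the image point. No potential occurs, so motions coming from different
  subgraphs become comparable.\<close>

definition follows ::
  "('v::finite \<Rightarrow> real^2) \<Rightarrow> real^('v \<times> 2) \<Rightarrow> 'v gedge \<Rightarrow> real \<Rightarrow> real \<Rightarrow> real \<Rightarrow> bool" where
  "follows p u f k l \<omega> \<longleftrightarrow> u $ (tgt f, 1) = k - \<omega> * imgy p f \<and>
     sn (flp f) * u $ (tgt f, 2) = l + \<omega> * imgx p f"

text \<open>The type \<open>t\<close> is 0, 1, 2 according to whether \<open>F\<close> together with the chord is balanced, only
  purely periodic, or neither; it measures the loss of freedom in the common motion.\<close>

definition locked ::
  "('v::finite \<Rightarrow> real^2) \<Rightarrow> 'v gedge \<Rightarrow> 'v gedge \<Rightarrow> 'v gedge set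
     \<Rightarrow> ('v \<Rightarrow> real) \<Rightarrow> ('v \<Rightarrow> real) \<Rightarrow> ('v \<Rightarrow> bool) \<Rightarrow> nat \<Rightarrow> bool" where
  "locked p f g F A B s t \<longleftrightarrow>
     (t = 0 \<longrightarrow> (\<forall>w. B w \<in> \<int>) \<and> (\<forall>e\<in>F. fits A B s e) \<and>
        A (tgt f) = shx f \<and> B (tgt f) = shy f \<and> A (tgt g) = shx g \<and> B (tgt g) = shy g) \<and>
     (t \<le> 1 \<longrightarrow> (\<forall>e\<in>F. flp e = (s (src e) \<noteq> s (tgt e))) \<and> s (tgt f) = flp f \<and> s (tgt g) = flp g) \<and>
     (\<forall>u\<in>motions p F. \<exists>k l \<omega>. (1 \<le> t \<longrightarrow> \<omega> = 0) \<and> (2 \<le> t \<longrightarrow> l = 0) \<and>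
        (\<forall>w\<in>ends F \<union> {tgt f, tgt g}. moves p u A B s k l \<omega> w) \<and> follows p u f k l \<omega> \<and> follows p u g k l \<omega>)"

text \<open>At the ends of the chord the potential is pinned down only as far as the motion depends
  on it: fully for \<open>t = 0\<close>, in its sign for \<open>t = 1\<close>, not at all for
  \<open>t = 2\<close>. This is just enough to read off \<open>follows\<close>.\<close>

lemma locked_motion:
  fixes t :: nat
  assumes m: "motions p F \<inter> supported V \<subseteq> {rigid_motion p A B s V (k, l, \<omega>) |k l \<omega>.
      (1 \<le> t \<longrightarrow> \<omega> = 0) \<and> (2 \<le> t \<longrightarrow> l = 0)}"
    and V: "V = ends F \<union> {tgt f, tgt g}"
    and t0: "t = 0 \<Longrightarrow> A (tgt f) = shx f \<and> B (tgt f) = shy f \<and> A (tgt g) = shx g \<and> B (tgt g) = shy g"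
    and t1: "t \<le> 1 \<Longrightarrow> s (tgt f) = flp f \<and> s (tgt g) = flp g"
    and u: "u \<in> motions p F"
  shows "\<exists>k l \<omega>. (1 \<le> t \<longrightarrow> \<omega> = 0) \<and> (2 \<le> t \<longrightarrow> l = 0) \<and>
        (\<forall>w\<in>ends F \<union> {tgt f, tgt g}. moves p u A B s k l \<omega> w) \<and> follows p u f k l \<omega> \<and> follows p u g k l \<omega>"
proof -
  have "(\<chi> i. if fst i \<in> V then u $ i else 0) \<in> motions p F \<inter> supported V"
    using V by (intro restrict_motion[OF u]) blast
  with m obtain k l \<omega> where K: "(\<chi> i. if fst i \<in> V then u $ i else 0) = rigid_motion p A B s V (k, l, \<omega>)"
    "1 \<le> t \<longrightarrow> \<omega> = 0" "2 \<le> t \<longrightarrow> l = 0" by blast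
  have mv: "moves p u A B s k l \<omega> w" if "w \<in> V" for w
    using rigid_motion_moves[OF that, of p A B s k l \<omega>] moves_restrict[OF that, of p u A B s k l \<omega>] by (simp add: K(1))
  have "follows p u h k l \<omega>" if h: "h = f \<or> h = g" for h
  proof -
    have hV: "tgt h \<in> V" using h V by auto
    consider "t = 0" | "t = 1" | "2 \<le> t" by linarith
    then show ?thesis
    proof cases
      case 1 then show ?thesis using mv[OF hV] t0 t1 h by (auto simp: moves_def follows_def imgx_def imgy_def)
    next
      case 2 then show ?thesis using mv[OF hV] t1 h K by (auto simp: moves_def follows_def)
    next
      case 3 then show ?thesis using mv[OF hV] K by (auto simp: moves_def follows_def)
    qed
  qed
  with mv K V show ?thesis by blast
qed

text \<open>A violating set must contain the chord. Without the chord it still attains the bound on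
  the same vertices, and \<open>count_eq\<close> leaves only the rigid motions of type
  \<open>t\<close>.\<close>

lemma obstruction:
  assumes H: "finite H" "gain_sparse H" "indep UNIV p H"
    and L: "L = chord f g l" "L \<notin> H" "\<not> gain_sparse (insert L H)" "dX p L \<noteq> 0 \<or> dY p L \<noteq> 0"
    and int: "shy f \<in> \<int>"
  shows "\<exists>F A B s t. F \<subseteq> H \<and> locked p f g F A B s t"
proof -
  obtain F' where F': "F' \<subseteq> insert L H" "F' \<noteq> {}"
    and viol: "\<not> (card F' + 1 \<le> 2 * card (ends F') \<and>
     (periodic_set F' \<longrightarrow> card F' + 2 \<le> 2 * card (ends F')) \<and>
     (balanced_set F' \<longrightarrow> card F' + 3 \<le> 2 * card (ends F')))"
    using L(3) unfolding gain_sparse_def by blast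
  have "L \<in> F'"
  proof (rule ccontr)
    assume "L \<notin> F'"
    then have "F' \<subseteq> H" using F' by blast
    then show False using sparseD[OF H(2) _ F'(2)] viol by blast
  qed
  define F where "F = F' - {L}"
  \<comment> \<open>The ends of the chord stay in \<open>V\<close> even where \<open>F\<close>
    misses them; if the chord is a translation loop, \<open>F\<close> may be empty.\<close>
  define V where "V = ends F'"
  have F: "F \<subseteq> H" "F' = insert L F" "L \<notin> F" using F' \<open>L \<in> F'\<close> by (auto simp: F_def)
  have fin: "finite F" using F H finite_subset by blast
  have ind: "indep UNIV p F" using indep_mono[OF H(3) F(1) H(1)] .
  have card: "card F' = card F + 1" using F fin by simp
  have V: "V = ends F \<union> {tgt f, tgt g}" by (auto simp: V_def F ends_def L(1))
  have VF: "ends F \<subseteq> V" using V by blast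
  have V': "src L \<in> V" "tgt L \<in> V" by (auto simp: V L)
  then have Vne: "V \<noteq> {}" by blast
  \<comment> \<open>Dropping the chord turns a strict violation for \<open>F'\<close> into a weak
    bound for \<open>F\<close>, with constant 1, 2 or 3.\<close>
  consider (free) "2 * card V \<le> card F + DIM(real)"
    | (periodic) "periodic_set F'" "2 * card V \<le> card F + DIM(real \<times> real)"
    | (balanced) "balanced_set F'" "2 * card V \<le> card F + DIM(real \<times> real \<times> real)"
    using viol card unfolding V_def by fastforce
  then have "\<exists>A B s t. locked p f g F A B s t"
  proof cases
    case free
    let ?\<Phi> = "\<lambda>k :: real. rigid_motion p (\<lambda>_. 0) (\<lambda>_. 0) (\<lambda>_. False) V (k, 0, 0)"
    have "motions p F \<inter> supported V = range ?\<Phi>"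
      by (rule count_eq[OF fin ind VF linear_rigid_motion1 inj_rigid_motion1[OF Vne] _ free])
        (use rigid_motion_all[OF VF, where p = p] rigid_motion_supported in blast)
    then have "motions p F \<inter> supported V \<subseteq> {rigid_motion p (\<lambda>_. 0) (\<lambda>_. 0) (\<lambda>_. False) V (k, l, \<omega>) |k l \<omega>.
      (1 \<le> (2::nat) \<longrightarrow> \<omega> = 0) \<and> (2 \<le> (2::nat) \<longrightarrow> l = 0)}" by auto
    from locked_motion[OF this V]
    have "locked p f g F (\<lambda>_. 0) (\<lambda>_. 0) (\<lambda>_. False) 2" unfolding locked_def by auto
    then show ?thesis by blast
  next
    case periodic
    obtain s0 :: "'a \<Rightarrow> bool" where s0: "\<forall>e\<in>F'. flp e = (s0 (src e) \<noteq> s0 (tgt e))"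
      using periodic(1) unfolding periodic_set_def by blast
    \<comment> \<open>Flipped globally if necessary, to agree with the sign of \<open>f\<close> at
      \<open>tgt f\<close>; the chord then forces agreement at \<open>tgt g\<close>.\<close>
    define s where "s = (\<lambda>w. s0 w \<noteq> (s0 (tgt f) \<noteq> flp f))"
    have s: "\<forall>e\<in>F'. flp e = (s (src e) \<noteq> s (tgt e))" "s (tgt f) = flp f"
      using s0 by (auto simp: s_def)
    have sg: "s (tgt g) = flp g" using s(1) \<open>L \<in> F'\<close> s(2) L(1) by fastforce
    have sF: "\<forall>e\<in>F. flp e = (s (src e) \<noteq> s (tgt e))" using s F by simp
    let ?\<Phi> = "\<lambda>(k, l). rigid_motion p (\<lambda>_. 0) (\<lambda>_. 0) s V (k, l, 0)"
    have "motions p F \<inter> supported V = range ?\<Phi>"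
      by (rule count_eq[OF fin ind VF linear_rigid_motion2 inj_rigid_motion2[OF Vne] _ periodic(2)])
        (use rigid_motion_per[OF sF VF, where p = p] rigid_motion_supported in force)
    then have "motions p F \<inter> supported V \<subseteq> {rigid_motion p (\<lambda>_. 0) (\<lambda>_. 0) s V (k, l, \<omega>) |k l \<omega>.
      (1 \<le> (1::nat) \<longrightarrow> \<omega> = 0) \<and> (2 \<le> (1::nat) \<longrightarrow> l = 0)}" by auto
    from locked_motion[OF this V] s(2) sg sF
    have "locked p f g F (\<lambda>_. 0) (\<lambda>_. 0) s 1" unfolding locked_def by auto
    then show ?thesis by blast
  next
    case balanced
    then obtain A0 B0 s0 where "\<forall>w. B0 w \<in> \<int>" "\<forall>e\<in>F'. fits A0 B0 s0 e"
      by (auto simp: balanced_set_def)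
    \<comment> \<open>Normalized to be the gain of \<open>f\<close> at \<open>tgt f\<close>. As the
      chord has the gain of \<open>g\<close> preceded by the inverse of that of \<open>f\<close>,
      the value at \<open>tgt g\<close> must be the gain of \<open>g\<close>.\<close>
    from fits_normalize[OF this int]
    obtain A B s where P: "\<forall>w. B w \<in> \<int>" "\<forall>e\<in>F'. fits A B s e"
      "A (tgt f) = shx f" "B (tgt f) = shy f" "s (tgt f) = flp f" by blast
    have fL: "fits A B s L" using P(2) \<open>L \<in> F'\<close> by blast
    then have Pg: "A (tgt g) = shx g" "s (tgt g) = flp g" using P L(1) by (auto simp: fits_def)
    have "sn (flp f) * (B (tgt g) - shy f) = sn (flp f) * (shy g - shy f)"
      using fL P L(1) by (simp add: fits_def)
    then have Pg': "B (tgt g) = shy g" by simp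
    have inj: "inj (rigid_motion p A B s V)"
      by (rule inj_rigid_motion[OF V']) (use L(4) fits_dX[OF fL, of p] fits_dY[OF fL, of p] in auto)
    have fF: "\<forall>e\<in>F. fits A B s e" using P F by simp
    have "motions p F \<inter> supported V = range (rigid_motion p A B s V)"
      by (rule count_eq[OF fin ind VF linear_rigid_motion inj _ balanced(2)])
        (use rigid_motion_bal[OF fF VF, where p = p] rigid_motion_supported in blast)
    then have "motions p F \<inter> supported V \<subseteq> {rigid_motion p A B s V (k, l, \<omega>) |k l \<omega>.
      (1 \<le> (0::nat) \<longrightarrow> \<omega> = 0) \<and> (2 \<le> (0::nat) \<longrightarrow> l = 0)}" by auto
    from locked_motion[OF this V] P Pg Pg' fF
    have "locked p f g F A B s 0" unfolding locked_def by (auto simp: fits_def)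
    then show ?thesis by blast
  qed
  with F(1) show ?thesis by blast
qed

text \<open>At each corner two of the three fields agree. Differences along the sides give a linear
  relation between two independent side vectors whose coefficients are differences of angular
  velocities; these vanish, and the translational parts follow.\<close>

lemma triangle_motion:
  assumes "follows p u f k3 l3 w3" "follows p u g k3 l3 w3"
    and "follows p u g k1 l1 w1" "follows p u h k1 l1 w1"
    and "follows p u f k2 l2 w2" "follows p u h k2 l2 w2"
    and D: "collinearity p f g h \<noteq> 0"
  shows "k1 = k3 \<and> k2 = k3 \<and> l1 = l3 \<and> l2 = l3 \<and> w1 = w3 \<and> w2 = w3"
proof -
  define x1 x2 x3 y1 y2 y3 where "x1 = imgx p f" "x2 = imgx p g" "x3 = imgx p h"
    "y1 = imgy p f" "y2 = imgy p g" "y3 = imgy p h"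
  note d = this
  have x: "k3 - w3 * y1 = k2 - w2 * y1" "k3 - w3 * y2 = k1 - w1 * y2" "k1 - w1 * y3 = k2 - w2 * y3"
    and y: "l3 + w3 * x1 = l2 + w2 * x1" "l3 + w3 * x2 = l1 + w1 * x2" "l1 + w1 * x3 = l2 + w2 * x3"
    using assms unfolding follows_def d by auto
  define a b c d where "a = x2 - x1" "b = y2 - y1" "c = x3 - x2" "d = y3 - y2"
  note e = this
  have "a * d - c * b \<noteq> 0"
    using D unfolding collinearity_def d[symmetric] e by (simp add: algebra_simps)
  moreover have "(w3 - w2) * a + (w1 - w2) * c = 0" "(w3 - w2) * b + (w1 - w2) * d = 0"
    using x y unfolding e by (simp_all add: algebra_simps)
  then have "(w3 - w2) * (a * d - c * b) = 0" "(w1 - w2) * (a * d - c * b) = 0" by algebra+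
  ultimately have "w3 = w2" "w1 = w2" by auto
  with x y show ?thesis by simp
qed

text \<open>Reading one motion through two potentials at a shared vertex costs freedom: different
  potential values force \<omega> = 0, different linear parts also l = 0. So either the potentials
  merge on the union or the motions have fewer parameters, and \<open>count_ge\<close> turns the
  number of parameters into an edge count.\<close>

lemma glue_motions:
  fixes p :: "'v::finite \<Rightarrow> real^2" and F :: "'i \<Rightarrow> 'v gedge set" and V :: "'i \<Rightarrow> 'v set" and I :: "'i set" and t :: "'i \<Rightarrow> nat"
  defines "FF \<equiv> \<Union>i\<in>I. F i" and "VV \<equiv> \<Union>i\<in>I. V i"
  assumes F: "finite FF" "indep UNIV p FF" "ends FF \<subseteq> VV"
    and y: "\<And>w. 2 * p w $ 2 \<notin> \<int>"
    and int: "\<And>i w. i \<in> I \<Longrightarrow> t i = 0 \<Longrightarrow> B i w \<in> \<int>"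
    and motion: "\<And>u. u \<in> motions p FF \<Longrightarrow> \<exists>k l \<omega>. \<forall>i\<in>I. (1 \<le> t i \<longrightarrow> \<omega> = 0) \<and> (2 \<le> t i \<longrightarrow> l = 0) \<and>
          (\<forall>w\<in>V i. moves p u (A i) (B i) (s i) k l \<omega> w)"
  obtains (balanced) A' B' s' where "\<And>i w. i \<in> I \<Longrightarrow> w \<in> V i \<Longrightarrow> A' w = A i w \<and> B' w = B i w \<and> s' w = s i w"
      "\<And>w. w \<notin> VV \<Longrightarrow> B' w = 0 \<and> A' w = 0 \<and> s' w = False" "\<And>i. i \<in> I \<Longrightarrow> t i = 0" "2 * card VV \<le> card FF + 3"
    | (periodic) s' where "\<And>i w. i \<in> I \<Longrightarrow> w \<in> V i \<Longrightarrow> s' w = s i w" "\<And>w. w \<notin> VV \<Longrightarrow> s' w = False"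
      "\<And>i. i \<in> I \<Longrightarrow> t i \<le> 1" "2 * card VV \<le> card FF + 2"
    | (free) "2 * card VV \<le> card FF + 1"
proof -
  define j where "j w = (SOME i. i \<in> I \<and> w \<in> V i)" for w
  have j: "j w \<in> I \<and> w \<in> V (j w)" if "i \<in> I" "w \<in> V i" for i w
    unfolding j_def by (rule someI[of _ i]) (use that in blast)
  \<comment> \<open>The value outside \<open>VV\<close> is the identity; this will be the value at
    the deleted vertex.\<close>
  define A' B' s' where "A' w = (if w \<in> VV then A (j w) w else 0)"
    and "B' w = (if w \<in> VV then B (j w) w else 0)"
    and "s' w = (if w \<in> VV then s (j w) w else False)" for w
  let ?s = "\<forall>i\<in>I. \<forall>j\<in>I. \<forall>w\<in>V i \<inter> V j. s i w = s j w"
  let ?AB = "\<forall>i\<in>I. \<forall>j\<in>I. \<forall>w\<in>V i \<inter> V j. A i w = A j w \<and> B i w = B j w"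
  have VV: "w \<in> VV" if "i \<in> I" "w \<in> V i" for i w using that by (auto simp: VV_def)
  have s': "s' w = s i w" if "?s" "i \<in> I" "w \<in> V i" for i w
  proof -
    have "j w \<in> I" "w \<in> V (j w)" "w \<in> VV" using j[OF that(2,3)] VV[OF that(2,3)] by auto
    moreover from this that have "s (j w) w = s i w" by blast
    ultimately show ?thesis by (simp add: s'_def)
  qed
  have AB': "A' w = A i w \<and> B' w = B i w" if "?AB" "i \<in> I" "w \<in> V i" for i w
  proof -
    have "j w \<in> I" "w \<in> V (j w)" "w \<in> VV" using j[OF that(2,3)] VV[OF that(2,3)] by auto
    moreover from this that have "A (j w) w = A i w \<and> B (j w) w = B i w" by blast
    ultimately show ?thesis by (simp add: A'_def B'_def)
  qed
  show thesis
  proof (cases "?s \<and> ?AB \<and> (\<forall>i\<in>I. t i = 0)")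
    case True
    have "u \<in> range (rigid_motion p A' B' s' VV)" if "u \<in> motions p FF \<inter> supported VV" for u
    proof -
      from motion[OF IntD1[OF that]] obtain k l \<omega>
        where "\<forall>i\<in>I. (1 \<le> t i \<longrightarrow> \<omega> = 0) \<and> (2 \<le> t i \<longrightarrow> l = 0) \<and>
          (\<forall>w\<in>V i. moves p u (A i) (B i) (s i) k l \<omega> w)" by blast
      then have K: "\<forall>i\<in>I. \<forall>w\<in>V i. moves p u (A i) (B i) (s i) k l \<omega> w" by blast
      have "moves p u A' B' s' k l \<omega> w" if w: "w \<in> VV" for w
      proof -
        obtain i where i: "i \<in> I" "w \<in> V i" using w by (auto simp: VV_def)
        have "A' w = A i w \<and> B' w = B i w" using AB'[OF _ i] True by blast
        moreover have "s' w = s i w" using s'[OF _ i] True by blast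
        moreover have "moves p u (A i) (B i) (s i) k l \<omega> w" using K i by blast
        ultimately show ?thesis by (simp add: moves_def)
      qed
      then have "u = rigid_motion p A' B' s' VV (k, l, \<omega>)" using that by (intro rigid_motionI) auto
      then show ?thesis by blast
    qed
    then have "2 * card VV \<le> card FF + DIM(real \<times> real \<times> real)"
      by (intro count_ge[OF F linear_rigid_motion]) blast
    then show thesis
    proof (intro balanced[of A' B' s'])
      show "A' w = A i w \<and> B' w = B i w \<and> s' w = s i w" if "i \<in> I" "w \<in> V i" for i w
        using s'[OF _ that] AB'[OF _ that] True by blast
      show "t i = 0" if "i \<in> I" for i using True that by blast
    qed (simp_all add: A'_def B'_def s'_def)
  next
    case nbal: False
    have motion': "\<exists>k l. \<forall>i\<in>I. (2 \<le> t i \<longrightarrow> l = 0) \<and>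
          (\<forall>w\<in>V i. moves p u (A i) (B i) (s i) k l 0 w)" if u: "u \<in> motions p FF" for u
    proof -
      obtain k l \<omega> where K: "\<forall>i\<in>I. (1 \<le> t i \<longrightarrow> \<omega> = 0) \<and> (2 \<le> t i \<longrightarrow> l = 0) \<and>
          (\<forall>w\<in>V i. moves p u (A i) (B i) (s i) k l \<omega> w)" using motion[OF u] by blast
      have "\<omega> = 0"
      proof (cases "\<forall>i\<in>I. t i = 0")
        case False
        then obtain i where "i \<in> I" "1 \<le> t i" by force
        with K show ?thesis by blast
      next
        case t: True
        with nbal obtain i i' w where i: "i \<in> I" "i' \<in> I" "w \<in> V i" "w \<in> V i'"
          and ne: "s i w \<noteq> s i' w \<or> A i w \<noteq> A i' w \<or> B i w \<noteq> B i' w" by blast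
        have "moves p u (A i) (B i) (s i) k l \<omega> w" "moves p u (A i') (B i') (s i') k l \<omega> w"
          using K i by blast+
        then have 1: "\<omega> * (sn (s i w) * p w $ 2 + B i w) = \<omega> * (sn (s i' w) * p w $ 2 + B i' w)"
          and 2: "sn (s i w) * (l + \<omega> * (p w $ 1 + A i w)) = sn (s i' w) * (l + \<omega> * (p w $ 1 + A i' w))"
          by (simp_all add: moves_def)
        show ?thesis
        proof (cases "s i w = s i' w")
          case True
          then have "\<omega> * B i w = \<omega> * B i' w" using 1 by (simp add: algebra_simps)
          moreover have "\<omega> * A i w = \<omega> * A i' w" using 2 True by (simp add: algebra_simps)
          ultimately show ?thesis using ne True by auto
        next
          case False
          then have s: "sn (s i' w) = - sn (s i w)" by (auto simp: sn_def)
          \<comment> \<open>Opposite signs: the first coordinates leave \<omega> times the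
            difference of an integer and, up to sign, twice the height of \<open>w\<close>. This is
            where \<open>y\<close> enters.\<close>
          have "\<omega> * (sn (s i w) * (2 * p w $ 2) - (B i' w - B i w)) = 0"
            using 1 unfolding s by (simp add: algebra_simps)
          moreover have "sn (s i w) * (2 * p w $ 2) - (B i' w - B i w) \<noteq> 0"
          proof
            assume "sn (s i w) * (2 * p w $ 2) - (B i' w - B i w) = 0"
            then have "sn (s i w) * (sn (s i w) * (2 * p w $ 2)) = sn (s i w) * (B i' w - B i w)" by simp
            then have "2 * p w $ 2 = sn (s i w) * (B i' w - B i w)" by simp
            moreover have "sn (s i w) * (B i' w - B i w) \<in> \<int>"
              using int i t by (intro Ints_mult Ints_diff) auto
            ultimately show False using y[of w] by simp
          qed
          ultimately show ?thesis by simp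
        qed
      qed
      with K show ?thesis by blast
    qed
    show thesis
    proof (cases "?s \<and> (\<forall>i\<in>I. t i \<le> 1)")
      case True
      have "u \<in> range (\<lambda>(k, l). rigid_motion p (\<lambda>_. 0) (\<lambda>_. 0) s' VV (k, l, 0))"
        if "u \<in> motions p FF \<inter> supported VV" for u
      proof -
        from motion'[OF IntD1[OF that]] obtain k l where "\<forall>i\<in>I. (2 \<le> t i \<longrightarrow> l = 0) \<and>
          (\<forall>w\<in>V i. moves p u (A i) (B i) (s i) k l 0 w)" by blast
        then have K: "\<forall>i\<in>I. \<forall>w\<in>V i. moves p u (A i) (B i) (s i) k l 0 w" by blast
        have "moves p u (\<lambda>_. 0) (\<lambda>_. 0) s' k l 0 w" if w: "w \<in> VV" for w
        proof -
          obtain i where i: "i \<in> I" "w \<in> V i" using w by (auto simp: VV_def)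
          have "s' w = s i w" using s'[OF _ i] True by blast
          moreover have "moves p u (A i) (B i) (s i) k l 0 w" using K i by blast
          ultimately show ?thesis by (simp add: moves_def)
        qed
        then have "u = rigid_motion p (\<lambda>_. 0) (\<lambda>_. 0) s' VV (k, l, 0)" using that by (intro rigid_motionI) auto
        then show ?thesis by (intro range_eqI[of _ _ "(k, l)"]) simp
      qed
      then have "2 * card VV \<le> card FF + DIM(real \<times> real)"
        by (intro count_ge[OF F linear_rigid_motion2]) blast
      then show thesis
      proof (intro periodic[of s'])
        show "s' w = s i w" if "i \<in> I" "w \<in> V i" for i w using s'[OF _ that] True by blast
        show "t i \<le> 1" if "i \<in> I" for i using True that by blast
      qed (simp_all add: s'_def)
    next
      case False
      have "u \<in> range (\<lambda>k. rigid_motion p (\<lambda>_. 0) (\<lambda>_. 0) (\<lambda>_. False) VV (k, 0, 0))"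
        if u: "u \<in> motions p FF \<inter> supported VV" for u
      proof -
        obtain k l where K: "\<forall>i\<in>I. (2 \<le> t i \<longrightarrow> l = 0) \<and> (\<forall>w\<in>V i. moves p u (A i) (B i) (s i) k l 0 w)"
          using motion'[OF IntD1[OF u]] by blast
        have "l = 0"
        proof (cases "\<forall>i\<in>I. t i \<le> 1")
          case False
          then obtain i where "i \<in> I" "2 \<le> t i" by force
          with K show ?thesis by blast
        next
          case True
          with False obtain i i' w where i: "i \<in> I" "i' \<in> I" "w \<in> V i" "w \<in> V i'" "s i w \<noteq> s i' w"
            by blast
          have "moves p u (A i) (B i) (s i) k l 0 w" "moves p u (A i') (B i') (s i') k l 0 w"
            using K i by blast+
          then have "sn (s i w) * l = sn (s i' w) * l" by (simp add: moves_def)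
          with i(5) show ?thesis by (auto simp: sn_def split: if_splits)
        qed
        have "moves p u (\<lambda>_. 0) (\<lambda>_. 0) (\<lambda>_. False) k 0 0 w" if w: "w \<in> VV" for w
        proof -
          obtain i where "i \<in> I" "w \<in> V i" using w by (auto simp: VV_def)
          then have "moves p u (A i) (B i) (s i) k l 0 w" using K by blast
          then show ?thesis using \<open>l = 0\<close> by (simp add: moves_def)
        qed
        then have "u = rigid_motion p (\<lambda>_. 0) (\<lambda>_. 0) (\<lambda>_. False) VV (k, 0, 0)" using u by (intro rigid_motionI) auto
        then show ?thesis by blast
      qed
      then have "2 * card VV \<le> card FF + DIM(real)"
        by (intro count_ge[OF F linear_rigid_motion1]) blast
      then show thesis using free by simp
    qed
  qed
qed


section \<open>Sparse edge sets are independent\<close>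

lemma fits_cong:
  assumes "A (src e) = A' (src e)" "A (tgt e) = A' (tgt e)" "B (src e) = B' (src e)" "B (tgt e) = B' (tgt e)"
    "s (src e) = s' (src e)" "s (tgt e) = s' (tgt e)"
  shows "fits A B s e = fits A' B' s' e"
  using assms by (simp add: fits_def)

lemma balanced_setI: "\<forall>e\<in>F. fits A B s e \<Longrightarrow> \<forall>w. B w \<in> \<int> \<Longrightarrow> balanced_set F"
  unfolding balanced_set_def by iprover

lemma periodic_setI:
  fixes s :: "'v \<Rightarrow> bool"
  shows "\<forall>e\<in>F. flp e = (s (src e) \<noteq> s (tgt e)) \<Longrightarrow> periodic_set F"
  unfolding periodic_set_def by iprover

lemma ends_star_edge:
  assumes "src (orient v e) = v"
  shows "ends {e} = {v, tgt (orient v e)}"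
  using orient_ends[of v e] assms by (auto simp: ends_def)

text \<open>Two parallel edges of equal gain are balanced on two vertices, and 2 + 3 exceeds 4.
  Labels alone could keep such edges apart, so distinct gains have to come from the count.\<close>

lemma sparse_gain_distinct:
  fixes E :: "'v gedge set"
  assumes sp: "gain_sparse E" and e: "e \<in> E" "e' \<in> E" "e \<noteq> e'" and int: "shy e \<in> \<int>"
    and v: "src (orient v e) = v" "tgt (orient v e) \<noteq> v" "src (orient v e') = v" "tgt (orient v e') \<noteq> v"
  shows "tgt (orient v e) \<noteq> tgt (orient v e') \<or> shx (orient v e) \<noteq> shx (orient v e') \<or>
    shy (orient v e) \<noteq> shy (orient v e') \<or> flp (orient v e) \<noteq> flp (orient v e')"
proof (rule ccontr)
  assume same: "\<not> ?thesis"
  define f f' where "f = orient v e" and "f' = orient v e'"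
  note ff' = this
  let ?A = "\<lambda>w. if w = tgt f then shx f else 0"
  let ?B = "\<lambda>w. if w = tgt f then shy f else 0"
  let ?s = "\<lambda>w. w = tgt f \<and> flp f"
  have "fits ?A ?B ?s f" "fits ?A ?B ?s f'"
    using same v unfolding ff'[symmetric] by (auto simp: fits_def)
  then have "\<forall>e\<in>{e, e'}. fits ?A ?B ?s e" unfolding ff' fits_orient by simp
  moreover have "shy f \<in> \<int>" using int by (auto simp: f_def intro!: orient_shy_Ints)
  then have "\<forall>w. ?B w \<in> \<int>" by simp
  ultimately have "balanced_set {e, e'}" by (rule balanced_setI)
  moreover have "{e, e'} \<subseteq> E" using e by blast
  ultimately have "card {e, e'} + 3 \<le> 2 * card (ends {e, e'})" using sparseD(3)[OF sp] by blast
  moreover have "ends {e, e'} = ends {e} \<union> ends {e'}" by (auto simp: ends_def)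
  then have "ends {e, e'} = {v, tgt f}"
    using ends_star_edge[OF v(1)] ends_star_edge[OF v(3)] same by (auto simp: ff')
  moreover have "card {v, tgt f} \<le> 2" by (simp add: card_insert_if)
  ultimately show False using e(3) by simp
qed

text \<open>No vertex lies on a reflection axis of \<open>pm\<close>.\<close>

definition off_axes :: "('v \<Rightarrow> real^2) \<Rightarrow> bool" where
  "off_axes p \<longleftrightarrow> (\<forall>w\<in>UNIV. 2 * p w $ 2 \<notin> \<int>)"

lemma not_half_integer_quarter: "2 * (vector [0, 1/4] :: real^2) $ 2 \<notin> \<int>"
proof
  assume "2 * (vector [0, 1/4] :: real^2) $ 2 \<in> \<int>"
  then obtain z :: int where "of_int z = (1/2 :: real)" by (auto elim!: Ints_cases)
  then have "of_int (2 * z) = (of_int 1 :: real)" by simp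
  then have "2 * z = 1" by (simp only: of_int_eq_iff)
  then show False by presburger
qed

lemma off_axes_exists: "\<exists>p. off_axes p"
  using not_half_integer_quarter by (intro exI[of _ "\<lambda>_. vector [0, 1/4]"]) (simp add: off_axes_def)

lemma generic_condition_off_axes: "generic_condition (off_axes :: ('v::finite \<Rightarrow> real^2) \<Rightarrow> bool)"
  unfolding off_axes_def
proof (rule conjunct1[OF generic_condition_ball])
  show "\<exists>p :: 'v \<Rightarrow> real^2. 2 * p w $ 2 \<notin> \<int>" for w
    using not_half_integer_quarter by (intro exI[of _ "\<lambda>_. vector [0, 1/4]"])
qed (simp_all add: generic_condition_not_half_integer)

text \<open>The induction hypothesis reaches \<open>card H + 1\<close>, enough for \<open>H\<close>
  with one new edge, chord or loop. The assumptions are symmetric in the three edges, so each lemma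
  can be applied after a permutation.\<close>

locale cubic_vertex =
  fixes H :: "'v::finite gedge set" and v :: 'v and e1 e2 e3 :: "'v gedge"
  assumes fin: "finite H" and v: "v \<notin> ends H"
    and dist: "e1 \<noteq> e2" "e2 \<noteq> e3" "e1 \<noteq> e3"
    and star: "e \<in> {e1, e2, e3} \<Longrightarrow> src (orient v e) = v \<and> tgt (orient v e) \<noteq> v"
    and int: "e \<in> H \<union> {e1, e2, e3} \<Longrightarrow> shy e \<in> \<int>"
    and sp: "gain_sparse (H \<union> {e1, e2, e3})"
    and IH: "\<And>E' :: 'v gedge set. finite E' \<Longrightarrow> card E' \<le> card H + 1 \<Longrightarrow> (\<forall>e\<in>E'. shy e \<in> \<int>) \<Longrightarrow> gain_sparse E' \<Longrightarrow>
      \<exists>p. indep UNIV p E'"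
begin

abbreviation "f1 \<equiv> orient v e1"
abbreviation "f2 \<equiv> orient v e2"
abbreviation "f3 \<equiv> orient v e3"

lemma star_simps: "src f1 = v" "src f2 = v" "src f3 = v" "tgt f1 \<noteq> v" "tgt f2 \<noteq> v" "tgt f3 \<noteq> v"
  using star by auto

lemma rotate: "cubic_vertex H v e2 e3 e1"
proof -
  have "{e2, e3, e1} = {e1, e2, e3}" by blast
  then show ?thesis
    unfolding cubic_vertex_def using fin v dist star int sp IH by simp
qed

lemma swap: "cubic_vertex H v e1 e3 e2"
proof -
  have "{e1, e3, e2} = {e1, e2, e3}" by blast
  then show ?thesis
    unfolding cubic_vertex_def using fin v dist star int sp IH by simp
qed

lemma int_f: "shy f1 \<in> \<int>" "shy f2 \<in> \<int>" "shy f3 \<in> \<int>"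
  using int by (simp_all add: orient_shy_Ints)

lemma sparse_H: "gain_sparse H"
  using sp by (rule sparse_mono) blast

lemma indep_H: "\<exists>p. indep UNIV p H"
  using IH[OF fin _ _ sparse_H] int by simp

lemma disj: "H \<inter> {e1, e2, e3} = {}"
  by (rule disjoint_star[OF v]) (use star_simps in \<open>simp add: orient_src_iff\<close>)

lemma ends_star: "e \<in> {e1, e2, e3} \<Longrightarrow> ends {e} = {v, tgt (orient v e)}"
  by (rule ends_star_edge) (use star in blast)

text \<open>A new label separates the chord from an edge of \<open>H\<close> with the same ends and
  gain; such a coincidence then appears as a violated count, instead of the insertion adding
  nothing.\<close>

lemma fresh: "\<exists>l. \<forall>e\<in>H. lbl e \<noteq> l"
proof -
  obtain l where "l \<notin> lbl ` H"
    using ex_new_if_finite[OF infinite_UNIV_nat finite_imageI[OF fin]] by blast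
  then show ?thesis by (intro exI[of _ l]) blast
qed

lemma some_chord_sparse:
  assumes p: "indep UNIV p H" "collinearity p f1 f2 f3 \<noteq> 0" "\<And>w. 2 * p w $ 2 \<notin> \<int>"
    and lab: "\<forall>e\<in>H. lbl e \<noteq> l"
  shows "gain_sparse (insert (chord f1 f2 l) H) \<or> gain_sparse (insert (chord f2 f3 l) H) \<or> gain_sparse (insert (chord f1 f3 l) H)"
proof (rule ccontr)
  assume contra: "\<not> ?thesis"
  define I where "I = {0, 1, 2 :: nat}"
  \<comment> \<open>The sides of the triangle of images: 0 joins \<open>f1\<close> and
    \<open>f2\<close>, 1 joins \<open>f2\<close> and \<open>f3\<close>, 2 joins \<open>f1\<close>
    and \<open>f3\<close>.\<close>
  define fa where "fa i = (if i = 1 then f2 else f1)" for i :: nat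
  define fb where "fb i = (if i = 0 then f2 else f3)" for i :: nat
  have "\<exists>F A B s t. F \<subseteq> H \<and> locked p (fa i) (fb i) F A B s t" if "i \<in> I" for i
  proof (rule obstruction[OF fin sparse_H p(1) refl, where l = l])
    show "chord (fa i) (fb i) l \<notin> H" using lab by auto
    show "\<not> gain_sparse (insert (chord (fa i) (fb i) l) H)"
      using contra that by (auto simp: I_def fa_def fb_def)
    have "imgx p (fa i) \<noteq> imgx p (fb i) \<or> imgy p (fa i) \<noteq> imgy p (fb i)"
      using p(2) that by (auto simp: I_def fa_def fb_def collinearity_def)
    then show "dX p (chord (fa i) (fb i) l) \<noteq> 0 \<or> dY p (chord (fa i) (fb i) l) \<noteq> 0"
      by (simp add: dX_chord dY_chord)
    show "shy (fa i) \<in> \<int>" using int_f by (simp add: fa_def)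
  qed
  then have "\<forall>i\<in>I. \<exists>F A B s t. F \<subseteq> H \<and> locked p (fa i) (fb i) F A B s t" by blast
  then obtain F A B s t where
    "\<forall>i\<in>I. F i \<subseteq> H \<and> locked p (fa i) (fb i) (F i) (A i) (B i) (s i) (t i)"
    unfolding bchoice_iff by blast
  then have FH: "\<And>i. i \<in> I \<Longrightarrow> F i \<subseteq> H"
    and lk: "\<And>i. i \<in> I \<Longrightarrow> locked p (fa i) (fb i) (F i) (A i) (B i) (s i) (t i)" by blast+
  define V where "V i = ends (F i) \<union> {tgt (fa i), tgt (fb i)}" for i
  let ?F = "\<Union>i\<in>I. F i" and ?V = "\<Union>i\<in>I. V i"
  have FFH: "?F \<subseteq> H" using FH by blast
  have finF: "finite ?F" using finite_subset[OF FFH fin] .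
  have indF: "indep UNIV p ?F" using indep_mono[OF p(1) FFH fin] .
  have endsF: "ends ?F \<subseteq> ?V" by (auto simp: V_def ends_def)
  have Vi: "src e \<in> V i \<and> tgt e \<in> V i" if "e \<in> F i" for e i using that by (auto simp: V_def ends_def)
  have "v \<notin> V i" if "i \<in> I" for i
    using v FH[OF that] star_simps by (auto simp: V_def ends_def fa_def fb_def)
  then have vV: "v \<notin> ?V" by blast
  have int': "B i w \<in> \<int>" if "i \<in> I" "t i = 0" for i w
    using lk[OF that(1)] that(2) unfolding locked_def by blast
  have mot: "\<exists>k l \<omega>. \<forall>i\<in>I. (1 \<le> t i \<longrightarrow> \<omega> = 0) \<and> (2 \<le> t i \<longrightarrow> l = 0) \<and>
          (\<forall>w\<in>V i. moves p u (A i) (B i) (s i) k l \<omega> w)" if u: "u \<in> motions p ?F" for u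
  proof -
    have "\<exists>k l \<omega>. (1 \<le> t i \<longrightarrow> \<omega> = 0) \<and> (2 \<le> t i \<longrightarrow> l = 0) \<and>
          (\<forall>w\<in>V i. moves p u (A i) (B i) (s i) k l \<omega> w) \<and> follows p u (fa i) k l \<omega> \<and> follows p u (fb i) k l \<omega>"
      if i: "i \<in> I" for i
    proof -
      have "u \<in> motions p (F i)" using u i by (auto simp: motions_def)
      then show ?thesis using lk[OF i] unfolding locked_def V_def by blast
    qed
    then have "\<forall>i\<in>I. \<exists>k l \<omega>. (1 \<le> t i \<longrightarrow> \<omega> = 0) \<and> (2 \<le> t i \<longrightarrow> l = 0) \<and>
          (\<forall>w\<in>V i. moves p u (A i) (B i) (s i) k l \<omega> w) \<and> follows p u (fa i) k l \<omega> \<and> follows p u (fb i) k l \<omega>"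
      by blast
    then obtain k l \<omega> where K: "\<forall>i\<in>I. (1 \<le> t i \<longrightarrow> \<omega> i = 0) \<and> (2 \<le> t i \<longrightarrow> l i = 0) \<and>
          (\<forall>w\<in>V i. moves p u (A i) (B i) (s i) (k i) (l i) (\<omega> i) w) \<and>
          follows p u (fa i) (k i) (l i) (\<omega> i) \<and> follows p u (fb i) (k i) (l i) (\<omega> i)"
      unfolding bchoice_iff by blast
    have fol: "follows p u (fa i) (k i) (l i) (\<omega> i)" "follows p u (fb i) (k i) (l i) (\<omega> i)" if "i \<in> I" for i
      using K that by blast+
    have "k 1 = k 0 \<and> k 2 = k 0 \<and> l 1 = l 0 \<and> l 2 = l 0 \<and> \<omega> 1 = \<omega> 0 \<and> \<omega> 2 = \<omega> 0"
      by (rule triangle_motion[OF _ _ _ _ _ _ p(2), where u = u])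
        (use fol[of 0] fol[of 1] fol[of 2] in \<open>auto simp: fa_def fb_def I_def\<close>)
    then have "k i = k 0 \<and> l i = l 0 \<and> \<omega> i = \<omega> 0" if "i \<in> I" for i
      using that by (auto simp: I_def)
    with K show ?thesis by (intro exI[of _ "k 0"] exI[of _ "l 0"] exI[of _ "\<omega> 0"]) auto
  qed
  let ?E = "?F \<union> {e1, e2, e3}"
  have card3: "card {e1, e2, e3} = 3" using dist by auto
  have "?F \<inter> {e1, e2, e3} = {}" using disj FFH by blast
  \<comment> \<open>Three edges and at most one vertex more: 2|V| - |F| drops by at least 1, one too
    much for whichever of the three bounds applies.\<close>
  then have cE: "card ?E = card ?F + 3"
    using card_Un_disjoint[of ?F "{e1, e2, e3}"] finF card3 by simp
  have tgtV: "\<exists>i\<in>I. orient v e = fa i \<or> orient v e = fb i" if "e \<in> {e1, e2, e3}" for e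
    using that by (auto simp: I_def fa_def fb_def)
  have es: "ends {e} \<subseteq> insert v ?V" if "e \<in> {e1, e2, e3}" for e
  proof -
    from tgtV[OF that] obtain i where i: "i \<in> I" "orient v e = fa i \<or> orient v e = fb i" by blast
    from i(2) have "tgt (orient v e) \<in> V i" unfolding V_def by auto
    with i(1) show ?thesis unfolding ends_star[OF that] by blast
  qed
  have "ends ?E = ends ?F \<union> ends {e1} \<union> ends {e2} \<union> ends {e3}" by (auto simp: ends_def)
  also have "\<dots> \<subseteq> insert v ?V" using endsF es[of e1] es[of e2] es[of e3] by (intro Un_least subset_trans[OF endsF]) blast+
  finally have "card (ends ?E) \<le> card (insert v ?V)" by (intro card_mono) auto
  then have cV: "card (ends ?E) \<le> card ?V + 1" using vV by simp
  have EE: "?E \<subseteq> H \<union> {e1, e2, e3}" "?E \<noteq> {}" using FFH by auto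
  show False
  proof (rule glue_motions[of F I p V t B A s, OF finF indF endsF p(3)])
    show "B i w \<in> \<int>" if "i \<in> I" "t i = 0" for i w by (rule int'[OF that])
    show "\<exists>k l \<omega>. \<forall>i\<in>I. (1 \<le> t i \<longrightarrow> \<omega> = 0) \<and> (2 \<le> t i \<longrightarrow> l = 0) \<and>
          (\<forall>w\<in>V i. moves p u (A i) (B i) (s i) k l \<omega> w)" if "u \<in> motions p ?F" for u by (rule mot[OF that])
  next
    fix A' B' s'
    assume P: "\<And>i w. i \<in> I \<Longrightarrow> w \<in> V i \<Longrightarrow> A' w = A i w \<and> B' w = B i w \<and> s' w = s i w"
      and P0: "\<And>w. w \<notin> ?V \<Longrightarrow> B' w = 0 \<and> A' w = 0 \<and> s' w = False"
      and t: "\<And>i. i \<in> I \<Longrightarrow> t i = 0" and count: "2 * card ?V \<le> card ?F + 3"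
    have lk': "(\<forall>w. B i w \<in> \<int>) \<and> (\<forall>e\<in>F i. fits (A i) (B i) (s i) e) \<and>
        A i (tgt (fa i)) = shx (fa i) \<and> B i (tgt (fa i)) = shy (fa i) \<and>
        A i (tgt (fb i)) = shx (fb i) \<and> B i (tgt (fb i)) = shy (fb i) \<and>
        s i (tgt (fa i)) = flp (fa i) \<and> s i (tgt (fb i)) = flp (fb i)"
      if "i \<in> I" for i using lk[OF that] t[OF that] unfolding locked_def by simp
    have "fits A' B' s' e" if "e \<in> F i" "i \<in> I" for e i
      using lk'[OF that(2)] that P[OF that(2)] Vi[OF that(1)] fits_cong[of A' e "A i" B' "B i" s' "s i"] by simp
    moreover have "fits A' B' s' e" if "e \<in> {e1, e2, e3}" for e
    proof -
      let ?f = "orient v e"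
      from tgtV[OF that] obtain i where i: "i \<in> I" "?f = fa i \<or> ?f = fb i" by blast
      then have "tgt ?f \<in> V i" by (auto simp: V_def)
      from P[OF i(1) this] lk'[OF i(1)] i(2)
      have "A' (tgt ?f) = shx ?f" "B' (tgt ?f) = shy ?f" "s' (tgt ?f) = flp ?f" by metis+
      \<comment> \<open>\<open>v\<close> carries the identity and each neighbour the gain of its
        edge, which is what the normalization in \<open>locked\<close> is for.\<close>
      then have "fits A' B' s' ?f" using P0[OF vV] star[OF that] by (simp add: fits_def)
      then show ?thesis by (simp only: fits_orient)
    qed
    moreover have "B' w \<in> \<int>" for w
    proof (cases "w \<in> ?V")
      case True
      then obtain i where "i \<in> I" "w \<in> V i" by blast
      then show ?thesis using P lk' by metis
    qed (use P0 in simp)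
    ultimately have "balanced_set ?E" by (intro balanced_setI[of _ A' B' s']) blast+
    from sparseD(3)[OF sp EE this] show False using cE cV count by linarith
  next
    fix s'
    assume P: "\<And>i w. i \<in> I \<Longrightarrow> w \<in> V i \<Longrightarrow> s' w = s i w"
      and P0: "\<And>w. w \<notin> ?V \<Longrightarrow> s' w = False"
      and t: "\<And>i. i \<in> I \<Longrightarrow> t i \<le> 1" and count: "2 * card ?V \<le> card ?F + 2"
    have lk': "(\<forall>e\<in>F i. flp e = (s i (src e) \<noteq> s i (tgt e))) \<and>
        s i (tgt (fa i)) = flp (fa i) \<and> s i (tgt (fb i)) = flp (fb i)"
      if "i \<in> I" for i using lk[OF that] t[OF that] unfolding locked_def by simp
    have "flp e = (s' (src e) \<noteq> s' (tgt e))" if "e \<in> F i" "i \<in> I" for e i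
      using lk'[OF that(2)] that P[OF that(2)] Vi[OF that(1)] by simp
    moreover have "flp e = (s' (src e) \<noteq> s' (tgt e))" if "e \<in> {e1, e2, e3}" for e
    proof -
      let ?f = "orient v e"
      from tgtV[OF that] obtain i where i: "i \<in> I" "?f = fa i \<or> ?f = fb i" by blast
      then have "tgt ?f \<in> V i" by (auto simp: V_def)
      from P[OF i(1) this] lk'[OF i(1)] i(2)
      have "s' (tgt ?f) = flp ?f" by metis
      moreover have "{src e, tgt e} = {v, tgt ?f}" using orient_ends[of v e] star[OF that] by simp
      ultimately show ?thesis using P0[OF vV] by (auto simp: doubleton_eq_iff)
    qed
    ultimately have "periodic_set ?E" by (intro periodic_setI[of _ s']) blast
    from sparseD(2)[OF sp EE this] show False using cE cV count by linarith
  next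
    assume "2 * card ?V \<le> card ?F + 1"
    with sparseD(1)[OF sp EE] show False using cE cV by linarith
  qed
qed

lemma extend_chord:
  assumes "gain_sparse (insert (chord f1 f2 l) H)" "\<forall>e\<in>H. lbl e \<noteq> l" "collinearity q f1 f2 f3 \<noteq> 0"
  shows "\<exists>r. indep UNIV r (H \<union> {e1, e2, e3})"
proof -
  let ?L = "chord f1 f2 l"
  have L: "?L \<notin> H" using assms(2) by auto
  have finL: "finite (insert ?L H)" using fin by simp
  have "shy ?L \<in> \<int>" using int_f by simp
  then obtain p where p: "indep UNIV p (insert ?L H)"
    using IH[OF finL _ _ assms(1)] int fin L by auto
  obtain r where r: "indep UNIV r (insert ?L H)" "collinearity r f1 f2 f3 \<noteq> 0"
    by (rule generic_condition_meet[OF generic_condition_indep[OF finL] p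
        generic_condition_nonzero[OF polynomial_on_lines_collinearity] assms(3)])
  show ?thesis
    by (rule one_extension[OF fin v dist refl refl refl star_simps L r])
qed

lemma gain_distinct:
  assumes "e \<in> {e1, e2, e3}" "e' \<in> {e1, e2, e3}" "e \<noteq> e'"
  shows "tgt (orient v e) \<noteq> tgt (orient v e') \<or> shx (orient v e) \<noteq> shx (orient v e') \<or>
    shy (orient v e) \<noteq> shy (orient v e') \<or> flp (orient v e) \<noteq> flp (orient v e')"
  using assms star int by (intro sparse_gain_distinct[OF sp]) auto

text \<open>A neighbour distinct from the other two can be moved freely, so a nondegenerate triangle
  of images exists. The sparse chord may be any of the three; permuting the edges brings it into
  first position.\<close>

lemma extend_distinct:
  assumes "tgt f3 \<noteq> tgt f1" "tgt f3 \<noteq> tgt f2"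
  shows "\<exists>r. indep UNIV r (H \<union> {e1, e2, e3})"
proof -
  obtain q where q: "collinearity q f1 f2 f3 \<noteq> 0"
    using exists_config_noncollinear[OF assms] gain_distinct[of e1 e2] dist by auto
  obtain p0 where p0: "indep UNIV p0 H" using indep_H by blast
  obtain p1 :: "'v \<Rightarrow> real^2" where p1: "off_axes p1" using off_axes_exists by blast
  note gH = generic_condition_indep[OF fin]
    and gc = generic_condition_nonzero[OF polynomial_on_lines_collinearity]
  obtain p2 where p2: "indep UNIV p2 H" "collinearity p2 f1 f2 f3 \<noteq> 0"
    by (rule generic_condition_meet[OF gH p0 gc q])
  obtain p where p: "indep UNIV p H \<and> collinearity p f1 f2 f3 \<noteq> 0" "off_axes p"
    by (rule generic_condition_meet[OF generic_condition_conj[OF gH gc] conjI[OF p2]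
        generic_condition_off_axes p1])
  obtain l where l: "\<forall>e\<in>H. lbl e \<noteq> l" using fresh by blast
  interpret r: cubic_vertex H v e2 e3 e1 by (rule rotate)
  interpret s: cubic_vertex H v e1 e3 e2 by (rule swap)
  have "gain_sparse (insert (chord f1 f2 l) H) \<or> gain_sparse (insert (chord f2 f3 l) H) \<or> gain_sparse (insert (chord f1 f3 l) H)"
    using some_chord_sparse[of p l] p l unfolding off_axes_def by blast
  moreover have "{e2, e3, e1} = {e1, e2, e3}" "{e1, e3, e2} = {e1, e2, e3}" by blast+
  moreover have "collinearity q f2 f3 f1 \<noteq> 0" "collinearity q f1 f3 f2 \<noteq> 0"
    using q by (auto simp: collinearity_def algebra_simps)
  ultimately show ?thesis using extend_chord r.extend_chord s.extend_chord l q by metis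
qed

text \<open>All three images hang on the single vertex \<open>n\<close>, so a reflection loop at
  \<open>n\<close> replaces the chord. No set containing that loop is purely periodic, which leaves
  only the bound 2|V| - 1 to check.\<close>

lemma extend_parallel:
  assumes n: "tgt f1 = n" "tgt f2 = n" "tgt f3 = n" and s: "flp f1 = flp f2" "flp f3 \<noteq> flp f1"
  shows "\<exists>r. indep UNIV r (H \<union> {e1, e2, e3})"
proof -
  obtain l where l: "\<forall>e\<in>H. lbl e \<noteq> l" using fresh by blast
  let ?L = "GEdge n n True 0 0 l"
  have L: "?L \<notin> H" using l by auto
  have finL: "finite (insert ?L H)" using fin by simp
  have "gain_sparse (insert ?L H)"
    unfolding gain_sparse_def
  proof (intro allI impI)
    fix F assume F: "F \<subseteq> insert ?L H" "F \<noteq> {}"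
    show "card F + 1 \<le> 2 * card (ends F) \<and> (periodic_set F \<longrightarrow> card F + 2 \<le> 2 * card (ends F)) \<and>
      (balanced_set F \<longrightarrow> card F + 3 \<le> 2 * card (ends F))"
    proof (cases "?L \<in> F")
      case False
      then have "F \<subseteq> H" using F by blast
      from sparseD[OF sparse_H this F(2)] show ?thesis by blast
    next
      case True
      have "\<not> periodic_set F"
        using True unfolding periodic_set_def by force
      then have "\<not> balanced_set F" using balanced_set_periodic_set by blast
      moreover have "card F + 1 \<le> 2 * card (ends F)"
      proof -
        \<comment> \<open>Trading the loop for \<open>v\<close> and its three edges adds at most one
          vertex and a net two edges, so the bound for the enlarged set gives back the bound for
          \<open>F\<close>.\<close>
        define F0 where "F0 = F - {?L}"
        have F0: "F0 \<subseteq> H" "finite F0" "card F = card F0 + 1"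
          using F True finL finite_subset[of F] by (auto simp: F0_def card_Diff_singleton Suc_leI card_gt_0_iff)
        have card3: "card {e1, e2, e3} = 3" using dist by auto
        have "F0 \<inter> {e1, e2, e3} = {}" using F0 disj by blast
        then have "card (F0 \<union> {e1, e2, e3}) = card F0 + 3"
          using card_Un_disjoint[of F0 "{e1, e2, e3}"] F0 card3 by simp
        moreover have "card (F0 \<union> {e1, e2, e3}) + 1 \<le> 2 * card (ends (F0 \<union> {e1, e2, e3}))"
          using F0 by (intro sparseD(1)[OF sp]) auto
        moreover have "ends (F0 \<union> {e1, e2, e3}) \<subseteq> insert v (ends F)"
        proof -
          have "ends (F0 \<union> {e1, e2, e3}) = ends F0 \<union> ends {e1} \<union> ends {e2} \<union> ends {e3}"
            by (auto simp: ends_def)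
          moreover have "n \<in> ends F" using True by (force simp: ends_def)
          moreover have "ends F0 \<subseteq> ends F" by (auto simp: ends_def F0_def)
          ultimately show ?thesis using ends_star n by auto
        qed
        then have "card (ends (F0 \<union> {e1, e2, e3})) \<le> card (insert v (ends F))"
          by (intro card_mono) simp_all
        moreover have "card (insert v (ends F)) \<le> card (ends F) + 1" by (simp add: card_insert_if)
        ultimately show ?thesis using F0(3) by linarith
      qed
      ultimately show ?thesis using \<open>\<not> periodic_set F\<close> by blast
    qed
  qed
  then obtain p where p: "indep UNIV p (insert ?L H)"
    using IH[OF finL] int fin L by auto
  have g: "shx f1 \<noteq> shx f2 \<or> shy f1 \<noteq> shy f2"
    using gain_distinct[of e1 e2] dist n s by auto
  have "n \<noteq> v" using star_simps n by blast
  show ?thesis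
    by (rule triple_edge_extension[OF fin v dist refl refl refl star_simps(1-3) n \<open>n \<noteq> v\<close> s g L p])
qed

lemma extend: "\<exists>r. indep UNIV r (H \<union> {e1, e2, e3})"
proof -
  interpret r: cubic_vertex H v e2 e3 e1 by (rule rotate)
  interpret s: cubic_vertex H v e1 e3 e2 by (rule swap)
  have eq: "{e2, e3, e1} = {e1, e2, e3}" "{e1, e3, e2} = {e1, e2, e3}" by blast+
  consider "tgt f3 \<noteq> tgt f1 \<and> tgt f3 \<noteq> tgt f2" | "tgt f1 \<noteq> tgt f2 \<and> tgt f1 \<noteq> tgt f3"
    | "tgt f2 \<noteq> tgt f1 \<and> tgt f2 \<noteq> tgt f3" | (same) "tgt f1 = tgt f3" "tgt f2 = tgt f3" by metis
  then show ?thesis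
  proof cases
    case 1 then show ?thesis using extend_distinct by blast
  next
    case 2 then show ?thesis using r.extend_distinct unfolding eq by blast
  next
    case 3 then show ?thesis using s.extend_distinct unfolding eq by blast
  next
    case same
    \<comment> \<open>Two of three signs always agree; if all do, the star is purely periodic on two
      vertices, and 3 + 2 exceeds 4.\<close>
    consider "flp f1 = flp f2 \<and> flp f3 \<noteq> flp f1" | "flp f2 = flp f3 \<and> flp f1 \<noteq> flp f2"
      | "flp f1 = flp f3 \<and> flp f2 \<noteq> flp f1" | (eq) "flp f1 = flp f3" "flp f2 = flp f3" by metis
    then show ?thesis
    proof cases
      case 1 then show ?thesis using extend_parallel[of "tgt f3"] same by blast
    next
      case 2 then show ?thesis using r.extend_parallel[of "tgt f3"] same unfolding eq by blast
    next
      case 3 then show ?thesis using s.extend_parallel[of "tgt f3"] same unfolding eq by blast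
    next
      case flips: eq
      let ?s = "\<lambda>w. w = tgt f3 \<and> flp f3"
      have "flp e = (?s (src e) \<noteq> ?s (tgt e))" if e: "e \<in> {e1, e2, e3}" for e
      proof -
        have "tgt (orient v e) = tgt f3" "flp (orient v e) = flp f3" using e same flips by auto
        then have "{src e, tgt e} = {v, tgt f3}" "flp e = flp f3" using orient_ends[of v e] star[OF e] by auto
        then show ?thesis using star_simps by (auto simp: doubleton_eq_iff)
      qed
      then have "periodic_set {e1, e2, e3}" by (intro periodic_setI[of _ ?s]) blast
      then have "card {e1, e2, e3} + 2 \<le> 2 * card (ends {e1, e2, e3})"
        using sparseD(2)[OF sp, of "{e1, e2, e3}"] by blast
      moreover have "ends {e1, e2, e3} = ends {e1} \<union> ends {e2} \<union> ends {e3}" by (auto simp: ends_def)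
      then have "ends {e1, e2, e3} = {v, tgt f3}" using ends_star same by auto
      moreover have "card {v, tgt f3} \<le> 2" by (simp add: card_insert_if)
      ultimately show ?thesis using dist by simp
    qed
  qed
qed

end

section \<open>The induction on the number of edges\<close>

lemma exists_low_degree:
  fixes E :: "'v gedge set"
  assumes "finite E" "card E + 1 \<le> 2 * card (ends E)"
  shows "\<exists>v\<in>ends E. card {e \<in> E. src e = v} + card {e \<in> E. tgt e = v} \<le> 3"
proof (rule ccontr)
  assume contra: "\<not> ?thesis"
  have fin: "finite (ends E)" using assms by (simp add: ends_def)
  have sum: "(\<Sum>v\<in>ends E. card {e \<in> E. g e = v}) = card E" if "g ` E \<subseteq> ends E" for g :: "'v gedge \<Rightarrow> 'v"
    using sum.group[OF assms(1) fin that, of "\<lambda>_. 1 :: nat"] by simp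
  \<comment> \<open>Degrees count loops twice and so add up to 2|E|, which is less than
    4|V|.\<close>
  have "(\<Sum>v\<in>ends E. 4) \<le> (\<Sum>v\<in>ends E. card {e \<in> E. src e = v} + card {e \<in> E. tgt e = v})"
    using contra by (intro sum_mono) force
  also have "\<dots> = 2 * card E"
    unfolding sum.distrib by (subst (1 2) sum) (auto simp: ends_def)
  finally show False using assms by simp
qed

lemma indep_pair_at:
  assumes "e1 \<noteq> e2" "src (orient v e1) = v" "src (orient v e2) = v" "tgt (orient v e1) \<noteq> v" "tgt (orient v e2) \<noteq> v"
    and "spread q (orient v e1) (orient v e2) \<noteq> 0"
  shows "indep ({v} \<times> UNIV) q {e1, e2}"
proof (rule indepI)
  fix c e assume c: "\<And>i. i \<in> {v} \<times> UNIV \<Longrightarrow> (\<Sum>e\<in>{e1, e2}. c e * orow q e i) = 0" and e: "e \<in> {e1, e2}"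
  let ?f = "orient v e1" and ?g = "orient v e2"
  have c': "c e1 * orow q ?f (v, k) + c e2 * orow q ?g (v, k) = 0" for k
    using c[of "(v, k)"] assms(1) by (simp add: orow_orient)
  have "c e1 * dX q ?f + c e2 * dX q ?g = 0" "c e1 * dY q ?f + c e2 * dY q ?g = 0"
    using c'[of 1] c'[of 2] orow_at_src[of ?f q] orow_at_src[of ?g q] assms by auto
  then have "c e1 * spread q ?f ?g = 0" "c e2 * spread q ?f ?g = 0"
    unfolding spread_def by algebra+
  then show "c e = 0" using e assms by auto
qed

theorem sparse_imp_indep:
  fixes E :: "'v::finite gedge set"
  assumes "finite E" "\<forall>e\<in>E. shy e \<in> \<int>" "gain_sparse E"
  shows "\<exists>p. indep UNIV p E"
  using assms
proof (induction "card E" arbitrary: E rule: less_induct)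
  case less
  show ?case
  proof (cases "E = {}")
    case True
    then show ?thesis by (simp add: indep_def)
  next
    case ne: False
    obtain v where v: "v \<in> ends E" and deg: "card {e \<in> E. src e = v} + card {e \<in> E. tgt e = v} \<le> 3"
      using exists_low_degree[OF less.prems(1) sparseD(1)[OF less.prems(3) order_refl ne]] by blast
    define S where "S = {e \<in> E. src e = v \<or> tgt e = v}"
    define P where "P = {e \<in> E. src e = v \<and> tgt e = v}"
    define H where "H = E - S"
    have finS: "finite S" "finite P" "finite H" using less.prems by (auto simp: S_def P_def H_def)
    have E: "E = H \<union> S" "H \<inter> S = {}" by (auto simp: H_def S_def)
    have vH: "v \<notin> ends H" by (auto simp: H_def S_def ends_def)
    have Sv: "\<forall>e\<in>S. src e = v \<or> tgt e = v" by (auto simp: S_def)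
    have "S \<noteq> {}" using v by (auto simp: ends_def S_def)
    then have S0: "card S \<ge> 1" using finS by (simp add: Suc_leI card_gt_0_iff)
    have "{e \<in> E. src e = v} \<union> {e \<in> E. tgt e = v} = S" "{e \<in> E. src e = v} \<inter> {e \<in> E. tgt e = v} = P"
      by (auto simp: S_def P_def)
    \<comment> \<open>\<open>P\<close> collects the loops at \<open>v\<close>, each of which counts
      twice in the degree.\<close>
    then have SP: "card S + card P \<le> 3"
      using card_Un_Int[of "{e \<in> E. src e = v}" "{e \<in> E. tgt e = v}"] less.prems(1) deg by simp
    have cE: "card E = card H + card S" using card_Un_disjoint[OF finS(3) finS(1) E(2)] E(1) by simp
    have spH: "gain_sparse H" using less.prems(3) by (rule sparse_mono) (simp add: H_def)
    obtain p where p: "indep UNIV p H"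
      using less.hyps[OF _ finS(3) _ spH] cE S0 less.prems(2) by (auto simp: H_def)
    have ext: "\<exists>r. indep UNIV r E" if "indep ({v} \<times> UNIV) q S" for q
      using zero_extension[OF finS(3) p vH finS(1) Sv that] E(1) by simp
    show ?thesis
    proof (cases "P = {}")
      case False
      then obtain L where L: "L \<in> E" "src L = v" "tgt L = v" by (auto simp: P_def)
      then have LS: "L \<in> S" "L \<in> P" by (auto simp: S_def P_def)
      \<comment> \<open>A translation loop is purely periodic on one vertex, and 1 + 2 exceeds
        2.\<close>
      have "flp L"
      proof (rule ccontr)
        assume "\<not> flp L"
        then have "periodic_set {L}" unfolding periodic_set_def using L by auto
        then have "card {L} + 2 \<le> 2 * card (ends {L})" using sparseD(2)[OF less.prems(3), of "{L}"] L by blast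
        then show False using L by (simp add: ends_def)
      qed
      then have L1: "orow q L (v, 1) = 0" "orow q L (v, 2) = 2 * dY q L" "dY q L = 2 * q v $ 2 - shy L" for q
        using orow_loop[OF L(2,3), of q] L by (simp_all add: dY_def)
      have "card P \<ge> 1" using LS finS by (metis Suc_leI card_gt_0_iff empty_iff One_nat_def)
      then have "card S \<le> 2" using SP by linarith
      show ?thesis
      proof (cases "S = {L}")
        case True
        \<comment> \<open>At this height \<open>dY\<close> of the loop is 1.\<close>
        have "indep ({v} \<times> UNIV) (\<lambda>_. vector [0, (shy L + 1) / 2]) S"
        proof (rule indepI)
          fix c e assume c: "\<And>i. i \<in> {v} \<times> UNIV \<Longrightarrow> (\<Sum>e\<in>S. c e * orow (\<lambda>_. vector [0, (shy L + 1) / 2]) e i) = 0"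
            and e: "e \<in> S"
          show "c e = 0" using c[of "(v, 2)"] e True L1 by (simp add: field_simps)
        qed
        then show ?thesis by (rule ext)
      next
        case False
        then have "S - {L} \<noteq> {}" using LS by blast
        then have "card (S - {L}) \<ge> 1" using finS by (simp add: Suc_leI card_gt_0_iff)
        moreover have "card (S - {L}) = card S - 1" using LS by simp
        ultimately have "card (S - {L}) = 1" "card S = 2" using \<open>card S \<le> 2\<close> by linarith+
        then obtain e where "S - {L} = {e}" by (auto simp: card_1_singleton_iff)
        then have e: "S = {L, e}" "L \<noteq> e" using LS by auto
        have "card P = 1" using \<open>card P \<ge> 1\<close> \<open>card S = 2\<close> SP by linarith
        then have "P = {L}" using LS by (auto simp: card_1_singleton_iff)
        have "e \<in> S" using e(1) by simp
        then have eE: "e \<in> E" "src e = v \<or> tgt e = v" unfolding S_def by blast+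
        have "e \<notin> P" using \<open>P = {L}\<close> e(2) by simp
        then have "\<not> (src e = v \<and> tgt e = v)" using eE(1) by (simp add: P_def)
        let ?f = "orient v e"
        have f: "src ?f = v" "tgt ?f \<noteq> v"
          using \<open>\<not> (src e = v \<and> tgt e = v)\<close> eE(2) by (auto simp: orient_def)
        \<comment> \<open>The loop has entry 0 in the first column of \<open>v\<close>, so the block
          is triangular; the two coordinates of \<open>v\<close> make both diagonal entries
          nonzero.\<close>
        define q where "q = (\<lambda>_. 0)(v := vector [shx ?f + 1, (shy L + 1) / 2] :: real^2)"
        have dXf: "dX q ?f = 1" using f by (simp add: dX_def q_def)
        have dYL: "dY q L = 1" using L1(3)[of q] by (simp add: q_def field_simps)
        have "indep ({v} \<times> UNIV) q S"
        proof (rule indepI)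
          fix c e' assume c: "\<And>i. i \<in> {v} \<times> UNIV \<Longrightarrow> (\<Sum>e\<in>S. c e * orow q e i) = 0" and e': "e' \<in> S"
          have c': "c L * orow q L (v, k) + c e * orow q ?f (v, k) = 0" for k
            using c[of "(v, k)"] e by (simp add: orow_orient)
          have "orow q ?f (v, 1) = 1" using orow_at_src(1)[of ?f q] f dXf by simp
          then have "c e = 0" using c'[of 1] L1(1) by simp
          moreover from this have "c L = 0" using c'[of 2] L1(2)[of q] dYL by simp
          ultimately show "c e' = 0" using e' e by auto
        qed
        then show ?thesis by (rule ext)
      qed
    next
      case noloop: True
      have star: "src (orient v e) = v \<and> tgt (orient v e) \<noteq> v" if "e \<in> S" for e
        using that noloop by (auto simp: orient_def S_def P_def)
      have "card S = 1 \<or> card S = 2 \<or> card S = 3" using S0 SP by linarith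
      then show ?thesis
      proof (elim disjE)
        assume "card S = 1"
        then obtain e where S: "S = {e}" by (auto simp: card_1_singleton_iff)
        let ?f = "orient v e"
        define q where "q = (\<lambda>_. 0)(v := vector [shx ?f + 1, 0] :: real^2)"
        have f: "src ?f = v" "tgt ?f \<noteq> v" using star S by auto
        have dXf: "dX q ?f = 1" using f by (simp add: dX_def q_def)
        have "indep ({v} \<times> UNIV) q S"
        proof (rule indepI)
          fix c e' assume c: "\<And>i. i \<in> {v} \<times> UNIV \<Longrightarrow> (\<Sum>e\<in>S. c e * orow q e i) = 0" and e': "e' \<in> S"
          have "orow q e (v, 1) = 1" using orow_at_src(1)[of ?f q] f dXf by (simp add: orow_orient)
          then show "c e' = 0" using c[of "(v, 1)"] S e' by simp
        qed
        then show ?thesis by (rule ext)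
      next
        assume "card S = 2"
        then obtain e1 e2 where S: "S = {e1, e2}" "e1 \<noteq> e2" by (auto simp: card_2_iff)
        let ?f = "orient v e1" and ?g = "orient v e2"
        have f: "src ?f = v" "tgt ?f \<noteq> v" "src ?g = v" "tgt ?g \<noteq> v" using star S by auto
        have "tgt ?f \<noteq> tgt ?g \<or> shx ?f \<noteq> shx ?g \<or> shy ?f \<noteq> shy ?g \<or> flp ?f \<noteq> flp ?g"
          using S E(1) f less.prems(2) by (intro sparse_gain_distinct[OF less.prems(3)]) auto
        from exists_config_spread[OF f(1,3,2,4) this] obtain q where q: "spread q ?f ?g \<noteq> 0" by blast
        have "indep ({v} \<times> UNIV) q S" using indep_pair_at[OF S(2) f(1,3,2,4) q] S(1) by simp
        then show ?thesis by (rule ext)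
      next
        assume "card S = 3"
        then obtain e1 e2 e3 where S: "S = {e1, e2, e3}" "e1 \<noteq> e2" "e2 \<noteq> e3" "e1 \<noteq> e3"
          by (auto simp: card_3_iff)
        interpret cubic_vertex H v e1 e2 e3
        proof
          show "src (orient v e) = v \<and> tgt (orient v e) \<noteq> v" if "e \<in> {e1, e2, e3}" for e
            using star that S by blast
          show "shy e \<in> \<int>" if "e \<in> H \<union> {e1, e2, e3}" for e
            using less.prems(2) that E(1) S(1) by blast
          show "gain_sparse (H \<union> {e1, e2, e3})" using less.prems(3) E(1) S(1) by simp
          show "\<exists>p. indep UNIV p E'" if "finite E'" "card E' \<le> card H + 1" "\<forall>e\<in>E'. shy e \<in> \<int>" "gain_sparse E'" for E' :: "'v gedge set"
            using less.hyps[of E'] that cE \<open>card S = 3\<close> by simp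
        qed (use finS vH S in auto)
        show ?thesis using extend E(1) S(1) by simp
      qed
    qed
  qed
qed


section \<open>Gain groups and potentials\<close>

text \<open>Pure reflections count as glides.\<close>

definition glide :: "plane_map \<Rightarrow> bool" where
  "glide \<gamma> \<longleftrightarrow> linear_part \<gamma> \<noteq> id"

lemma reflection_neq_id: "reflection \<noteq> id"
proof
  assume "reflection = id"
  then have "reflection (vector [0, 1]) $ 2 = (vector [0, 1] :: real^2) $ 2" by simp
  then show False by (simp add: reflection_def)
qed

lemma glide_isom: "\<sigma> \<in> {id, reflection} \<Longrightarrow> glide (isom a b \<sigma>) \<longleftrightarrow> \<sigma> = reflection"
  using reflection_neq_id by (auto simp: glide_def linear_part_isom)

lemma pm_cases:
  assumes "\<gamma> \<in> carrier pm"
  obtains a b \<sigma> where "\<gamma> = isom a b \<sigma>" "\<sigma> \<in> {id, reflection}"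
  using assms by (auto simp: pm_def)

lemma pm_apply:
  assumes "\<gamma> \<in> carrier pm"
  shows "\<gamma> x $ 1 = x $ 1 + \<gamma> 0 $ 1" "\<gamma> x $ 2 = sn (glide \<gamma>) * x $ 2 + \<gamma> 0 $ 2"
    "\<gamma> 0 $ 1 \<in> \<int>" "\<gamma> 0 $ 2 \<in> \<int>"
    "linear_part \<gamma> x $ 1 = x $ 1" "linear_part \<gamma> x $ 2 = sn (glide \<gamma>) * x $ 2"
proof -
  obtain a b \<sigma> where g: "\<gamma> = isom a b \<sigma>" "\<sigma> \<in> {id, reflection}" using pm_cases[OF assms] .
  have lp: "linear_part \<gamma> = \<sigma>" using linear_part_isom[OF g(2)] g(1) by simp
  have \<sigma>: "\<sigma> y $ 1 = y $ 1" "\<sigma> y $ 2 = sn (glide \<gamma>) * y $ 2" for y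
    using g(2) glide_isom[OF g(2), of a b] reflection_neq_id by (auto simp: g(1) reflection_def)
  have \<gamma>: "\<gamma> y $ 1 = y $ 1 + of_int a" "\<gamma> y $ 2 = sn (glide \<gamma>) * y $ 2 + of_int b" for y
    using \<sigma>[of y] by (simp_all add: g(1) isom_def)
  show "\<gamma> x $ 1 = x $ 1 + \<gamma> 0 $ 1" "\<gamma> x $ 2 = sn (glide \<gamma>) * x $ 2 + \<gamma> 0 $ 2"
    "\<gamma> 0 $ 1 \<in> \<int>" "\<gamma> 0 $ 2 \<in> \<int>"
    "linear_part \<gamma> x $ 1 = x $ 1" "linear_part \<gamma> x $ 2 = sn (glide \<gamma>) * x $ 2"
    unfolding lp using \<sigma> \<gamma>[of x] \<gamma>[of 0] by simp_all
qed

lemma pm_eqI: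
  assumes "\<gamma> \<in> carrier pm" "\<delta> \<in> carrier pm" "glide \<gamma> = glide \<delta>" "\<gamma> 0 $ 1 = \<delta> 0 $ 1" "\<gamma> 0 $ 2 = \<delta> 0 $ 2"
  shows "\<gamma> = \<delta>"
proof
  show "\<gamma> x = \<delta> x" for x
    using pm_apply(1,2)[OF assms(1), of x] pm_apply(1,2)[OF assms(2), of x] assms(3-5)
    by (simp add: vec_eq_iff forall_2)
qed

lemma glide_comp:
  assumes "\<gamma> \<in> carrier pm" "\<delta> \<in> carrier pm" "\<gamma> \<circ> \<delta> \<in> carrier pm"
  shows "glide (\<gamma> \<circ> \<delta>) \<longleftrightarrow> glide \<gamma> \<noteq> glide \<delta>"
proof -
  \<comment> \<open>A test vector: the second coordinate of the difference from the value at 0 is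
    the sign of the linear part.\<close>
  let ?y = "vector [0, 1] :: real^2"
  have "sn (glide (\<gamma> \<circ> \<delta>)) = (\<gamma> \<circ> \<delta>) ?y $ 2 - (\<gamma> \<circ> \<delta>) 0 $ 2"
    using pm_apply(2)[OF assms(3), of ?y] by simp
  also have "\<dots> = sn (glide \<gamma>) * sn (glide \<delta>)"
    using pm_apply(2)[OF assms(1), of "\<delta> ?y"] pm_apply(2)[OF assms(1), of "\<delta> 0"]
      pm_apply(2)[OF assms(2), of ?y] by (simp add: algebra_simps)
  finally have "sn (glide (\<gamma> \<circ> \<delta>)) = sn (glide \<gamma> \<noteq> glide \<delta>)" by (simp only: sn_neq)
  then show ?thesis by (simp only: sn_eq_iff)
qed

lemma glide_id: "\<not> glide id" "\<not> glide (\<lambda>x. x)"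
  by (auto simp: glide_def linear_part_def fun_eq_iff)

lemma translation_maps_glide: "\<gamma> \<in> translation_maps \<longleftrightarrow> \<not> glide \<gamma>"
  by (simp add: translation_maps_def glide_def)

text \<open>What the three groups share. The translation rules out rotations among the symmetric
  trivial motions, the reflecting element rules out vertical translations.\<close>

locale gain_group = group \<Gamma> for \<Gamma> :: "plane_map monoid" +
  assumes mult_comp: "mult \<Gamma> = (\<circ>)"
    and one_id: "one \<Gamma> = id"
    and carrier_pm: "carrier \<Gamma> \<subseteq> carrier pm"
    and translation: "\<exists>\<tau>\<in>carrier \<Gamma>. \<not> glide \<tau> \<and> \<tau> 0 \<noteq> 0"
    and glide_reflection: "\<exists>\<rho>\<in>carrier \<Gamma>. glide \<rho>"

lemma gain_group_pm: "gain_group pm"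
proof -
  interpret group pm by (rule group_pm)
  show ?thesis
  proof
    have "isom 0 1 id \<in> carrier pm" by (auto simp: pm_def)
    moreover have "isom 0 1 id 0 $ 2 \<noteq> (0 :: real^2) $ 2" by (simp add: isom_def)
    moreover have "\<not> glide (isom 0 1 id)" using glide_isom[of id] reflection_neq_id by auto
    ultimately show "\<exists>\<tau>\<in>carrier pm. \<not> glide \<tau> \<and> \<tau> 0 \<noteq> 0" by metis
    have "isom 0 0 reflection \<in> carrier pm" by (auto simp: pm_def)
    moreover have "glide (isom 0 0 reflection)" using glide_isom[of reflection] by auto
    ultimately show "\<exists>\<rho>\<in>carrier pm. glide \<rho>" by blast
  qed (auto simp: pm_def)
qed

lemma gain_group_subgroup_generated:
  assumes "S \<subseteq> carrier pm" "\<exists>\<tau>\<in>S. \<not> glide \<tau> \<and> \<tau> 0 \<noteq> 0" "\<exists>\<rho>\<in>S. glide \<rho>"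
  shows "gain_group (subgroup_generated pm S)"
proof -
  interpret pm: group pm by (rule group_pm)
  interpret group "subgroup_generated pm S" by (rule pm.group_subgroup_generated)
  have "S \<subseteq> carrier (subgroup_generated pm S)"
    using assms(1) by (auto simp: carrier_subgroup_generated intro: generate.incl)
  with assms show ?thesis
    using pm.carrier_subgroup_generated_subset[of S]
    by unfold_locales (auto simp: pm_def)
qed

lemma gain_group_cases:
  assumes "\<Gamma> \<in> {pm, cm, pg}"
  shows "gain_group \<Gamma>"
proof -
  have id: "\<not> glide (isom a b id)" for a b using glide_isom[of id] reflection_neq_id by auto
  have re: "glide (isom a b reflection)" for a b using glide_isom[of reflection] by auto
  have ne: "isom a 1 id 0 \<noteq> 0" for a
  proof
    assume "isom a 1 id 0 = 0"
    then have "isom a 1 id 0 $ 2 = 0" by simp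
    then show False by (simp add: isom_def)
  qed
  have "gain_group cm"
    unfolding cm_def by (rule gain_group_subgroup_generated) (use id re ne in \<open>auto simp: pm_def\<close>)
  moreover have "gain_group pg"
    unfolding pg_def by (rule gain_group_subgroup_generated) (use id re ne in \<open>auto simp: pm_def\<close>)
  ultimately show ?thesis using assms gain_group_pm by blast
qed

text \<open>The label encodes the arc, so distinct arcs give distinct edges and cardinalities carry
  over.\<close>

definition gedge_of :: "('v, 'e::finite) pre_digraph \<Rightarrow> ('e \<Rightarrow> plane_map) \<Rightarrow> 'e \<Rightarrow> 'v gedge" where
  "gedge_of G m e = GEdge (tail G e) (head G e) (glide (m e)) (m e 0 $ 1) (m e 0 $ 2) (to_nat e)"

lemma gedge_of_sel [simp]:
  "src (gedge_of G m e) = tail G e" "tgt (gedge_of G m e) = head G e" "flp (gedge_of G m e) = glide (m e)"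
  "shx (gedge_of G m e) = m e 0 $ 1" "shy (gedge_of G m e) = m e 0 $ 2"
  by (simp_all add: gedge_of_def)

lemma inj_gedge_of: "inj (gedge_of G m)"
  by (rule injI) (simp add: gedge_of_def)

lemma ends_gedge_of: "ends (gedge_of G m ` F) = tail G ` F \<union> head G ` F"
  by (simp add: ends_def image_image)

section \<open>Walks and potentials in a gain group\<close>

context gain_group
begin

lemma comp_closed: "\<gamma> \<in> carrier \<Gamma> \<Longrightarrow> \<delta> \<in> carrier \<Gamma> \<Longrightarrow> \<gamma> \<circ> \<delta> \<in> carrier \<Gamma>"
  using m_closed by (simp add: mult_comp)

lemma inv_of_comp:
  "\<gamma> \<in> carrier \<Gamma> \<Longrightarrow> \<delta> \<in> carrier \<Gamma> \<Longrightarrow> inv\<^bsub>\<Gamma>\<^esub> (\<gamma> \<circ> \<delta>) = inv\<^bsub>\<Gamma>\<^esub> \<delta> \<circ> inv\<^bsub>\<Gamma>\<^esub> \<gamma>"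
  using inv_mult_group by (simp add: mult_comp)

lemma in_pm: "\<gamma> \<in> carrier \<Gamma> \<Longrightarrow> \<gamma> \<in> carrier pm"
  using carrier_pm by blast

lemma inv_comp: "\<gamma> \<in> carrier \<Gamma> \<Longrightarrow> inv\<^bsub>\<Gamma>\<^esub> \<gamma> \<circ> \<gamma> = id" "\<gamma> \<in> carrier \<Gamma> \<Longrightarrow> \<gamma> \<circ> inv\<^bsub>\<Gamma>\<^esub> \<gamma> = id"
  using l_inv r_inv by (simp_all add: mult_comp one_id)

lemma id_closed: "id \<in> carrier \<Gamma>"
  using one_closed by (simp add: one_id)

lemma glide_mult:
  "\<gamma> \<in> carrier \<Gamma> \<Longrightarrow> \<delta> \<in> carrier \<Gamma> \<Longrightarrow> glide (\<gamma> \<circ> \<delta>) \<longleftrightarrow> glide \<gamma> \<noteq> glide \<delta>"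
  by (intro glide_comp in_pm comp_closed)

lemma glide_inv: "\<gamma> \<in> carrier \<Gamma> \<Longrightarrow> glide (inv\<^bsub>\<Gamma>\<^esub> \<gamma>) = glide \<gamma>"
  using glide_mult[of "inv\<^bsub>\<Gamma>\<^esub> \<gamma>" \<gamma>] inv_comp(1)[of \<gamma>] glide_id by auto

lemma inv_apply:
  assumes "\<gamma> \<in> carrier \<Gamma>"
  shows "(inv\<^bsub>\<Gamma>\<^esub> \<gamma>) x $ 1 = x $ 1 - \<gamma> 0 $ 1" "(inv\<^bsub>\<Gamma>\<^esub> \<gamma>) x $ 2 = sn (glide \<gamma>) * (x $ 2 - \<gamma> 0 $ 2)"
proof -
  have "\<gamma> ((inv\<^bsub>\<Gamma>\<^esub> \<gamma>) x) = x" using inv_comp(2)[OF assms] by (metis comp_apply id_apply)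
  then have "x $ 1 = (inv\<^bsub>\<Gamma>\<^esub> \<gamma>) x $ 1 + \<gamma> 0 $ 1"
    "x $ 2 = sn (glide \<gamma>) * (inv\<^bsub>\<Gamma>\<^esub> \<gamma>) x $ 2 + \<gamma> 0 $ 2"
    using pm_apply(1,2)[OF in_pm[OF assms], of "(inv\<^bsub>\<Gamma>\<^esub> \<gamma>) x"] by simp_all
  then show "(inv\<^bsub>\<Gamma>\<^esub> \<gamma>) x $ 1 = x $ 1 - \<gamma> 0 $ 1" "(inv\<^bsub>\<Gamma>\<^esub> \<gamma>) x $ 2 = sn (glide \<gamma>) * (x $ 2 - \<gamma> 0 $ 2)"
    by simp_all
qed

lemma orbit_entry_rowv:
  assumes "m e \<in> carrier \<Gamma>"
  shows "rowv p (gedge_of G m e) $ (w, k) = orbit_entry \<Gamma> G m p e w $ k"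
proof -
  note app = pm_apply(1,2)[OF in_pm[OF assms], of "p (head G e)"]
    pm_apply(1,2)[OF in_pm[OF assms], of "p (tail G e)"] inv_apply[OF assms]
  have "k = 1 \<or> k = 2" using exhaust_2 by blast
  then show ?thesis
    by (auto simp: rowv_def orow_def dX_def dY_def orbit_entry_def Let_def app sn_def algebra_simps)
qed

lemma row_orbit_matrix:
  assumes "m e \<in> carrier \<Gamma>" "e \<in> arcs G"
  shows "row e (orbit_matrix \<Gamma> G m p) = rowv p (gedge_of G m e)"
  using assms by (auto simp: row_def orbit_matrix_def vec_eq_iff orbit_entry_rowv)

lemma net_gain_comp:
  "net_gain \<Gamma> m [] = id"
  "net_gain \<Gamma> m ((e, True) # w) = m e \<circ> net_gain \<Gamma> m w"
  "net_gain \<Gamma> m ((e, False) # w) = inv\<^bsub>\<Gamma>\<^esub> (m e) \<circ> net_gain \<Gamma> m w"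
  by (simp_all only: net_gain.simps mult_comp one_id)

lemma walk_append:
  "gain_walk G u w x \<Longrightarrow> gain_walk G x w' v \<Longrightarrow> gain_walk G u (w @ w') v"
  by (induction G u w x rule: gain_walk.induct) auto

lemma walk_verts:
  "wf_digraph G \<Longrightarrow> gain_walk G u w v \<Longrightarrow> u \<in> verts G \<and> v \<in> verts G"
  by (induction G u w v rule: gain_walk.induct) (auto simp: wf_digraph_def)

lemma net_gain_closed:
  assumes "\<forall>e\<in>arcs G. m e \<in> carrier \<Gamma>" "gain_walk G u w v"
  shows "net_gain \<Gamma> m w \<in> carrier \<Gamma>"
  using assms(2) assms(1) by (induction G u w v rule: gain_walk.induct) auto

lemma net_gain_append:
  assumes "\<forall>e\<in>arcs G. m e \<in> carrier \<Gamma>" "gain_walk G u w x" "gain_walk G x w' v"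
  shows "net_gain \<Gamma> m (w @ w') = net_gain \<Gamma> m w \<circ> net_gain \<Gamma> m w'"
  using assms(2,1,3)
proof (induction G u w x rule: gain_walk.induct)
  case (1 G u v)
  then show ?case by (simp add: one_id)
qed (simp_all add: mult_comp comp_assoc)

lemma reverse_walk:
  assumes "wf_digraph G" "\<forall>e\<in>arcs G. m e \<in> carrier \<Gamma>" "gain_walk G u w v"
  shows "\<exists>w'. gain_walk G v w' u \<and> net_gain \<Gamma> m w' = inv\<^bsub>\<Gamma>\<^esub> net_gain \<Gamma> m w"
  using assms(3,1,2)
proof (induction G u w v rule: gain_walk.induct)
  case (1 G u v)
  then show ?case by (intro exI[of _ "[]"]) auto
next
  case (2 G u e w v)
  then obtain w' where w': "gain_walk G v w' (head G e)" "net_gain \<Gamma> m w' = inv\<^bsub>\<Gamma>\<^esub> net_gain \<Gamma> m w"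
    by auto
  have e: "gain_walk G (head G e) [(e, False)] u" "m e \<in> carrier \<Gamma>"
    using 2 by (auto simp: wf_digraph_def)
  have "net_gain \<Gamma> m w \<in> carrier \<Gamma>" using net_gain_closed 2 by auto
  then have "net_gain \<Gamma> m (w' @ [(e, False)]) = inv\<^bsub>\<Gamma>\<^esub> net_gain \<Gamma> m ((e, True) # w)"
    using net_gain_append[OF 2(4) w'(1) e(1)] e(2) w'(2) by (simp add: inv_of_comp mult_comp one_id)
  then show ?case using walk_append[OF w'(1) e(1)] by blast
next
  case (3 G u e w v)
  then obtain w' where w': "gain_walk G v w' (tail G e)" "net_gain \<Gamma> m w' = inv\<^bsub>\<Gamma>\<^esub> net_gain \<Gamma> m w"
    by auto
  have e: "gain_walk G (tail G e) [(e, True)] u" "m e \<in> carrier \<Gamma>"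
    using 3 by (auto simp: wf_digraph_def)
  have "net_gain \<Gamma> m w \<in> carrier \<Gamma>" using net_gain_closed 3 by auto
  then have "net_gain \<Gamma> m (w' @ [(e, True)]) = inv\<^bsub>\<Gamma>\<^esub> net_gain \<Gamma> m ((e, False) # w)"
    using net_gain_append[OF 3(4) w'(1) e(1)] e(2) w'(2) by (simp add: inv_of_comp mult_comp one_id)
  then show ?case using walk_append[OF w'(1) e(1)] by blast
qed

text \<open>Each vertex receives the net gain of a walk leading to it from a base vertex of its
  component.\<close>

lemma potential_exists:
  assumes "wf_digraph G" "\<forall>e\<in>arcs G. m e \<in> carrier \<Gamma>"
  obtains g where "\<And>v. g v \<in> carrier \<Gamma>"
    "\<And>e. e \<in> arcs G \<Longrightarrow> \<exists>r\<in>verts G. g (tail G e) \<circ> m e \<circ> inv\<^bsub>\<Gamma>\<^esub> g (head G e) \<in> gain_space \<Gamma> G m r"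
proof -
  define R where "R v u \<longleftrightarrow> (\<exists>w. gain_walk G u w v)" for u v
  define root where "root v = (SOME u. R v u)" for v
  define W where "W v = (SOME w. gain_walk G (root v) w v)" for v
  define g where "g v = (if v \<in> verts G then net_gain \<Gamma> m (W v) else id)" for v
  have W: "gain_walk G (root v) (W v) v" if "v \<in> verts G" for v
  proof -
    have "gain_walk G v [] v" using that by simp
    then have "R v v" unfolding R_def by blast
    then have "R v (root v)" unfolding root_def by (rule someI)
    then show ?thesis unfolding W_def R_def by (rule someI_ex)
  qed
  have "g v \<in> carrier \<Gamma>" for v
    using W[of v] net_gain_closed[OF assms(2)] id_closed by (auto simp: g_def)
  moreover have "\<exists>r\<in>verts G. g (tail G e) \<circ> m e \<circ> inv\<^bsub>\<Gamma>\<^esub> g (head G e) \<in> gain_space \<Gamma> G m r"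
    if e: "e \<in> arcs G" for e
  proof -
    let ?i = "tail G e" and ?j = "head G e"
    have ij: "?i \<in> verts G" "?j \<in> verts G" using assms(1) e by (auto simp: wf_digraph_def)
    have f: "gain_walk G ?i [(e, True)] ?j" and b: "gain_walk G ?j [(e, False)] ?i" using e ij by auto
    have "R ?i u = R ?j u" for u
      unfolding R_def using walk_append[OF _ f] walk_append[OF _ b] by blast
    then have "R ?i = R ?j" by blast
    then have root: "root ?j = root ?i" by (simp add: root_def)
    obtain w' where w': "gain_walk G ?j w' (root ?j)" "net_gain \<Gamma> m w' = inv\<^bsub>\<Gamma>\<^esub> net_gain \<Gamma> m (W ?j)"
      using reverse_walk[OF assms W[OF ij(2)]] by blast
    have c1: "gain_walk G (root ?i) (W ?i @ [(e, True)]) ?j" using walk_append[OF W[OF ij(1)] f] .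
    have c2: "gain_walk G (root ?i) ((W ?i @ [(e, True)]) @ w') (root ?i)"
      using walk_append[OF c1] w'(1) root by simp
    have n: "net_gain \<Gamma> m ((W ?i @ [(e, True)]) @ w') = g ?i \<circ> m e \<circ> inv\<^bsub>\<Gamma>\<^esub> g ?j"
      using net_gain_append[OF assms(2) c1 w'(1)] net_gain_append[OF assms(2) W[OF ij(1)] f] w'(2) ij
        assms(2) e by (simp add: g_def one_id mult_comp)
    have "net_gain \<Gamma> m ((W ?i @ [(e, True)]) @ w') \<in> gain_space \<Gamma> G m (root ?i)"
      unfolding gain_space_def by (rule generate.incl) (use c2 in blast)
    then have "g ?i \<circ> m e \<circ> inv\<^bsub>\<Gamma>\<^esub> g ?j \<in> gain_space \<Gamma> G m (root ?i)" by (simp only: n)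
    moreover have "root ?i \<in> verts G" using walk_verts[OF assms(1) W[OF ij(1)]] by blast
    ultimately show ?thesis by blast
  qed
  ultimately show ?thesis using that by blast
qed

text \<open>Telescoping: each step contributes the inverse of the potential at its start times the
  potential at its end, so only the two ends of the walk remain.\<close>

lemma walk_fits:
  assumes "\<forall>e\<in>arcs G. m e \<in> carrier \<Gamma>" "\<forall>e\<in>arcs G. fits A B s (gedge_of G m e)" "gain_walk G u w v"
  shows "glide (net_gain \<Gamma> m w) = (s u \<noteq> s v) \<and> net_gain \<Gamma> m w 0 $ 1 = A v - A u \<and>
    net_gain \<Gamma> m w 0 $ 2 = sn (s u) * (B v - B u)"
  using assms(3,1,2)
proof (induction G u w v rule: gain_walk.induct)
  case (1 G u v)
  then show ?case using glide_id by (simp add: one_id)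
next
  case (2 G u e w v)
  then have e: "e \<in> arcs G" "tail G e = u" "m e \<in> carrier \<Gamma>" and w: "gain_walk G (head G e) w v" by auto
  have IH: "glide (net_gain \<Gamma> m w) = (s (head G e) \<noteq> s v)" "net_gain \<Gamma> m w 0 $ 1 = A v - A (head G e)"
    "net_gain \<Gamma> m w 0 $ 2 = sn (s (head G e)) * (B v - B (head G e))" using 2 w by auto
  have f: "fits A B s (gedge_of G m e)" using 2 e by blast
  have c: "net_gain \<Gamma> m w \<in> carrier \<Gamma>" using net_gain_closed[OF _ w] 2 by blast
  have "sn (glide (m e)) = sn (s u) * sn (s (head G e))"
    using f e(2) sn_neq[of "s u" "s (head G e)"] by (simp add: fits_def)
  moreover have fl: "glide (m e) = (s u \<noteq> s (head G e))" using f e(2) by (simp add: fits_def)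
  moreover have "glide (net_gain \<Gamma> m ((e, True) # w)) = (s u \<noteq> s v)"
    unfolding net_gain_comp glide_mult[OF e(3) c] IH(1) using fl by blast
  moreover have "sn (s (head G e)) * net_gain \<Gamma> m w 0 $ 2 = B v - B (head G e)" by (simp add: IH(3))
  moreover have "net_gain \<Gamma> m ((e, True) # w) 0 = m e (net_gain \<Gamma> m w 0)"
    unfolding net_gain_comp by (rule comp_apply)
  ultimately show ?case
    using f e(2) IH(2) pm_apply(1,2)[OF in_pm[OF e(3)], of "net_gain \<Gamma> m w 0"]
    by (simp del: net_gain.simps add: fits_def mult.assoc) (simp add: algebra_simps)
next
  case (3 G u e w v)
  then have e: "e \<in> arcs G" "head G e = u" "m e \<in> carrier \<Gamma>" and w: "gain_walk G (tail G e) w v" by auto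
  have IH: "glide (net_gain \<Gamma> m w) = (s (tail G e) \<noteq> s v)" "net_gain \<Gamma> m w 0 $ 1 = A v - A (tail G e)"
    "net_gain \<Gamma> m w 0 $ 2 = sn (s (tail G e)) * (B v - B (tail G e))" using 3 w by auto
  have f: "fits A B s (gedge_of G m e)" using 3 e by blast
  have c: "net_gain \<Gamma> m w \<in> carrier \<Gamma>" using net_gain_closed[OF _ w] 3 by blast
  have "sn (glide (m e)) = sn (s (tail G e)) * sn (s u)"
    using f e(2) sn_neq[of "s (tail G e)" "s u"] by (simp add: fits_def)
  moreover have fl: "glide (m e) = (s (tail G e) \<noteq> s u)" using f e(2) by (simp add: fits_def)
  moreover have "glide (net_gain \<Gamma> m ((e, False) # w)) = (s u \<noteq> s v)"
    unfolding net_gain_comp glide_mult[OF inv_closed[OF e(3)] c] glide_inv[OF e(3)] IH(1) using fl by blast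
  moreover have "sn (s (tail G e)) * net_gain \<Gamma> m w 0 $ 2 = B v - B (tail G e)" by (simp add: IH(3))
  moreover have "sn (s (tail G e)) * m e 0 $ 2 = B u - B (tail G e)" using f e(2) by (simp add: fits_def)
  moreover have "net_gain \<Gamma> m ((e, False) # w) 0 = (inv\<^bsub>\<Gamma>\<^esub> (m e)) (net_gain \<Gamma> m w 0)"
    unfolding net_gain_comp by (rule comp_apply)
  ultimately show ?case
    using f e(2) IH(2) inv_apply[OF e(3), of "net_gain \<Gamma> m w 0"]
    by (simp del: net_gain.simps add: fits_def mult.assoc) (simp add: algebra_simps)
qed

lemma walk_periodic:
  fixes s :: "'v \<Rightarrow> bool"
  assumes "\<forall>e\<in>arcs G. m e \<in> carrier \<Gamma>" "\<forall>e\<in>arcs G. glide (m e) = (s (tail G e) \<noteq> s (head G e))"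
    "gain_walk G u w v"
  shows "glide (net_gain \<Gamma> m w) = (s u \<noteq> s v)"
  using assms(3,1,2)
proof (induction G u w v rule: gain_walk.induct)
  case (1 G u v)
  then show ?case using glide_id by (simp add: one_id)
next
  case (2 G u e w v)
  then have e: "e \<in> arcs G" "tail G e = u" "m e \<in> carrier \<Gamma>" and w: "gain_walk G (head G e) w v" by auto
  have IH: "glide (net_gain \<Gamma> m w) = (s (head G e) \<noteq> s v)" using 2 w by blast
  have c: "net_gain \<Gamma> m w \<in> carrier \<Gamma>" using net_gain_closed[OF _ w] 2 by blast
  have "glide (m e) = (s (tail G e) \<noteq> s (head G e))" using 2 e by blast
  then show ?case unfolding net_gain_comp glide_mult[OF e(3) c] IH using e(2) by blast
next
  case (3 G u e w v)
  then have e: "e \<in> arcs G" "head G e = u" "m e \<in> carrier \<Gamma>" and w: "gain_walk G (tail G e) w v" by auto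
  have IH: "glide (net_gain \<Gamma> m w) = (s (tail G e) \<noteq> s v)" using 3 w by blast
  have c: "net_gain \<Gamma> m w \<in> carrier \<Gamma>" using net_gain_closed[OF _ w] 3 by blast
  have "glide (m e) = (s (tail G e) \<noteq> s (head G e))" using 3 e by blast
  then show ?case
    unfolding net_gain_comp glide_mult[OF inv_closed[OF e(3)] c] glide_inv[OF e(3)] IH using e(2) by blast
qed

text \<open>The potential carries each arc gain into the gain space at a base vertex; if that is
  trivial, the gain is a quotient of potentials. Conversely, gains that are such quotients cancel
  around closed walks.\<close>

lemma balanced_iff:
  assumes "wf_digraph G" "\<forall>e\<in>arcs G. m e \<in> carrier \<Gamma>"
  shows "balanced \<Gamma> G m \<longleftrightarrow> balanced_set (gedge_of G m ` arcs G)"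
proof
  assume bal: "balanced \<Gamma> G m"
  obtain g where g: "\<And>v. g v \<in> carrier \<Gamma>"
    "\<And>e. e \<in> arcs G \<Longrightarrow> \<exists>r\<in>verts G. g (tail G e) \<circ> m e \<circ> inv\<^bsub>\<Gamma>\<^esub> g (head G e) \<in> gain_space \<Gamma> G m r"
    by (rule potential_exists[OF assms]) blast
  have "fits (\<lambda>v. g v 0 $ 1) (\<lambda>v. g v 0 $ 2) (\<lambda>v. glide (g v)) (gedge_of G m e)" if e: "e \<in> arcs G" for e
  proof -
    have me: "m e \<in> carrier \<Gamma>" using e assms by blast
    have "g (tail G e) \<circ> m e \<circ> inv\<^bsub>\<Gamma>\<^esub> g (head G e) = id"
      using g(2)[OF e] bal by (auto simp: balanced_def one_id)
    then have "g (tail G e) \<circ> m e \<circ> (inv\<^bsub>\<Gamma>\<^esub> g (head G e) \<circ> g (head G e)) = g (head G e)"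
      by (metis comp_assoc id_comp)
    then have eq: "g (tail G e) \<circ> m e = g (head G e)" by (simp add: inv_comp(1)[OF g(1)])
    have "g (head G e) 0 = g (tail G e) (m e 0)" by (simp flip: eq)
    moreover have "glide (g (head G e)) = (glide (g (tail G e)) \<noteq> glide (m e))"
      using glide_mult[OF g(1) me] eq by metis
    ultimately show ?thesis
      using pm_apply(1,2)[OF in_pm[OF g(1)], of "tail G e" "m e 0"] by (auto simp: fits_def)
  qed
  \<comment> \<open>The potential takes values in the group, whose elements shift by
    integers.\<close>
  moreover have "g v 0 $ 2 \<in> \<int>" for v using pm_apply(4)[OF in_pm[OF g(1)]] .
  ultimately show "balanced_set (gedge_of G m ` arcs G)"
    by (intro balanced_setI[of _ "\<lambda>v. g v 0 $ 1" "\<lambda>v. g v 0 $ 2" "\<lambda>v. glide (g v)"]) blast+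
next
  assume "balanced_set (gedge_of G m ` arcs G)"
  then obtain A B s where f: "\<forall>e\<in>arcs G. fits A B s (gedge_of G m e)"
    unfolding balanced_set_def by blast
  have "net_gain \<Gamma> m w = id" if "gain_walk G v w v" for v w
  proof (rule pm_eqI)
    show "net_gain \<Gamma> m w \<in> carrier pm" using net_gain_closed[OF assms(2) that] in_pm by blast
    show "id \<in> carrier pm" using id_closed in_pm by blast
  qed (use walk_fits[OF assms(2) f that] glide_id in auto)
  then have "gain_space \<Gamma> G m v \<subseteq> generate \<Gamma> {id}" for v
    unfolding gain_space_def by (intro mono_generate) blast
  moreover have "generate \<Gamma> {id} = {id}" using generate_one one_id by simp
  moreover have "id \<in> gain_space \<Gamma> G m v" for v
    unfolding gain_space_def one_id[symmetric] by (rule generate.one)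
  ultimately show "balanced \<Gamma> G m" unfolding balanced_def one_id by blast
qed

text \<open>The same correspondence for linear parts only. These are multiplicative, so being a
  translation passes from net gains to the subgroup they generate.\<close>

lemma purely_periodic_iff:
  fixes G :: "('v, 'e::finite) pre_digraph"
  assumes "wf_digraph G" "\<forall>e\<in>arcs G. m e \<in> carrier \<Gamma>"
  shows "purely_periodic \<Gamma> G m \<longleftrightarrow> periodic_set (gedge_of G m ` arcs G)"
proof
  assume per: "purely_periodic \<Gamma> G m"
  obtain g where g: "\<And>v. g v \<in> carrier \<Gamma>"
    "\<And>e. e \<in> arcs G \<Longrightarrow> \<exists>r\<in>verts G. g (tail G e) \<circ> m e \<circ> inv\<^bsub>\<Gamma>\<^esub> g (head G e) \<in> gain_space \<Gamma> G m r"
    by (rule potential_exists[OF assms]) blast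
  have "glide (m e) = (glide (g (tail G e)) \<noteq> glide (g (head G e)))" if e: "e \<in> arcs G" for e
  proof -
    have me: "m e \<in> carrier \<Gamma>" using e assms by blast
    have "\<not> glide (g (tail G e) \<circ> m e \<circ> inv\<^bsub>\<Gamma>\<^esub> g (head G e))"
      using g(2)[OF e] per translation_maps_glide by (auto simp: purely_periodic_def)
    then show ?thesis
      using glide_mult[OF comp_closed[OF g(1) me] inv_closed[OF g(1)]] glide_mult[OF g(1) me]
        glide_inv[OF g(1)] by blast
  qed
  then show "periodic_set (gedge_of G m ` arcs G)"
    by (intro periodic_setI[of _ "\<lambda>v. glide (g v)"]) simp
next
  assume "periodic_set (gedge_of G m ` arcs G)"
  then obtain s :: "'v \<Rightarrow> bool" where s: "\<forall>e\<in>arcs G. glide (m e) = (s (tail G e) \<noteq> s (head G e))"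
    unfolding periodic_set_def by auto
  have "\<not> glide \<gamma> \<and> \<gamma> \<in> carrier \<Gamma>" if "\<gamma> \<in> gain_space \<Gamma> G m v" for \<gamma> v
    using that unfolding gain_space_def
  proof (induction rule: generate.induct)
    case one
    then show ?case unfolding one_id using glide_id(1) id_closed by blast
  next
    case (incl h)
    then show ?case using walk_periodic[OF assms(2) s] net_gain_closed[OF assms(2)] by auto
  next
    case (inv h)
    then have "h \<in> carrier \<Gamma>" "\<not> glide h" using walk_periodic[OF assms(2) s] net_gain_closed[OF assms(2)] by auto
    then show ?case using glide_inv by simp
  next
    case (eng h1 h2)
    then show ?case unfolding mult_comp using glide_mult[of h1 h2] comp_closed[of h1 h2] by blast
  qed
  then show "purely_periodic \<Gamma> G m"
    unfolding purely_periodic_def using translation_maps_glide by blast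
qed

end


section \<open>Rigidity of gain graphs\<close>

text \<open>Isolated vertices only weaken the bound, so it suffices to test the subgraphs spanned by
  sets of arcs.\<close>

lemma kl_sparse_iff:
  fixes G :: "('v::finite, 'e::finite) pre_digraph"
  assumes "wf_digraph G"
  shows "kl_sparse 2 l G \<longleftrightarrow>
    (\<forall>F\<subseteq>arcs G. F \<noteq> {} \<longrightarrow> int (card F) \<le> 2 * int (card (tail G ` F \<union> head G ` F)) - l)"
proof
  assume sp: "kl_sparse 2 l G"
  show "\<forall>F\<subseteq>arcs G. F \<noteq> {} \<longrightarrow> int (card F) \<le> 2 * int (card (tail G ` F \<union> head G ` F)) - l"
  proof (intro allI impI)
    fix F assume F: "F \<subseteq> arcs G" "F \<noteq> {}"
    let ?H = "\<lparr>verts = tail G ` F \<union> head G ` F, arcs = F, tail = tail G, head = head G\<rparr>"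
    have "subgraph ?H G"
      using assms F by (auto simp: subgraph_def compatible_def wf_digraph_def)
    moreover have "card (arcs ?H) \<ge> 1" using F by (simp add: Suc_leI card_gt_0_iff)
    ultimately have "int (card (arcs ?H)) \<le> 2 * int (card (verts ?H)) - l"
      using sp unfolding kl_sparse_def by blast
    then show "int (card F) \<le> 2 * int (card (tail G ` F \<union> head G ` F)) - l" by simp
  qed
next
  assume F: "\<forall>F\<subseteq>arcs G. F \<noteq> {} \<longrightarrow> int (card F) \<le> 2 * int (card (tail G ` F \<union> head G ` F)) - l"
  show "kl_sparse 2 l G"
    unfolding kl_sparse_def
  proof (intro allI impI, elim conjE)
    fix H assume H: "subgraph H G" "1 \<le> card (arcs H)"
    have "arcs H \<subseteq> arcs G" "arcs H \<noteq> {}" using H by (auto simp: subgraph_def)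
    with F have "int (card (arcs H)) \<le> 2 * int (card (tail G ` arcs H \<union> head G ` arcs H)) - l" by blast
    moreover have "tail G ` arcs H \<union> head G ` arcs H \<subseteq> verts H"
      using H(1) by (auto simp: subgraph_def compatible_def wf_digraph_def)
    then have "card (tail G ` arcs H \<union> head G ` arcs H) \<le> card (verts H)" by (intro card_mono) auto
    ultimately show "int (card (arcs H)) \<le> 2 * int (card (verts H)) - l" by linarith
  qed
qed

locale gain_digraph = gain_group \<Gamma> for \<Gamma> :: "plane_map monoid" +
  fixes G :: "('v::finite, 'e::finite) pre_digraph" and m :: "'e \<Rightarrow> plane_map"
  assumes gain_graph: "gain_graph \<Gamma> G m"
begin

abbreviation "edge \<equiv> gedge_of G m"
abbreviation "edges \<equiv> edge ` arcs G"

lemma wf: "wf_digraph G"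
  using gain_graph by (simp add: gain_graph_def fin_digraph.axioms(1))

lemma m_closed': "e \<in> arcs G \<Longrightarrow> m e \<in> carrier \<Gamma>"
  using gain_graph by (simp add: gain_graph_def)

lemma verts_nonempty: "verts G \<noteq> {}"
  using gain_graph by (simp add: gain_graph_def)

lemma card_edge: "card (edge ` F) = card F"
  by (rule card_image) (use inj_gedge_of inj_on_subset in blast)

lemma card_ends_edge: "card (ends (edge ` F)) = card (tail G ` F \<union> head G ` F)"
  by (simp add: ends_gedge_of)

lemma ends_edges: "ends edges \<subseteq> verts G"
  using wf by (auto simp: ends_gedge_of wf_digraph_def)

lemma gedge_of_subgraph: "subgraph H G \<Longrightarrow> gedge_of H m = edge"
  by (auto simp: subgraph_def compatible_def gedge_of_def fun_eq_iff)

lemma subgraph_props: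
  assumes "subgraph H G"
  shows "wf_digraph H" "\<forall>e\<in>arcs H. m e \<in> carrier \<Gamma>" "arcs H \<subseteq> arcs G" "tail H = tail G" "head H = head G"
  using assms m_closed' by (auto simp: subgraph_def compatible_def)

lemma sparse_edges_iff:
  "gain_sparse edges \<longleftrightarrow> kl_sparse 2 1 G \<and>
    (\<forall>H. subgraph H G \<and> purely_periodic \<Gamma> H m \<longrightarrow> kl_sparse 2 2 H) \<and>
    (\<forall>H. subgraph H G \<and> balanced \<Gamma> H m \<longrightarrow> kl_sparse 2 3 H)"
proof
  assume sp: "gain_sparse edges"
  have count: "int (card F) \<le> 2 * int (card (tail G ` F \<union> head G ` F)) - 1"
    "periodic_set (edge ` F) \<Longrightarrow> int (card F) \<le> 2 * int (card (tail G ` F \<union> head G ` F)) - 2"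
    "balanced_set (edge ` F) \<Longrightarrow> int (card F) \<le> 2 * int (card (tail G ` F \<union> head G ` F)) - 3"
    if "F \<subseteq> arcs G" "F \<noteq> {}" for F
    using sparseD[OF sp, of "edge ` F"] that unfolding card_edge card_ends_edge by fastforce+
  have "kl_sparse 2 1 G" unfolding kl_sparse_iff[OF wf] using count(1) by blast
  moreover have "kl_sparse 2 2 H" if H: "subgraph H G" "purely_periodic \<Gamma> H m" for H
  proof -
    note P = subgraph_props[OF H(1)]
    have per: "periodic_set (edge ` arcs H)"
      using H(2) purely_periodic_iff[OF P(1,2)] gedge_of_subgraph[OF H(1)] by simp
    have "periodic_set (edge ` F)" if "F \<subseteq> arcs H" for F
      using per that unfolding periodic_set_def by blast
    then show ?thesis unfolding kl_sparse_iff[OF P(1)] P(4,5) using count(2) P(3) by blast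
  qed
  moreover have "kl_sparse 2 3 H" if H: "subgraph H G" "balanced \<Gamma> H m" for H
  proof -
    note P = subgraph_props[OF H(1)]
    have bal: "balanced_set (edge ` arcs H)"
      using H(2) balanced_iff[OF P(1,2)] gedge_of_subgraph[OF H(1)] by simp
    have "balanced_set (edge ` F)" if "F \<subseteq> arcs H" for F
      using bal that unfolding balanced_set_def by blast
    then show ?thesis unfolding kl_sparse_iff[OF P(1)] P(4,5) using count(3) P(3) by blast
  qed
  ultimately show "kl_sparse 2 1 G \<and>
    (\<forall>H. subgraph H G \<and> purely_periodic \<Gamma> H m \<longrightarrow> kl_sparse 2 2 H) \<and>
    (\<forall>H. subgraph H G \<and> balanced \<Gamma> H m \<longrightarrow> kl_sparse 2 3 H)" by blast
next
  assume sp: "kl_sparse 2 1 G \<and>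
    (\<forall>H. subgraph H G \<and> purely_periodic \<Gamma> H m \<longrightarrow> kl_sparse 2 2 H) \<and>
    (\<forall>H. subgraph H G \<and> balanced \<Gamma> H m \<longrightarrow> kl_sparse 2 3 H)"
  show "gain_sparse edges"
    unfolding gain_sparse_def
  proof (intro allI impI)
    fix F' assume "F' \<subseteq> edges" "F' \<noteq> {}"
    then obtain F where F: "F' = edge ` F" "F \<subseteq> arcs G" "F \<noteq> {}"
      by (auto simp: subset_image_iff)
    define H where "H = \<lparr>verts = tail G ` F \<union> head G ` F, arcs = F, tail = tail G, head = head G\<rparr>"
    have H: "subgraph H G"
      using wf F by (auto simp: H_def subgraph_def compatible_def wf_digraph_def)
    have H_sel: "arcs H = F" "tail H = tail G" "head H = head G" by (simp_all add: H_def)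
    note P = subgraph_props[OF H]
    have iff: "purely_periodic \<Gamma> H m \<longleftrightarrow> periodic_set F'" "balanced \<Gamma> H m \<longleftrightarrow> balanced_set F'"
      using purely_periodic_iff[OF P(1,2)] balanced_iff[OF P(1,2)] gedge_of_subgraph[OF H] H_sel F(1)
      by simp_all
    have kl: "int (card F) \<le> 2 * int (card (tail G ` F \<union> head G ` F)) - l" if "kl_sparse 2 l H" for l
      using that F(3) unfolding kl_sparse_iff[OF P(1)] H_sel by blast
    have "int (card F) \<le> 2 * int (card (tail G ` F \<union> head G ` F)) - 1"
      using sp F unfolding kl_sparse_iff[OF wf] by blast
    moreover have "int (card F) \<le> 2 * int (card (tail G ` F \<union> head G ` F)) - 2" if "periodic_set F'"
      using kl sp H iff that by blast
    moreover have "int (card F) \<le> 2 * int (card (tail G ` F \<union> head G ` F)) - 3" if "balanced_set F'"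
      using kl sp H iff that by blast
    ultimately show "card F' + 1 \<le> 2 * card (ends F') \<and>
     (periodic_set F' \<longrightarrow> card F' + 2 \<le> 2 * card (ends F')) \<and>
     (balanced_set F' \<longrightarrow> card F' + 3 \<le> 2 * card (ends F'))"
      unfolding F(1) card_edge card_ends_edge by linarith
  qed
qed

section \<open>Configurations and the orbit matrix\<close>

lemma dX_dY_edge_zero:
  assumes "e \<in> arcs G" "p (tail G e) = m e (p (head G e))"
  shows "dX p (edge e) = 0 \<and> dY p (edge e) = 0"
  unfolding dX_def dY_def gedge_of_sel assms(2)
  using pm_apply(1,2)[OF in_pm[OF m_closed'[OF assms(1)]], of "p (head G e)"] by simp

lemma pm_inj:
  assumes "\<gamma> \<in> carrier \<Gamma>" "\<gamma> x = \<gamma> y"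
  shows "x = y"
  using inv_comp(1)[OF assms(1)] assms(2) by (metis comp_apply id_apply)

lemma derived_adjD:
  assumes "derived_adj \<Gamma> G m x y"
  obtains e where "e \<in> arcs G" "snd x \<in> carrier \<Gamma>" "tail G e = fst x" "head G e = fst y" "snd y = snd x \<circ> m e"
    | e where "e \<in> arcs G" "snd y \<in> carrier \<Gamma>" "tail G e = fst y" "head G e = fst x" "snd x = snd y \<circ> m e"
proof -
  have xy: "snd x \<in> carrier \<Gamma>" "snd y \<in> carrier \<Gamma>" using assms by (auto simp: derived_adj_def derived_verts_def)
  have eq: "\<delta> = \<gamma> \<circ> \<epsilon>" if "\<gamma> \<in> carrier \<Gamma>" "\<epsilon> = inv\<^bsub>\<Gamma>\<^esub> \<gamma> \<otimes>\<^bsub>\<Gamma>\<^esub> \<delta>" for \<gamma> \<delta> \<epsilon>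
  proof -
    have "\<gamma> \<circ> \<epsilon> = (\<gamma> \<circ> inv\<^bsub>\<Gamma>\<^esub> \<gamma>) \<circ> \<delta>" using that by (simp only: mult_comp comp_assoc)
    then show ?thesis using inv_comp(2)[OF that(1)] by simp
  qed
  show ?thesis
    using assms that eq xy unfolding derived_adj_def by blast
qed

text \<open>Every edge of the derived graph is the image under a group element of one lifted from an
  arc, and group elements are injective, so the arcs alone decide.\<close>

lemma configurationI:
  assumes "\<forall>e\<in>arcs G. dX p (edge e) \<noteq> 0 \<or> dY p (edge e) \<noteq> 0"
  shows "configuration \<Gamma> G m p"
  unfolding configuration_def
proof (intro allI impI)
  have ne: "\<gamma> (p (tail G e)) \<noteq> (\<gamma> \<circ> m e) (p (head G e))" if "e \<in> arcs G" "\<gamma> \<in> carrier \<Gamma>" for e \<gamma>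
    using assms dX_dY_edge_zero[OF that(1), of p] pm_inj[OF that(2)] that(1) by force
  fix x y assume "derived_adj \<Gamma> G m x y"
  then show "derived_pos p x \<noteq> derived_pos p y"
  proof (cases rule: derived_adjD)
    case (1 e)
    with ne[of e "snd x"] show ?thesis by (auto simp: derived_pos_def case_prod_unfold)
  next
    case (2 e)
    with ne[of e "snd y"] show ?thesis by (auto simp: derived_pos_def case_prod_unfold)
  qed
qed

text \<open>Needed for a generic configuration to exist at all; rigidity and independence,
  quantified over generic configurations, would otherwise hold vacuously.\<close>

lemma configuration_exists: "\<exists>p. configuration \<Gamma> G m p"
proof -
  \<comment> \<open>A sum of squares merges the two alternatives into one polynomial
    condition.\<close>
  let ?P = "\<lambda>e p. dX p (edge e) * dX p (edge e) + dY p (edge e) * dY p (edge e) \<noteq> 0"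
  have "generic_condition (\<lambda>p. \<forall>e\<in>arcs G. ?P e p) \<and> (\<exists>p. \<forall>e\<in>arcs G. ?P e p)"
  proof (rule generic_condition_ball)
    show "generic_condition (?P e)" for e
      unfolding dX_def dY_def
      by (intro generic_condition_nonzero polynomial_on_lines_mult polynomial_on_lines_add
          polynomial_on_lines_diff polynomial_on_lines_const polynomial_on_lines_coord)
    fix e assume e: "e \<in> arcs G"
    have me: "m e \<in> carrier \<Gamma>" by (rule m_closed'[OF e])
    show "\<exists>p. ?P e p"
    proof (cases "tail G e = head G e")
      case False
      have "dX ((\<lambda>_. 0)(tail G e := vector [m e 0 $ 1 + 1, 0])) (edge e) = 1"
        using False by (simp add: dX_def)
      then show ?thesis by (metis sum_squares_eq_zero_iff zero_neq_one)
    next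
      case loop: True
      have ne: "m e \<noteq> id" using gain_graph e loop one_id by (auto simp: gain_graph_def)
      show ?thesis
      proof (cases "m e 0 $ 1 = 0")
        case False
        then have "dX (\<lambda>_. 0) (edge e) \<noteq> 0" by (simp add: dX_def)
        then show ?thesis by (metis sum_squares_eq_zero_iff)
      next
        case x0: True
        have "\<exists>p. dY p (edge e) \<noteq> 0"
        proof (cases "glide (m e)")
          case True
          then show ?thesis
            using loop by (intro exI[of _ "\<lambda>_. vector [0, (m e 0 $ 2 + 1) / 2]"]) (simp add: dY_def field_simps)
        next
          case False
          have "m e 0 $ 2 \<noteq> 0"
          proof
            assume "m e 0 $ 2 = 0"
            then have "m e = id"
              using x0 False glide_id by (intro pm_eqI[OF in_pm[OF me] in_pm[OF id_closed]]) auto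
            with ne show False by blast
          qed
          then show ?thesis by (intro exI[of _ "\<lambda>_. 0"]) (simp add: dY_def)
        qed
        then show ?thesis by (metis sum_squares_eq_zero_iff)
      qed
    qed
  qed simp
  then obtain p where "\<forall>e\<in>arcs G. ?P e p" by blast
  then have "\<forall>e\<in>arcs G. dX p (edge e) \<noteq> 0 \<or> dY p (edge e) \<noteq> 0" by auto
  then show ?thesis using configurationI by blast
qed

lemma row_orbit: "row e (orbit_matrix \<Gamma> G m p) = (if e \<in> arcs G then rowv p (edge e) else 0)"
  using row_orbit_matrix[of m e G p] m_closed'[of e] by (auto simp: row_def orbit_matrix_def vec_eq_iff)

lemma row_independent_iff: "row_independent (arcs G) (orbit_matrix \<Gamma> G m p) \<longleftrightarrow> indep UNIV p edges"
proof -
  have "inj_on (\<lambda>e. row e (orbit_matrix \<Gamma> G m p)) (arcs G) \<longleftrightarrow> inj_on (rowv p \<circ> edge) (arcs G)"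
    by (rule inj_on_cong) (simp add: row_orbit)
  also have "\<dots> \<longleftrightarrow> inj_on (rowv p) edges"
    using comp_inj_on_iff[of edge "arcs G" "rowv p"] inj_gedge_of inj_on_subset by blast
  finally have "inj_on (\<lambda>e. row e (orbit_matrix \<Gamma> G m p)) (arcs G) \<longleftrightarrow> inj_on (rowv p) edges" .
  moreover have "(\<lambda>e. row e (orbit_matrix \<Gamma> G m p)) ` arcs G = rowv p ` edges"
    unfolding image_image by (rule image_cong) (simp_all add: row_orbit)
  ultimately show ?thesis
    by (simp add: row_independent_def indep_iff_independent)
qed

lemma rank_orbit: "rank (orbit_matrix \<Gamma> G m p) = dim (rowv p ` edges)"
proof -
  have "rows (orbit_matrix \<Gamma> G m p) \<subseteq> span (rowv p ` edges)"
    by (auto simp: rows_def row_orbit span_base span_zero)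
  then have "dim (rows (orbit_matrix \<Gamma> G m p)) \<le> dim (span (rowv p ` edges))"
    by (rule dim_subset)
  then have "dim (rows (orbit_matrix \<Gamma> G m p)) \<le> dim (rowv p ` edges)" by (simp only: dim_span)
  moreover have "rowv p ` edges \<subseteq> rows (orbit_matrix \<Gamma> G m p)"
    by (force simp: rows_def row_orbit)
  then have "dim (rowv p ` edges) \<le> dim (rows (orbit_matrix \<Gamma> G m p))"
    by (rule dim_subset)
  ultimately show ?thesis by (simp add: row_rank_def)
qed

lemma rank_eq_iff: "indep UNIV p edges \<longleftrightarrow> card edges \<le> rank (orbit_matrix \<Gamma> G m p)"
proof
  assume "indep UNIV p edges"
  then have "inj_on (rowv p) edges" "independent (rowv p ` edges)"
    using indep_iff_independent[of edges p] by auto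
  then show "card edges \<le> rank (orbit_matrix \<Gamma> G m p)"
    by (simp add: rank_orbit dim_eq_card_independent card_image)
next
  assume r: "card edges \<le> rank (orbit_matrix \<Gamma> G m p)"
  have "dim (rowv p ` edges) \<le> card (rowv p ` edges)" by (rule dim_le_card') simp
  moreover have "card (rowv p ` edges) \<le> card edges" by (rule card_image_le) simp
  ultimately have c: "card (rowv p ` edges) = card edges" "dim (rowv p ` edges) = card (rowv p ` edges)"
    using r unfolding rank_orbit by linarith+
  have "inj_on (rowv p) edges" by (rule eq_card_imp_inj_on) (use c in simp_all)
  moreover have "independent (rowv p ` edges)"
    by (rule card_le_dim_spanning[OF order_refl span_superset]) (use c in simp_all)
  ultimately show "indep UNIV p edges" by (simp add: indep_iff_independent)
qed

text \<open>Ranks are bounded by the number of edges, so their maximum over the configurations is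
  attained.\<close>

lemma generic_exists: "\<exists>p. generic \<Gamma> G m p"
proof -
  let ?P = "\<lambda>r. \<exists>p. configuration \<Gamma> G m p \<and> rank (orbit_matrix \<Gamma> G m p) = r"
  obtain p0 where "configuration \<Gamma> G m p0" using configuration_exists by blast
  then have "?P (rank (orbit_matrix \<Gamma> G m p0))" by blast
  moreover have "r \<le> card edges" if "?P r" for r
  proof -
    have "dim (rowv p ` edges) \<le> card edges" for p
      using dim_le_card'[of "rowv p ` edges"] card_image_le[of edges "rowv p"] by simp
    then show ?thesis using that rank_orbit by metis
  qed
  ultimately have "?P (Greatest ?P)" by (intro GreatestI_nat[of ?P _ "card edges"]) blast+
  moreover have "r \<le> Greatest ?P" if "?P r" for r
    using that \<open>\<And>r. ?P r \<Longrightarrow> r \<le> card edges\<close> by (intro Greatest_le_nat[of ?P _ "card edges"]) blast+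
  ultimately show ?thesis unfolding generic_def by metis
qed

section \<open>Symmetric motions of the derived framework\<close>

definition motion_vector :: "('v \<times> plane_map \<Rightarrow> real^2) \<Rightarrow> real^('v \<times> 2)" where
  "motion_vector u = (\<chi> i. u (fst i, id) $ snd i)"

definition vector_motion :: "real^('v \<times> 2) \<Rightarrow> 'v \<times> plane_map \<Rightarrow> real^2" where
  "vector_motion U = (\<lambda>(v, \<gamma>). linear_part \<gamma> (\<chi> k. U $ (v, k)))"

lemma linear_part_id: "linear_part id = id"
  by (auto simp: linear_part_def fun_eq_iff)

lemma symmetric_motion_vector:
  assumes u: "symmetric_motion \<Gamma> G m p u"
  shows "motion_vector u \<in> motions p edges"
proof -
  have "rowv p (edge e) \<bullet> motion_vector u = 0" if e: "e \<in> arcs G" for e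
  proof -
    let ?i = "tail G e" and ?j = "head G e"
    have ij: "?i \<in> verts G" "?j \<in> verts G" using wf e by (auto simp: wf_digraph_def)
    have me: "m e \<in> carrier \<Gamma>" by (rule m_closed'[OF e])
    have "derived_adj \<Gamma> G m (?i, id) (?j, m e)"
      unfolding derived_adj_def derived_verts_def
      using ij me id_closed e l_one[OF me] inv_one by (auto simp: one_id[symmetric])
    then have "(derived_pos p (?i, id) - derived_pos p (?j, m e)) \<bullet> (u (?i, id) - u (?j, m e)) = 0"
      using u unfolding symmetric_motion_def by blast
    moreover have "u (?j, m e) = linear_part (m e) (u (?j, id))"
      using u ij me unfolding symmetric_motion_def one_id by blast
    ultimately have "(p ?i - m e (p ?j)) \<bullet> (u (?i, id) - linear_part (m e) (u (?j, id))) = 0"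
      by (simp add: derived_pos_def)
    then have "(p ?i $ 1 - m e (p ?j) $ 1) * (u (?i, id) $ 1 - linear_part (m e) (u (?j, id)) $ 1)
        + (p ?i $ 2 - m e (p ?j) $ 2) * (u (?i, id) $ 2 - linear_part (m e) (u (?j, id)) $ 2) = 0"
      by (simp add: inner_vec_def sum_2)
    then show ?thesis
      unfolding inner_rowv
      using pm_apply(1,2)[OF in_pm[OF me], of "p ?j"] pm_apply(5,6)[OF in_pm[OF me], of "u (?j, id)"]
      by (simp add: motion_vector_def dX_def dY_def diff_diff_eq add.commute)
  qed
  then show ?thesis by (auto simp: motions_def)
qed

lemma vector_symmetric_motion:
  assumes U: "U \<in> motions p edges"
  shows "symmetric_motion \<Gamma> G m p (vector_motion U)"
  unfolding symmetric_motion_def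
proof (intro conjI allI impI ballI)
  fix v \<gamma>
  show "vector_motion U (v, \<gamma>) = linear_part \<gamma> (vector_motion U (v, \<one>\<^bsub>\<Gamma>\<^esub>))"
    by (simp add: vector_motion_def one_id linear_part_id)
next
  have *: "(derived_pos p (tail G e, \<gamma>) - derived_pos p (head G e, \<gamma> \<circ> m e)) \<bullet>
      (vector_motion U (tail G e, \<gamma>) - vector_motion U (head G e, \<gamma> \<circ> m e)) = 0"
    if e: "e \<in> arcs G" and \<gamma>: "\<gamma> \<in> carrier \<Gamma>" for e \<gamma>
  proof -
    let ?i = "tail G e" and ?j = "head G e"
    have me: "m e \<in> carrier \<Gamma>" by (rule m_closed'[OF e])
    have c: "\<gamma> \<circ> m e \<in> carrier \<Gamma>" by (rule comp_closed[OF \<gamma> me])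
    let ?d = "derived_pos p (?i, \<gamma>) - derived_pos p (?j, \<gamma> \<circ> m e)"
    let ?w = "vector_motion U (?i, \<gamma>) - vector_motion U (?j, \<gamma> \<circ> m e)"
    have d: "?d $ 1 = dX p (edge e)" "?d $ 2 = sn (glide \<gamma>) * dY p (edge e)"
      using pm_apply(1,2)[OF in_pm[OF \<gamma>], of "p ?i"] pm_apply(1,2)[OF in_pm[OF \<gamma>], of "m e (p ?j)"]
        pm_apply(1,2)[OF in_pm[OF me], of "p ?j"]
      by (simp_all add: derived_pos_def dX_def dY_def algebra_simps)
    have "sn (glide (\<gamma> \<circ> m e)) = sn (glide \<gamma>) * sn (glide (m e))"
      unfolding glide_mult[OF \<gamma> me] by (rule sn_neq)
    then have w: "?w $ 1 = U $ (?i, 1) - U $ (?j, 1)"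
      "?w $ 2 = sn (glide \<gamma>) * (U $ (?i, 2) - sn (glide (m e)) * U $ (?j, 2))"
      using pm_apply(5,6)[OF in_pm[OF \<gamma>]] pm_apply(5,6)[OF in_pm[OF c]]
      by (simp_all add: vector_motion_def algebra_simps)
    \<comment> \<open>Both vectors carry the sign of \<gamma> in the second coordinate, so it
      cancels: all lifts of an arc impose the same equation.\<close>
    have "?d \<bullet> ?w = ?d $ 1 * ?w $ 1 + ?d $ 2 * ?w $ 2" by (simp add: inner_vec_def sum_2)
    also have "\<dots> = rowv p (edge e) \<bullet> U"
      unfolding d w inner_rowv by (simp add: algebra_simps)
    also have "\<dots> = 0" using U e by (auto simp: motions_def)
    finally show ?thesis .
  qed
  fix x y assume "derived_adj \<Gamma> G m x y"
  then show "(derived_pos p x - derived_pos p y) \<bullet> (vector_motion U x - vector_motion U y) = 0"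
  proof (cases rule: derived_adjD)
    case (1 e)
    have "x = (tail G e, snd x)" "y = (head G e, snd x \<circ> m e)" using 1 by (auto simp: prod_eq_iff)
    then show ?thesis using *[OF 1(1,2)] by metis
  next
    case (2 e)
    have y: "y = (tail G e, snd y)" and x: "x = (head G e, snd y \<circ> m e)" using 2 by (auto simp: prod_eq_iff)
    have "(derived_pos p y - derived_pos p x) \<bullet> (vector_motion U y - vector_motion U x) = 0"
      using *[OF 2(1,2)] x y by metis
    then show ?thesis by (simp add: inner_diff_left inner_diff_right)
  qed
qed

text \<open>A trivial symmetric motion commutes with a translation and with a glide reflection of the
  group, so it is a translation along the axis direction.\<close>

lemma symmetrically_rigid_iff:
  "symmetrically_rigid \<Gamma> G m p \<longleftrightarrow>
    (\<forall>U\<in>motions p edges. \<exists>k. \<forall>v\<in>verts G. U $ (v, 1) = k \<and> U $ (v, 2) = 0)"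
proof
  assume rigid: "symmetrically_rigid \<Gamma> G m p"
  show "\<forall>U\<in>motions p edges. \<exists>k. \<forall>v\<in>verts G. U $ (v, 1) = k \<and> U $ (v, 2) = 0"
  proof
    fix U assume "U \<in> motions p edges"
    then have "trivial_motion \<Gamma> G p (vector_motion U)"
      using rigid vector_symmetric_motion by (auto simp: symmetrically_rigid_def)
    then obtain A :: "real^2^2" and b where A: "transpose A = - A"
      and tr0: "\<forall>x\<in>derived_verts \<Gamma> G. vector_motion U x = A *v derived_pos p x + b"
      unfolding trivial_motion_def by blast
    have tr: "linear_part \<gamma> (\<chi> k. U $ (v, k)) = A *v \<gamma> (p v) + b"
      if "v \<in> verts G" "\<gamma> \<in> carrier \<Gamma>" for v \<gamma>
      using tr0[rule_format, of "(v, \<gamma>)"] that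
      by (simp add: derived_verts_def vector_motion_def derived_pos_def)
    define a where "a = A $ 1 $ 2"
    have skew: "A $ j $ i = - A $ i $ j" for i j
      using arg_cong[OF A, of "\<lambda>M. M $ i $ j"] by (simp add: transpose_def)
    have A': "A $ 1 $ 1 = 0" "A $ 2 $ 2 = 0" "A $ 2 $ 1 = - a"
      using skew[of 1 1] skew[of 2 2] skew[of 1 2] by (simp_all add: a_def)
    have Ax: "(A *v x) $ 1 = a * x $ 2" "(A *v x) $ 2 = - a * x $ 1" for x
      using A' by (simp_all add: matrix_vector_mult_def sum_2 a_def)
    have co: "U $ (v, 1) = a * \<gamma> (p v) $ 2 + b $ 1" "sn (glide \<gamma>) * U $ (v, 2) = - a * \<gamma> (p v) $ 1 + b $ 2"
      if "v \<in> verts G" "\<gamma> \<in> carrier \<Gamma>" for v \<gamma>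
      using arg_cong[OF tr[OF that], of "\<lambda>x. x $ 1"] arg_cong[OF tr[OF that], of "\<lambda>x. x $ 2"]
        pm_apply(5,6)[OF in_pm[OF that(2)], of "\<chi> k. U $ (v, k)"] Ax by simp_all
    obtain \<tau> where \<tau>: "\<tau> \<in> carrier \<Gamma>" "\<not> glide \<tau>" "\<tau> 0 \<noteq> 0" using translation by blast
    obtain \<rho> where \<rho>: "\<rho> \<in> carrier \<Gamma>" "glide \<rho>" using glide_reflection by blast
    obtain v0 where v0: "v0 \<in> verts G" using verts_nonempty by blast
    have "a * \<tau> 0 $ 2 = 0" "a * \<tau> 0 $ 1 = 0"
      using co[OF v0 \<tau>(1)] co[OF v0 id_closed] pm_apply(1,2)[OF in_pm[OF \<tau>(1)], of "p v0"] \<tau>(2) glide_id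
      by (simp_all add: algebra_simps)
    with \<tau>(3) have "a = 0" by (auto simp: vec_eq_iff forall_2)
    have "U $ (v, 1) = b $ 1 \<and> U $ (v, 2) = 0" if v: "v \<in> verts G" for v
      using co[OF v id_closed] co[OF v \<rho>(1)] \<rho>(2) glide_id \<open>a = 0\<close> by simp
    then show "\<exists>k. \<forall>v\<in>verts G. U $ (v, 1) = k \<and> U $ (v, 2) = 0" by blast
  qed
next
  assume rigid: "\<forall>U\<in>motions p edges. \<exists>k. \<forall>v\<in>verts G. U $ (v, 1) = k \<and> U $ (v, 2) = 0"
  show "symmetrically_rigid \<Gamma> G m p"
    unfolding symmetrically_rigid_def
  proof (intro allI impI)
    fix u assume u: "symmetric_motion \<Gamma> G m p u"
    obtain k where k: "\<And>v. v \<in> verts G \<Longrightarrow> u (v, id) $ 1 = k \<and> u (v, id) $ 2 = 0"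
      using rigid symmetric_motion_vector[OF u] by (auto simp: motion_vector_def)
    have "u x = (0 :: real^2^2) *v derived_pos p x + vector [k, 0]" if x: "x \<in> derived_verts \<Gamma> G" for x
    proof -
      obtain v \<gamma> where x': "x = (v, \<gamma>)" "v \<in> verts G" "\<gamma> \<in> carrier \<Gamma>" using x by (auto simp: derived_verts_def)
      have "u x = linear_part \<gamma> (u (v, id))"
        using u x' unfolding symmetric_motion_def one_id by blast
      then have "u x $ 1 = k" "u x $ 2 = 0"
        using pm_apply(5,6)[OF in_pm[OF x'(3)], of "u (v, id)"] k[OF x'(2)] by simp_all
      then show ?thesis by (simp add: vec_eq_iff forall_2)
    qed
    moreover have "transpose (0 :: real^2^2) = - 0" by (simp add: transpose_def vec_eq_iff)
    ultimately show "trivial_motion \<Gamma> G p u" unfolding trivial_motion_def by blast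
  qed
qed

text \<open>Horizontal translation is always a motion, and rigidity says that it spans the kernel on
  \<open>verts G\<close>. Counting over all vertices, not only ends of edges, takes isolated
  vertices into account.\<close>

lemma rigid_count:
  assumes "indep UNIV p edges"
  shows "symmetrically_rigid \<Gamma> G m p \<longleftrightarrow> 2 * card (verts G) \<le> card (arcs G) + 1"
proof -
  let ?\<Phi> = "\<lambda>k :: real. rigid_motion p (\<lambda>_. 0) (\<lambda>_. 0) (\<lambda>_. False) (verts G) (k, 0, 0)"
  have fin: "finite edges" by simp
  have sub: "range ?\<Phi> \<subseteq> motions p edges \<inter> supported (verts G)"
    using rigid_motion_all[OF ends_edges, where p = p] rigid_motion_supported by blast
  have x: "?\<Phi> k $ (v, 1) = k" "?\<Phi> k $ (v, 2) = 0" if "v \<in> verts G" for v k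
    using that by (simp_all add: rigid_motion_def)
  show ?thesis
  proof
    assume rigid: "symmetrically_rigid \<Gamma> G m p"
    have "U \<in> range ?\<Phi>" if U: "U \<in> motions p edges \<inter> supported (verts G)" for U
    proof -
      from U have "U \<in> motions p edges" by blast
      with rigid obtain k where k: "\<forall>v\<in>verts G. U $ (v, 1) = k \<and> U $ (v, 2) = 0"
        unfolding symmetrically_rigid_iff by blast
      have "U = ?\<Phi> k" using U k by (intro rigid_motionI) (auto simp: moves_def)
      then show ?thesis by blast
    qed
    then have "2 * card (verts G) \<le> card edges + DIM(real)"
      by (intro count_ge[OF fin assms ends_edges linear_rigid_motion1]) blast
    then show "2 * card (verts G) \<le> card (arcs G) + 1" by (simp add: card_edge)
  next
    assume "2 * card (verts G) \<le> card (arcs G) + 1"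
    then have "2 * card (verts G) \<le> card edges + DIM(real)" by (simp add: card_edge)
    then have eq: "motions p edges \<inter> supported (verts G) = range ?\<Phi>"
      by (intro count_eq[OF fin assms ends_edges linear_rigid_motion1 inj_rigid_motion1[OF verts_nonempty] sub])
    show "symmetrically_rigid \<Gamma> G m p"
      unfolding symmetrically_rigid_iff
    proof
      fix U assume "U \<in> motions p edges"
      then have "(\<chi> i. if fst i \<in> verts G then U $ i else 0) \<in> range ?\<Phi>"
        using restrict_motion[OF _ ends_edges, of U p] eq by blast
      then obtain k where k: "(\<chi> i. if fst i \<in> verts G then U $ i else 0) = ?\<Phi> k" by blast
      have "U $ (v, 1) = k \<and> U $ (v, 2) = 0" if "v \<in> verts G" for v
        using arg_cong[OF k, of "\<lambda>x. x $ (v, 1)"] arg_cong[OF k, of "\<lambda>x. x $ (v, 2)"] x[OF that, of k] that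
        by simp
      then show "\<exists>k. \<forall>v\<in>verts G. U $ (v, 1) = k \<and> U $ (v, 2) = 0" by blast
    qed
  qed
qed

text \<open>Independent rows are nonzero, so \<open>q\<close> is automatically a configuration and
  competes for the maximal rank.\<close>

lemma generic_indep:
  assumes "indep UNIV q edges" "generic \<Gamma> G m p"
  shows "indep UNIV p edges"
proof -
  have "dX q (edge e) \<noteq> 0 \<or> dY q (edge e) \<noteq> 0" if "e \<in> arcs G" for e
    using indep_row_nonzero[OF assms(1)] that by simp
  then have "configuration \<Gamma> G m q" using configurationI by blast
  then have "rank (orbit_matrix \<Gamma> G m q) \<le> rank (orbit_matrix \<Gamma> G m p)"
    using assms(2) by (auto simp: generic_def)
  with assms(1) show ?thesis unfolding rank_eq_iff by linarith
qed

lemma minimally_rigid_iff: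
  "minimally_rigid \<Gamma> G m \<longleftrightarrow> gain_sparse edges \<and> card (arcs G) + 1 = 2 * card (verts G)"
proof
  assume rigid: "minimally_rigid \<Gamma> G m"
  obtain p where "generic \<Gamma> G m p" using generic_exists by blast
  then have p: "indep UNIV p edges" "symmetrically_rigid \<Gamma> G m p"
    using rigid row_independent_iff by (auto simp: minimally_rigid_def gain_rigid_def gain_independent_def)
  have sp: "gain_sparse edges" by (rule indep_sparse[OF p(1)]) simp
  have "card (arcs G) + 1 \<le> 2 * card (verts G)"
  proof (cases "arcs G = {}")
    case True
    \<comment> \<open>\<open>gain_sparse\<close> speaks of nonempty edge sets only; for an edgeless
      graph the bound comes from having a vertex.\<close>
    have "0 < card (verts G)" using verts_nonempty by (simp add: card_gt_0_iff)
    moreover have "card (arcs G) = 0" using True by simp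
    ultimately show ?thesis by linarith
  next
    case False
    then have "card (arcs G) + 1 \<le> 2 * card (ends edges)"
      using sparseD(1)[OF sp order_refl] by (simp add: card_edge)
    moreover have "card (ends edges) \<le> card (verts G)" by (rule card_mono[OF _ ends_edges]) simp
    ultimately show ?thesis by linarith
  qed
  with sp rigid_count[OF p(1)] p(2) show "gain_sparse edges \<and> card (arcs G) + 1 = 2 * card (verts G)"
    by linarith
next
  assume sp: "gain_sparse edges \<and> card (arcs G) + 1 = 2 * card (verts G)"
  have "\<forall>e\<in>edges. shy e \<in> \<int>" using pm_apply(4)[OF in_pm[OF m_closed']] by auto
  then obtain q where q: "indep UNIV q edges" using sparse_imp_indep[of edges] sp by auto
  have "indep UNIV p edges" if "generic \<Gamma> G m p" for p using generic_indep[OF q that] .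
  then show "minimally_rigid \<Gamma> G m"
    using sp rigid_count row_independent_iff
    by (auto simp: minimally_rigid_def gain_rigid_def gain_independent_def)
qed

end

theorem theorem5p29:
  fixes \<Gamma> :: "plane_map monoid"
    and G :: "('v::finite, 'e::finite) pre_digraph"
    and m :: "'e \<Rightarrow> plane_map"
  assumes "\<Gamma> \<in> {pm, cm, pg}"
    and "gain_graph \<Gamma> G m"
  shows "minimally_rigid \<Gamma> G m \<longleftrightarrow>
    kl_tight 2 1 G \<and>
    (\<forall>H. subgraph H G \<and> purely_periodic \<Gamma> H m \<longrightarrow> kl_sparse 2 2 H) \<and>
    (\<forall>H. subgraph H G \<and> balanced \<Gamma> H m \<longrightarrow> kl_sparse 2 3 H)"
proof -
  interpret gain_group \<Gamma> by (rule gain_group_cases[OF assms(1)])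
  interpret gain_digraph \<Gamma> G m by unfold_locales (rule assms(2))
  have "int (card (arcs G)) = 2 * int (card (verts G)) - 1 \<longleftrightarrow> card (arcs G) + 1 = 2 * card (verts G)"
    by linarith
  then show ?thesis
    unfolding minimally_rigid_iff sparse_edges_iff kl_tight_def by blast
qed

end
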